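(* Let $X$ be a discrete metric space (with the acting group $G$ trivial). Then the following are equivalent: (1) $X$ has property A. (2) $[\mathbf 1_Q]\in \operatorname{Im}\bigl(\pi_*:H_Q^0(X,\ell^1(X))\to H_Q^0(X,\mathbb C)\bigr)$. (3) $D[\mathbf 1_Q]=0$ in $H_Q^1(X,\ell^1_0(X))$. (4) $D[\mathbf 1_W]=0$ in $H_W^1(X,\ell^1_0(X))$. (5) $[\mathbf 1_W]\in \operatorname{Im}\bigl(\pi_*:H_W^0(X,\ell^1(X))\to H_W^0(X,\mathbb C)\bigr)$. (6) $X$ admits an asymptotically invariant mean.
   Context: **Property A.** A metric space $X$ has property A if for each $x\in X$ and $n\in\mathbb N$ there is $f_n(x)\in\mathrm{Prob}(X)$ (non-negative functions in $\ell^1(X)$ of $\ell^1$-norm 1) and a sequence $S_n$ such that $\mathrm{Supp}(f_n(x))\subseteq B_{S_n}(x)$ for all $x,n$, and for every $R\ge 0$, $\|f_n(x_1)-f_n(x_0)\|_{\ell^1}\to 0$ as $n\to\infty$ uniformly on $\{(x_0,x_1): d(x_0,x_1)\le R\}$. Here $B_S(x)$ is the ball of radius $S$ about $x$. **Modules.** An $X$-module is a triple $\mathcal V=(V,\|\cdot\|_V,\mathrm{Supp})$ with $(V,\|\cdot\|_V)$ a Banach space and $\mathrm{Supp}$ a function from $V$ to subsets of $X$ such that: $\mathrm{Supp}(0)=\emptyset$; $\mathrm{Supp}(v+w)\subseteq\mathrm{Supp}(v)\cup\mathrm{Supp}(w)$; $\mathrm{Supp}(\lambda v)=\mathrm{Supp}(v)$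 for $\lambda\neq0$; and if $v_n\to v$ then $\mathrm{Supp}(v)\subseteq\bigcup_n\mathrm{Supp}(v_n)$. The modules used here are: $\ell^1(X)$ (complex valued) and its closed subspace $\ell^1_0(X)=\{f:\sum_x f(x)=0\}$, both with $\mathrm{Supp}(f)=\{x: f(x)\ne0\}$; and $\mathbb C$ with $\mathrm{Supp}(\lambda)=\emptyset$ for all $\lambda$. Let $\iota:\ell^1_0(X)\to\ell^1(X)$ be the inclusion and $\pi:\ell^1(X)\to\mathbb C$, $\pi(f)=\sum_x f(x)$. **Bicomplex.** For $R>0$ let $\Delta_R^{p+1}=\{\mathbf x=(x_0,\dots,x_p)\in X^{p+1}: d(x_i,x_j)\le R\ \forall i,j\}$ and let $\Delta_R^{p+1,q+1}$ be the set of $(\mathbf x,\mathbf y)\in X^{p+1}\times X^{q+1}$ all of whose coordinates $x_0,\dots,x_p,y_0,\dots,y_q$ are pairwise at distance $\le R$. ($X^0$ is a single point, the empty tuple, suppressed from the notation.) A function $\phi:X^{p+1}\times X^{q+1}\to V$ is of controlled supports if for every $R>0$ there is $S>0$ such that for $(\mathbf x,\mathbf y)\in\Delta_R^{p+1,q+1}$ the set $\mathrm{Supp}(\phi(\mathbf x,\mathbf y))$ is contained in $B_S(x_i)$ and $B_S(y_j)$ for all $i,j$. Put $\|\phi\|_R=\sup_{\mathbf x\in\Delta_R^{p+1},\,\mathbf y\in X^{q+1}}\|\phi(\mathbf x,\mathbf y)\|_V$. For $p\ge 0$, $q\ge-1$, $\mathcal E^{p,q}(X,\mathcal V)$ is the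 space of functions $\phi:X^{p+1}\times X^{q+1}\to V$ of controlled supports with $\|\phi\|_R<\infty$ for all $R>0$, topologised by the seminorms $\|\cdot\|_R$, $R\in\mathbb N$. The continuous anticommuting differentials $D:\mathcal E^{p,q}\to\mathcal E^{p+1,q}$ and $d:\mathcal E^{p,q}\to\mathcal E^{p,q+1}$ are $D\phi((x_0,\dots,x_{p+1}),\mathbf y)=\sum_{i=0}^{p+1}(-1)^i\phi((x_0,\dots,\widehat{x_i},\dots,x_{p+1}),\mathbf y)$ and $d\phi(\mathbf x,(y_0,\dots,y_{q+1}))=\sum_{i=0}^{q+1}(-1)^{i+p}\phi(\mathbf x,(y_0,\dots,\widehat{y_i},\dots,y_{q+1}))$. **Completions.** For a vector space $\mathcal E$ with an increasing countable family of seminorms $\|\cdot\|_i$ separating points: the quotient completion $\mathcal E_Q$ is the space of sequences in $\mathcal E$ bounded for every seminorm, modulo sequences converging to 0 for every seminorm. For $\alpha$ in the continuous dual $\mathcal E^*$ put $\|\alpha\|^i=\sup\{|\alpha(\phi)|:\|\phi\|_i\le1\}\in[0,\infty]$. The weak-* completion $\mathcal E_W=\mathcal E^{**}$ is the space of linear functionals $\eta$ on $\mathcal E^*$ with $\sup\{|\eta(\alpha)|:\|\alpha\|^i\le1\}<\infty$ for every $i$, with the weak-* topology. $I_Q:\mathcal E\to\mathcal E_Q$ (constant sequences) and $I_W:\mathcal E\to\mathcal E_W$ (evaluation) are the canonical inclusions. Continuous linear maps extend termwise to $\mathcal E_Q$ and by double transpose to $\mathcal E_W$; extensions are denoted by the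 same symbols. Write $\mathcal E_Q^{p,q}(X,\mathcal V)$, $\mathcal E_W^{p,q}(X,\mathcal V)$ for the completions of $\mathcal E^{p,q}(X,\mathcal V)$. **Cohomology.** For $\sim\,\in\{Q,W\}$, $H_\sim^*(X,\mathcal V)$ is the cohomology of the totalisation (degree $n$ part $\bigoplus_{p+q=n,\ p,q\ge0}\mathcal E_\sim^{p,q}(X,\mathcal V)$, differential $D+d$). The short exact sequence $0\to\ell^1_0(X)\xrightarrow{\iota}\ell^1(X)\xrightarrow{\pi}\mathbb C\to0$ induces (by composition of functions with $\iota,\pi$) short exact sequences of the bicomplexes $\mathcal E_\sim^{*,*}$, hence a long exact sequence; $\pi_*$ is the induced map and $D:H_\sim^0(X,\mathbb C)\to H_\sim^1(X,\ell^1_0(X))$ also denotes its connecting homomorphism. $\mathbf 1\in\mathcal E^{0,-1}(X,\mathbb C)$ is the constant function 1 on $X$, which under the inclusion $d:\mathcal E^{0,-1}\to\mathcal E^{0,0}$ becomes the constant function 1 on $X\times X$; its images under $I_Q,I_W$, denoted $\mathbf 1_Q,\mathbf 1_W$, are cocycles, with classes $[\mathbf 1_Q]\in H_Q^0(X,\mathbb C)$ and $[\mathbf 1_W]\in H_W^0(X,\mathbb C)$. **Asymptotically invariant mean.** An asymptotically invariant mean for $X$ is an element $\mu\in\mathcal E_W^{0,-1}(X,\ell^1(X))$ such that $D\mu=0$ and $\pi_*(\mu)=\mathbf 1_W$ in $\mathcal E_W^{0,-1}(X,\mathbb C)$. *)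

theory Defs
  imports "HOL-Analysis.Analysis" "HOL-Library.Function_Algebras" "HOL-Algebra.Product_Groups"
begin

section \<open>Complex vector spaces and seminormed spaces\<close>

class complex_vector = ab_group_add +
  fixes scaleC :: "complex \<Rightarrow> 'a \<Rightarrow> 'a" (infixr "*\<^sub>C" 75)
  assumes scaleC_add_right: "c *\<^sub>C (x + y) = c *\<^sub>C x + c *\<^sub>C y"
    and scaleC_add_left: "(b + c) *\<^sub>C x = b *\<^sub>C x + c *\<^sub>C x"
    and scaleC_scaleC: "b *\<^sub>C c *\<^sub>C x = (b * c) *\<^sub>C x"
    and scaleC_one: "1 *\<^sub>C x = x"

instantiation complex :: complex_vector
begin

definition scaleC_complex_def [simp]: "c *\<^sub>C (x :: complex) = c * x"

instance by standard (simp_all add: algebra_simps)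

end

instantiation "fun" :: (type, complex_vector) complex_vector
begin

definition scaleC_fun_def: "c *\<^sub>C f = (\<lambda>x. c *\<^sub>C f x)"

instance
  by standard (simp_all add: scaleC_fun_def plus_fun_def scaleC_add_right scaleC_add_left
      scaleC_scaleC scaleC_one)

end

lemma scaleC_fun_apply [simp]: "(c *\<^sub>C f) x = c *\<^sub>C f x"
  by (simp add: scaleC_fun_def)

definition csubspace :: "'v::complex_vector set \<Rightarrow> bool" where
  "csubspace V \<longleftrightarrow> 0 \<in> V \<and> (\<forall>v\<in>V. \<forall>w\<in>V. v + w \<in> V) \<and> (\<forall>c. \<forall>v\<in>V. c *\<^sub>C v \<in> V)"

definition clinear_on :: "'v::complex_vector set \<Rightarrow> ('v \<Rightarrow> complex) \<Rightarrow> bool" where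
  "clinear_on V f \<longleftrightarrow> (\<forall>v\<in>V. \<forall>w\<in>V. f (v + w) = f v + f w) \<and> (\<forall>c. \<forall>v\<in>V. f (c *\<^sub>C v) = c * f v)"

text \<open>Throughout, a function whose domain is a set \<open>A\<close> is represented by the total function that is
  \<open>0\<close> outside \<open>A\<close>.  Spaces of functions on \<open>A\<close> are thus subspaces of function types, with the
  pointwise operations.\<close>

definition vanishes_off :: "'a set \<Rightarrow> ('a \<Rightarrow> 'b::zero) \<Rightarrow> bool" where
  "vanishes_off A f \<longleftrightarrow> (\<forall>x. x \<notin> A \<longrightarrow> f x = 0)"

record 'e seminormed =
  sn_space :: "'e set"
  sn_norm :: "nat \<Rightarrow> 'e \<Rightarrow> ennreal"

definition sn_topology :: "'e::complex_vector seminormed \<Rightarrow> 'e topology" where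
  "sn_topology E = topology_generated_by
     {{\<psi> \<in> sn_space E. sn_norm E i (\<psi> - \<phi>) < ennreal r} | \<phi> i r. \<phi> \<in> sn_space E \<and> r > 0}"


section \<open>Completions\<close>

text \<open>Completions, and later cohomology groups, are recorded as (additive) groups in the sense of
  HOL-Algebra: the group operation \<open>\<otimes>\<close> is addition.\<close>

definition additive_group :: "'e::ab_group_add set \<Rightarrow> 'e monoid" where
  "additive_group V = \<lparr>carrier = V, monoid.mult = (+), one = 0\<rparr>"

subsection \<open>The quotient completion\<close>

definition bounded_seqs :: "'e::complex_vector seminormed \<Rightarrow> (nat \<Rightarrow> 'e) set" where
  "bounded_seqs E = {s. (\<forall>n. s n \<in> sn_space E) \<and> (\<forall>i. (SUP n. sn_norm E i (s n)) < \<infinity>)}"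

definition null_seqs :: "'e::complex_vector seminormed \<Rightarrow> (nat \<Rightarrow> 'e) set" where
  "null_seqs E = {s \<in> bounded_seqs E. \<forall>i. (\<lambda>n. sn_norm E i (s n)) \<longlonglongrightarrow> 0}"

definition Q_completion :: "'e::complex_vector seminormed \<Rightarrow> (nat \<Rightarrow> 'e) set monoid" where
  "Q_completion E = additive_group (bounded_seqs E) Mod null_seqs E"

definition Q_class :: "'e::complex_vector seminormed \<Rightarrow> (nat \<Rightarrow> 'e) \<Rightarrow> (nat \<Rightarrow> 'e) set" where
  "Q_class E s = null_seqs E #>\<^bsub>additive_group (bounded_seqs E)\<^esub> s"

definition Q_incl :: "'e::complex_vector seminormed \<Rightarrow> 'e \<Rightarrow> (nat \<Rightarrow> 'e) set" where
  "Q_incl E \<phi> = Q_class E (\<lambda>n. \<phi>)"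

text \<open>The extension of a continuous linear map \<open>T\<close> into \<open>F\<close>; all representatives of a class yield
  the same class, so that the union is that class.\<close>

definition Q_map :: "'f::complex_vector seminormed \<Rightarrow> ('e \<Rightarrow> 'f)
    \<Rightarrow> (nat \<Rightarrow> 'e) set \<Rightarrow> (nat \<Rightarrow> 'f) set" where
  "Q_map F T c = (\<Union>s\<in>c. Q_class F (\<lambda>n. T (s n)))"

subsection \<open>The weak-* completion\<close>

definition cdual :: "'e::complex_vector seminormed \<Rightarrow> ('e \<Rightarrow> complex) set" where
  "cdual E = {\<alpha>. clinear_on (sn_space E) \<alpha> \<and> continuous_map (sn_topology E) euclidean \<alpha>
                \<and> vanishes_off (sn_space E) \<alpha>}"

definition dual_norm :: "'e::complex_vector seminormed \<Rightarrow> nat \<Rightarrow> ('e \<Rightarrow> complex) \<Rightarrow> ennreal" where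
  "dual_norm E i \<alpha> = (SUP \<phi> \<in> {\<phi> \<in> sn_space E. sn_norm E i \<phi> \<le> 1}. ennreal (cmod (\<alpha> \<phi>)))"

definition bidual :: "'e::complex_vector seminormed \<Rightarrow> (('e \<Rightarrow> complex) \<Rightarrow> complex) set" where
  "bidual E = {\<eta>. clinear_on (cdual E) \<eta> \<and> vanishes_off (cdual E) \<eta> \<and>
     (\<forall>i. (SUP \<alpha> \<in> {\<alpha> \<in> cdual E. dual_norm E i \<alpha> \<le> 1}. ennreal (cmod (\<eta> \<alpha>))) < \<infinity>)}"

definition W_completion :: "'e::complex_vector seminormed \<Rightarrow> (('e \<Rightarrow> complex) \<Rightarrow> complex) monoid" where
  "W_completion E = additive_group (bidual E)"

definition W_incl :: "'e::complex_vector seminormed \<Rightarrow> 'e \<Rightarrow> (('e \<Rightarrow> complex) \<Rightarrow> complex)" where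
  "W_incl E \<phi> = (\<lambda>\<alpha>. if \<alpha> \<in> cdual E then \<alpha> \<phi> else 0)"

definition transpose_map :: "'e::complex_vector seminormed \<Rightarrow> ('e \<Rightarrow> 'f)
    \<Rightarrow> ('f \<Rightarrow> complex) \<Rightarrow> ('e \<Rightarrow> complex)" where
  "transpose_map E T \<beta> = (\<lambda>\<phi>. if \<phi> \<in> sn_space E then \<beta> (T \<phi>) else 0)"

definition W_map :: "'e::complex_vector seminormed \<Rightarrow> 'f::complex_vector seminormed \<Rightarrow> ('e \<Rightarrow> 'f)
    \<Rightarrow> (('e \<Rightarrow> complex) \<Rightarrow> complex) \<Rightarrow> (('f \<Rightarrow> complex) \<Rightarrow> complex)" where
  "W_map E F T \<eta> = (\<lambda>\<beta>. if \<beta> \<in> cdual F then \<eta> (transpose_map E T \<beta>) else 0)"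


section \<open>Modules over a metric space\<close>

record ('x, 'v) xmodule =
  m_space :: "'v set"
  m_norm :: "'v \<Rightarrow> real"
  m_supp :: "'v \<Rightarrow> 'x set"

locale X_module =
  fixes X :: "'x::metric_space set" and M :: "('x, 'v::complex_vector) xmodule"
  assumes subspace: "csubspace (m_space M)"
    and norm_nonneg: "v \<in> m_space M \<Longrightarrow> 0 \<le> m_norm M v"
    and norm_eq_0: "v \<in> m_space M \<Longrightarrow> m_norm M v = 0 \<longleftrightarrow> v = 0"
    and norm_triangle: "\<lbrakk>v \<in> m_space M; w \<in> m_space M\<rbrakk> \<Longrightarrow> m_norm M (v + w) \<le> m_norm M v + m_norm M w"
    and norm_scale: "v \<in> m_space M \<Longrightarrow> m_norm M (c *\<^sub>C v) = cmod c * m_norm M v"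
    and complete: "\<lbrakk>\<And>n. s n \<in> m_space M;
                    \<And>e. e > 0 \<Longrightarrow> \<exists>N. \<forall>m\<ge>N. \<forall>n\<ge>N. m_norm M (s m - s n) < e\<rbrakk>
                  \<Longrightarrow> \<exists>v\<in>m_space M. (\<lambda>n. m_norm M (s n - v)) \<longlonglongrightarrow> 0"
    and supp_subset: "v \<in> m_space M \<Longrightarrow> m_supp M v \<subseteq> X"
    and supp_zero: "m_supp M 0 = {}"
    and supp_add: "\<lbrakk>v \<in> m_space M; w \<in> m_space M\<rbrakk> \<Longrightarrow> m_supp M (v + w) \<subseteq> m_supp M v \<union> m_supp M w"
    and supp_scale: "\<lbrakk>v \<in> m_space M; c \<noteq> 0\<rbrakk> \<Longrightarrow> m_supp M (c *\<^sub>C v) = m_supp M v"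
    and supp_limit: "\<lbrakk>\<And>n. s n \<in> m_space M; v \<in> m_space M; (\<lambda>n. m_norm M (s n - v)) \<longlonglongrightarrow> 0\<rbrakk>
                     \<Longrightarrow> m_supp M v \<subseteq> (\<Union>n. m_supp M (s n))"

definition l1 :: "'x set \<Rightarrow> ('x, 'x \<Rightarrow> complex) xmodule" where
  "l1 X = \<lparr>m_space = {f. (\<lambda>x. cmod (f x)) summable_on X \<and> vanishes_off X f},
           m_norm = (\<lambda>f. \<Sum>\<^sub>\<infinity>x\<in>X. cmod (f x)),
           m_supp = (\<lambda>f. {x \<in> X. f x \<noteq> 0})\<rparr>"

definition l1_sum :: "'x set \<Rightarrow> ('x \<Rightarrow> complex) \<Rightarrow> complex" where
  "l1_sum X f = (\<Sum>\<^sub>\<infinity>x\<in>X. f x)"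

definition l1_0 :: "'x set \<Rightarrow> ('x, 'x \<Rightarrow> complex) xmodule" where
  "l1_0 X = (l1 X)\<lparr>m_space := {f \<in> m_space (l1 X). l1_sum X f = 0}\<rparr>"

definition scalars :: "('x, complex) xmodule" where
  "scalars = \<lparr>m_space = UNIV, m_norm = cmod, m_supp = (\<lambda>_. {})\<rparr>"


lemma l1_selectors [simp]:
  "f \<in> m_space (l1 X) \<longleftrightarrow> (\<lambda>x. cmod (f x)) summable_on X \<and> vanishes_off X f"
  "m_norm (l1 X) f = (\<Sum>\<^sub>\<infinity>x\<in>X. cmod (f x))"
  "m_supp (l1 X) f = {x \<in> X. f x \<noteq> 0}"
  by (simp_all add: l1_def)

lemma l1_0_selectors [simp]:
  "f \<in> m_space (l1_0 X) \<longleftrightarrow> f \<in> m_space (l1 X) \<and> l1_sum X f = 0"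
  "m_norm (l1_0 X) f = m_norm (l1 X) f"
  "m_supp (l1_0 X) f = m_supp (l1 X) f"
  by (simp_all add: l1_0_def)

lemma l1_csubspace: "csubspace (m_space (l1 X))"
proof -
  have "(\<lambda>x. cmod (f x + g x)) summable_on X"
    if "(\<lambda>x. cmod (f x)) summable_on X" "(\<lambda>x. cmod (g x)) summable_on X" for f g :: "'a \<Rightarrow> complex"
    by (rule summable_on_comparison_test[OF summable_on_add[OF that]]) (auto simp: norm_triangle_ineq)
  then show ?thesis
    by (auto simp: csubspace_def vanishes_off_def norm_mult intro: summable_on_cmult_right)
qed

lemma l1_diff: "f \<in> m_space (l1 X) \<Longrightarrow> g \<in> m_space (l1 X) \<Longrightarrow> f - g \<in> m_space (l1 X)"
proof -
  assume a: "f \<in> m_space (l1 X)" "g \<in> m_space (l1 X)"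
  then have "f + (-1) *\<^sub>C g \<in> m_space (l1 X)"
    using l1_csubspace[of X] unfolding csubspace_def by blast
  moreover have "f + (-1) *\<^sub>C g = f - g"
    by (auto simp: fun_eq_iff)
  ultimately show ?thesis by (simp only:)
qed

lemma l1_norm_triangle:
  assumes "f \<in> m_space (l1 X)" "g \<in> m_space (l1 X)"
  shows "m_norm (l1 X) (f + g) \<le> m_norm (l1 X) f + m_norm (l1 X) g"
proof -
  have s: "(\<lambda>x. cmod (f x)) summable_on X" "(\<lambda>x. cmod (g x)) summable_on X"
    using assms by auto
  have "f + g \<in> m_space (l1 X)"
    using assms l1_csubspace[of X] unfolding csubspace_def by blast
  then have "(\<Sum>\<^sub>\<infinity>x\<in>X. cmod (f x + g x)) \<le> (\<Sum>\<^sub>\<infinity>x\<in>X. cmod (f x) + cmod (g x))"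
    by (intro infsum_mono summable_on_add s) (auto simp: norm_triangle_ineq)
  then show ?thesis
    by (simp add: infsum_add[OF s])
qed

lemma l1_point_le_norm:
  assumes "f \<in> m_space (l1 X)"
  shows "cmod (f x) \<le> m_norm (l1 X) f"
proof (cases "x \<in> X")
  case True
  have "sum (\<lambda>x. cmod (f x)) {x} \<le> (\<Sum>\<^sub>\<infinity>x\<in>X. cmod (f x))"
    using assms True by (intro finite_sum_le_infsum) auto
  then show ?thesis by simp
next
  case False
  then show ?thesis using assms by (simp add: vanishes_off_def infsum_nonneg)
qed

lemma l1_complete:
  assumes s: "\<And>n. s n \<in> m_space (l1 X)"
    and c: "\<And>e. e > 0 \<Longrightarrow> \<exists>N. \<forall>m\<ge>N. \<forall>n\<ge>N. m_norm (l1 X) (s m - s n) < e"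
  shows "\<exists>f\<in>m_space (l1 X). (\<lambda>n. m_norm (l1 X) (s n - f)) \<longlonglongrightarrow> 0"
proof -
  have pt: "cmod (s m x - s n x) \<le> m_norm (l1 X) (s m - s n)" for m n x
    using l1_point_le_norm[OF l1_diff[OF s s]] by (metis minus_apply)
  have "Cauchy (\<lambda>n. s n x)" for x
  proof (rule metric_CauchyI)
    fix e :: real assume "e > 0"
    with c obtain N where "\<forall>m\<ge>N. \<forall>n\<ge>N. m_norm (l1 X) (s m - s n) < e" by blast
    then show "\<exists>M. \<forall>m\<ge>M. \<forall>n\<ge>M. dist (s m x) (s n x) < e"
      unfolding dist_norm using pt order_le_less_trans by blast
  qed
  then have "\<exists>l. (\<lambda>n. s n x) \<longlonglongrightarrow> l" for x
    using Cauchy_convergent convergent_def by blast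
  then obtain f where f: "(\<lambda>n. s n x) \<longlonglongrightarrow> f x" for x by metis
  have off: "vanishes_off X f"
    unfolding vanishes_off_def
  proof (intro allI impI)
    fix x assume "x \<notin> X"
    then have "s n x = 0" for n using s[of n] by (simp add: vanishes_off_def)
    then show "f x = 0" using f[of x] by (simp add: LIMSEQ_const_iff)
  qed
  have key: "s n - f \<in> m_space (l1 X) \<and> m_norm (l1 X) (s n - f) \<le> e"
    if N: "\<forall>m\<ge>N. \<forall>n\<ge>N. m_norm (l1 X) (s m - s n) < e" and n: "n \<ge> N" for e N n
  proof -
    have fin: "(\<Sum>x\<in>F. cmod (s n x - f x)) \<le> e" if F: "finite F" "F \<subseteq> X" for F
    proof (rule LIMSEQ_le_const2)
      show "(\<lambda>m. \<Sum>x\<in>F. cmod (s n x - s m x)) \<longlonglongrightarrow> (\<Sum>x\<in>F. cmod (s n x - f x))"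
        by (intro tendsto_intros f)
      have "(\<Sum>x\<in>F. cmod (s n x - s m x)) \<le> e" if "m \<ge> N" for m
      proof -
        have "(\<Sum>x\<in>F. cmod ((s n - s m) x)) \<le> (\<Sum>\<^sub>\<infinity>x\<in>X. cmod ((s n - s m) x))"
          using l1_diff[OF s s, of n m] F by (intro finite_sum_le_infsum) auto
        also have "\<dots> \<le> e" using N n that by (metis l1_selectors(2) less_imp_le)
        finally show ?thesis by simp
      qed
      then show "\<exists>N. \<forall>m\<ge>N. (\<Sum>x\<in>F. cmod (s n x - s m x)) \<le> e" by blast
    qed
    have "bdd_above (sum (\<lambda>x. cmod (s n x - f x)) ` {F. F \<subseteq> X \<and> finite F})"
      using fin by (auto intro!: bdd_aboveI)
    then have sm: "(\<lambda>x. cmod (s n x - f x)) summable_on X"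
      by (intro nonneg_bdd_above_summable_on) auto
    then have "(\<Sum>\<^sub>\<infinity>x\<in>X. cmod (s n x - f x)) \<le> e"
      using fin by (intro infsum_le_finite_sums) auto
    moreover have "vanishes_off X (s n - f)"
      using off s[of n] by (simp add: vanishes_off_def)
    ultimately show ?thesis using sm by simp
  qed
  obtain N where "\<forall>m\<ge>N. \<forall>n\<ge>N. m_norm (l1 X) (s m - s n) < 1"
    using c[of 1] by auto
  from key[OF this order_refl] have "s N - (s N - f) \<in> m_space (l1 X)"
    by (blast intro: l1_diff s)
  moreover have "s N - (s N - f) = f" by (simp add: fun_eq_iff)
  ultimately have fl: "f \<in> m_space (l1 X)" by (simp only:)
  have "(\<lambda>n. m_norm (l1 X) (s n - f)) \<longlonglongrightarrow> 0"
  proof (rule LIMSEQ_I)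
    fix e :: real assume "e > 0"
    then obtain N where N: "\<forall>m\<ge>N. \<forall>n\<ge>N. m_norm (l1 X) (s m - s n) < e / 2"
      using c[of "e / 2"] by auto
    have "norm (m_norm (l1 X) (s n - f) - 0) < e" if "n \<ge> N" for n
    proof -
      have "m_norm (l1 X) (s n - f) \<le> e / 2" using key[OF N that] by blast
      moreover have "m_norm (l1 X) (s n - f) \<ge> 0" by (simp add: infsum_nonneg)
      ultimately show ?thesis using \<open>e > 0\<close> by simp
    qed
    then show "\<exists>N. \<forall>n\<ge>N. norm (m_norm (l1 X) (s n - f) - 0) < e" by blast
  qed
  with fl show ?thesis by blast
qed

lemma l1_limit_zero:
  assumes "\<And>n. s n \<in> m_space (l1 X)" "f \<in> m_space (l1 X)"
    and "(\<lambda>n. m_norm (l1 X) (s n - f)) \<longlonglongrightarrow> 0" and "\<And>n. s n x = 0"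
  shows "f x = 0"
proof -
  have "cmod (f x) \<le> m_norm (l1 X) (s n - f)" for n
    using l1_point_le_norm[OF l1_diff[OF assms(1)[of n] assms(2)], of x] assms(4)[of n]
    by (simp only: minus_apply) simp
  then have "cmod (f x) \<le> 0" using assms(3) by (intro LIMSEQ_le_const) auto
  then show ?thesis by simp
qed

lemma X_module_l1: "X_module X (l1 X)"
proof
  fix f assume f: "f \<in> m_space (l1 X)"
  show "m_norm (l1 X) f = 0 \<longleftrightarrow> f = 0"
    using l1_point_le_norm[OF f] by (auto simp: fun_eq_iff)
next
  fix s :: \<open>nat \<Rightarrow> 'a \<Rightarrow> complex\<close> and f assume s: "\<And>n. s n \<in> m_space (l1 X)" "f \<in> m_space (l1 X)"
    "(\<lambda>n. m_norm (l1 X) (s n - f)) \<longlonglongrightarrow> 0"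
  show "m_supp (l1 X) f \<subseteq> (\<Union>n. m_supp (l1 X) (s n))"
    using l1_limit_zero[OF s] by auto
next
  fix s :: \<open>nat \<Rightarrow> 'a \<Rightarrow> complex\<close> assume "\<And>n. s n \<in> m_space (l1 X)"
    "\<And>e. e > 0 \<Longrightarrow> \<exists>N. \<forall>m\<ge>N. \<forall>n\<ge>N. m_norm (l1 X) (s m - s n) < e"
  then show "\<exists>v\<in>m_space (l1 X). (\<lambda>n. m_norm (l1 X) (s n - v)) \<longlonglongrightarrow> 0"
    by (rule l1_complete)
qed (use l1_csubspace l1_norm_triangle in
      \<open>auto simp: infsum_nonneg norm_mult infsum_cmult_right'\<close>)

lemma l1_sum_add:
  assumes "f \<in> m_space (l1 X)" "g \<in> m_space (l1 X)"
  shows "l1_sum X (f + g) = l1_sum X f + l1_sum X g"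
  using assms unfolding l1_sum_def plus_fun_def by (simp add: infsum_add abs_summable_summable)

lemma l1_sum_scale: "l1_sum X (c *\<^sub>C f) = c * l1_sum X f"
  unfolding l1_sum_def scaleC_fun_def by (simp add: infsum_cmult_right')

lemma l1_sum_diff:
  assumes "f \<in> m_space (l1 X)" "g \<in> m_space (l1 X)"
  shows "l1_sum X (f - g) = l1_sum X f - l1_sum X g"
  using l1_sum_add[OF l1_diff[OF assms] assms(2)] by simp

lemma l1_sum_bound: "f \<in> m_space (l1 X) \<Longrightarrow> cmod (l1_sum X f) \<le> m_norm (l1 X) f"
  unfolding l1_sum_def by (simp add: norm_infsum_bound)

lemma l1_0_csubspace: "csubspace (m_space (l1_0 X))"
proof -
  have "l1_sum X 0 = 0" by (simp add: l1_sum_def)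
  then show ?thesis
    using l1_csubspace[of X] l1_sum_add[of _ X] l1_sum_scale[of X]
    unfolding csubspace_def l1_0_selectors by simp
qed

lemma X_module_l1_0: "X_module X (l1_0 X)"
proof -
  interpret l1: X_module X "l1 X" by (rule X_module_l1)
  have sub: "f \<in> m_space (l1_0 X) \<Longrightarrow> f \<in> m_space (l1 X)" for f by simp
  show ?thesis
  proof
    fix s :: \<open>nat \<Rightarrow> 'a \<Rightarrow> complex\<close> assume s: "\<And>n. s n \<in> m_space (l1_0 X)"
      and "\<And>e. e > 0 \<Longrightarrow> \<exists>N. \<forall>m\<ge>N. \<forall>n\<ge>N. m_norm (l1_0 X) (s m - s n) < e"
    then obtain f where f: "f \<in> m_space (l1 X)" "(\<lambda>n. m_norm (l1 X) (s n - f)) \<longlonglongrightarrow> 0"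
      using l1.complete[of s] sub by (metis l1_0_selectors(2))
    have "cmod (l1_sum X f) \<le> m_norm (l1 X) (s n - f)" for n
    proof -
      have "l1_sum X (s n - f) = - l1_sum X f"
        using l1_sum_diff[OF sub[OF s] f(1), of n] s[of n] unfolding l1_0_selectors by simp
      then show ?thesis
        using l1_sum_bound[OF l1_diff[OF sub[OF s] f(1)], of n] by (metis norm_minus_cancel)
    qed
    then have "cmod (l1_sum X f) \<le> 0" using f(2) by (intro LIMSEQ_le_const) auto
    then show "\<exists>v\<in>m_space (l1_0 X). (\<lambda>n. m_norm (l1_0 X) (s n - v)) \<longlonglongrightarrow> 0"
      using f unfolding l1_0_selectors by (intro bexI[of _ f]) auto
  next
    fix s :: \<open>nat \<Rightarrow> 'a \<Rightarrow> complex\<close> and f assume "\<And>n. s n \<in> m_space (l1_0 X)" "f \<in> m_space (l1_0 X)"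
      "(\<lambda>n. m_norm (l1_0 X) (s n - f)) \<longlonglongrightarrow> 0"
    then show "m_supp (l1_0 X) f \<subseteq> (\<Union>n. m_supp (l1_0 X) (s n))"
      unfolding l1_0_selectors by (intro l1.supp_limit) auto
  next
    show "csubspace (m_space (l1_0 X))" by (rule l1_0_csubspace)
  qed (simp_all only: l1_0_selectors(2,3) sub l1.norm_nonneg l1.norm_eq_0 l1.norm_triangle
        l1.norm_scale l1.supp_subset l1.supp_zero l1.supp_add l1.supp_scale simp_thms)
qed

lemma X_module_scalars: "X_module X scalars"
proof
  fix s :: "nat \<Rightarrow> complex"
  assume "\<And>e. e > 0 \<Longrightarrow> \<exists>N. \<forall>m\<ge>N. \<forall>n\<ge>N. m_norm scalars (s m - s n) < e"
  then have "Cauchy s"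
    by (intro metric_CauchyI) (simp add: scalars_def dist_norm)
  then obtain l where "s \<longlonglongrightarrow> l" using Cauchy_convergent convergent_def by blast
  then show "\<exists>v\<in>m_space scalars. (\<lambda>n. m_norm scalars (s n - v)) \<longlonglongrightarrow> 0"
    by (intro bexI[of _ l]) (auto simp: scalars_def tendsto_norm_zero_iff LIM_zero_iff)
qed (auto simp: scalars_def csubspace_def norm_triangle_ineq norm_mult)


section \<open>Property A\<close>

definition prob_on :: "'x set \<Rightarrow> ('x \<Rightarrow> complex) set" where
  "prob_on X = {f \<in> m_space (l1 X). (\<forall>x\<in>X. f x \<in> \<real>\<^sub>\<ge>\<^sub>0) \<and> m_norm (l1 X) f = 1}"

definition property_A :: "'x::metric_space set \<Rightarrow> bool" where
  "property_A X \<longleftrightarrow> (\<exists>(f :: nat \<Rightarrow> 'x \<Rightarrow> 'x \<Rightarrow> complex) (S :: nat \<Rightarrow> real).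
     (\<forall>n. \<forall>x\<in>X. f n x \<in> prob_on X \<and> m_supp (l1 X) (f n x) \<subseteq> cball x (S n)) \<and>
     (\<forall>R\<ge>0. uniform_limit {(x0, x1). x0 \<in> X \<and> x1 \<in> X \<and> dist x0 x1 \<le> R}
               (\<lambda>n (x0, x1). m_norm (l1 X) (f n x1 - f n x0)) (\<lambda>_. 0) sequentially))"


section \<open>The bicomplex\<close>

text \<open>Tuples are lists; in bidegree \<open>(p, q)\<close> the arguments are lists of length \<open>p + 1\<close> and \<open>q + 1\<close>,
  where \<open>q \<ge> -1\<close> is an integer.\<close>

definition tuples :: "'x set \<Rightarrow> nat \<Rightarrow> 'x list set" where
  "tuples X k = {xs. length xs = k \<and> set xs \<subseteq> X}"

definition close_tuples :: "'x::metric_space set \<Rightarrow> real \<Rightarrow> nat \<Rightarrow> 'x list set" where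
  "close_tuples X R k = {xs \<in> tuples X k. \<forall>a\<in>set xs. \<forall>b\<in>set xs. dist a b \<le> R}"

definition close_pairs :: "'x::metric_space set \<Rightarrow> real \<Rightarrow> nat \<Rightarrow> nat \<Rightarrow> ('x list \<times> 'x list) set" where
  "close_pairs X R k l = {(xs, ys) \<in> tuples X k \<times> tuples X l.
     \<forall>a\<in>set xs \<union> set ys. \<forall>b\<in>set xs \<union> set ys. dist a b \<le> R}"

type_synonym ('x, 'v) cochain = "'x list \<Rightarrow> 'x list \<Rightarrow> 'v"

definition controlled_supports ::
    "'x::metric_space set \<Rightarrow> ('x, 'v) xmodule \<Rightarrow> nat \<Rightarrow> int \<Rightarrow> ('x, 'v) cochain \<Rightarrow> bool" where
  "controlled_supports X M p q \<phi> \<longleftrightarrow> (\<forall>R>0. \<exists>S>0. \<forall>(xs, ys) \<in> close_pairs X R (p + 1) (nat (q + 1)).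
     \<forall>z \<in> set xs \<union> set ys. m_supp M (\<phi> xs ys) \<subseteq> cball z S)"

definition cochain_norm ::
    "'x::metric_space set \<Rightarrow> ('x, 'v) xmodule \<Rightarrow> nat \<Rightarrow> int \<Rightarrow> real \<Rightarrow> ('x, 'v) cochain \<Rightarrow> ennreal" where
  "cochain_norm X M p q R \<phi> =
     (SUP (xs, ys) \<in> close_tuples X R (p + 1) \<times> tuples X (nat (q + 1)). ennreal (m_norm M (\<phi> xs ys)))"

definition cochains :: "'x::metric_space set \<Rightarrow> ('x, 'v::complex_vector) xmodule \<Rightarrow> nat \<Rightarrow> int
    \<Rightarrow> ('x, 'v) cochain seminormed" where
  "cochains X M p q =
     \<lparr>sn_space = {\<phi>. (\<forall>xs ys. \<phi> xs ys \<in> m_space M)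
                  \<and> (\<forall>xs ys. (xs, ys) \<notin> tuples X (p + 1) \<times> tuples X (nat (q + 1)) \<longrightarrow> \<phi> xs ys = 0)
                  \<and> controlled_supports X M p q \<phi>
                  \<and> (\<forall>R>0. cochain_norm X M p q R \<phi> < \<infinity>)},
      sn_norm = (\<lambda>i. cochain_norm X M p q (real (Suc i)))\<rparr>"

definition omit :: "nat \<Rightarrow> 'a list \<Rightarrow> 'a list" where
  "omit i xs = take i xs @ drop (Suc i) xs"

definition diff_D :: "'x set \<Rightarrow> nat \<Rightarrow> int \<Rightarrow> ('x, 'v::complex_vector) cochain \<Rightarrow> ('x, 'v) cochain" where
  "diff_D X p q \<phi> = (\<lambda>xs ys. if xs \<in> tuples X (p + 2) \<and> ys \<in> tuples X (nat (q + 1))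
     then \<Sum>i\<in>{0..p + 1}. ((-1) ^ i) *\<^sub>C \<phi> (omit i xs) ys else 0)"

definition diff_d :: "'x set \<Rightarrow> nat \<Rightarrow> int \<Rightarrow> ('x, 'v::complex_vector) cochain \<Rightarrow> ('x, 'v) cochain" where
  "diff_d X p q \<phi> = (\<lambda>xs ys. if xs \<in> tuples X (p + 1) \<and> ys \<in> tuples X (nat (q + 2))
     then \<Sum>i\<in>{0..nat (q + 1)}. ((-1) ^ (i + p)) *\<^sub>C \<phi> xs (omit i ys) else 0)"

definition push :: "('v \<Rightarrow> 'w) \<Rightarrow> ('x, 'v) cochain \<Rightarrow> ('x, 'w) cochain" where
  "push f \<phi> = (\<lambda>xs ys. f (\<phi> xs ys))"

definition const_one :: "'x set \<Rightarrow> ('x, complex) cochain" where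
  "const_one X = (\<lambda>xs ys. if xs \<in> tuples X 1 \<and> ys \<in> tuples X 0 then 1 else 0)"


section \<open>Total cohomology of a bicomplex of groups\<close>

record 'e bicomplex =
  bi_obj :: "nat \<Rightarrow> nat \<Rightarrow> 'e monoid"
  bi_D :: "nat \<Rightarrow> nat \<Rightarrow> 'e \<Rightarrow> 'e"
  bi_d :: "nat \<Rightarrow> nat \<Rightarrow> 'e \<Rightarrow> 'e"

text \<open>An element of degree \<open>n\<close> is a family \<open>c\<close> with \<open>c p\<close> in bidegree \<open>(p, n - p)\<close> for \<open>p \<le> n\<close>;
  the direct sum is finite, hence equal to the product.\<close>

definition total :: "'e bicomplex \<Rightarrow> nat \<Rightarrow> (nat \<Rightarrow> 'e) monoid" where
  "total B n = product_group {..n} (\<lambda>p. bi_obj B p (n - p))"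

definition total_diff :: "'e bicomplex \<Rightarrow> nat \<Rightarrow> (nat \<Rightarrow> 'e) \<Rightarrow> (nat \<Rightarrow> 'e)" where
  "total_diff B n c = (\<lambda>p\<in>{..Suc n}.
      (if p = 0 then \<one>\<^bsub>bi_obj B p (Suc n - p)\<^esub> else bi_D B (p - 1) (Suc n - p) (c (p - 1)))
      \<otimes>\<^bsub>bi_obj B p (Suc n - p)\<^esub>
      (if p = Suc n then \<one>\<^bsub>bi_obj B p (Suc n - p)\<^esub> else bi_d B p (n - p) (c p)))"

definition cocycles :: "'e bicomplex \<Rightarrow> nat \<Rightarrow> (nat \<Rightarrow> 'e) set" where
  "cocycles B n = kernel (total B n) (total B (Suc n)) (total_diff B n)"

fun coboundaries :: "'e bicomplex \<Rightarrow> nat \<Rightarrow> (nat \<Rightarrow> 'e) set" where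
  "coboundaries B 0 = {\<one>\<^bsub>total B 0\<^esub>}"
| "coboundaries B (Suc n) = total_diff B n ` carrier (total B n)"

definition cohomology :: "'e bicomplex \<Rightarrow> nat \<Rightarrow> (nat \<Rightarrow> 'e) set monoid" where
  "cohomology B n = (total B n)\<lparr>carrier := cocycles B n\<rparr> Mod coboundaries B n"

definition coh_class :: "'e bicomplex \<Rightarrow> nat \<Rightarrow> (nat \<Rightarrow> 'e) \<Rightarrow> (nat \<Rightarrow> 'e) set" where
  "coh_class B n z = coboundaries B n #>\<^bsub>total B n\<^esub> z"

definition total_map :: "(nat \<Rightarrow> nat \<Rightarrow> 'e \<Rightarrow> 'f) \<Rightarrow> nat \<Rightarrow> (nat \<Rightarrow> 'e) \<Rightarrow> (nat \<Rightarrow> 'f)" where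
  "total_map f n c = (\<lambda>p\<in>{..n}. f p (n - p) (c p))"

text \<open>The map induced in cohomology by a map \<open>f\<close> of bicomplexes with target \<open>C\<close>; as for
  \<^const>\<open>Q_map\<close>, the union is over representatives of one and the same class.\<close>

definition coh_map :: "'f bicomplex \<Rightarrow> (nat \<Rightarrow> nat \<Rightarrow> 'e \<Rightarrow> 'f) \<Rightarrow> nat
    \<Rightarrow> (nat \<Rightarrow> 'e) set \<Rightarrow> (nat \<Rightarrow> 'f) set" where
  "coh_map C f n \<zeta> = (\<Union>z\<in>\<zeta>. coh_class C n (total_map f n z))"

text \<open>The connecting homomorphism \<open>H\<^sup>n(C) \<rightarrow> H\<^sup>n\<^sup>+\<^sup>1(A)\<close> of a short exact sequence
  \<open>0 \<rightarrow> A \<rightarrow> B \<rightarrow> C \<rightarrow> 0\<close> of bicomplexes with maps \<open>i\<close> and \<open>r\<close>: lift a cocycle of \<open>C\<close> to a cochain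
  \<open>b\<close> of \<open>B\<close>, and take the class of the cochain \<open>a\<close> of \<open>A\<close> that \<open>i\<close> sends to the differential of \<open>b\<close>.\<close>

definition connecting :: "'e bicomplex \<Rightarrow> 'f bicomplex \<Rightarrow> (nat \<Rightarrow> nat \<Rightarrow> 'e \<Rightarrow> 'f)
    \<Rightarrow> (nat \<Rightarrow> nat \<Rightarrow> 'f \<Rightarrow> 'g) \<Rightarrow> nat \<Rightarrow> (nat \<Rightarrow> 'g) set \<Rightarrow> (nat \<Rightarrow> 'e) set" where
  "connecting A B i r n \<zeta> = (THE \<beta>. \<exists>z\<in>\<zeta>. \<exists>b\<in>carrier (total B n). \<exists>a\<in>carrier (total A (Suc n)).
     total_map r n b = z \<and> total_map i (Suc n) a = total_diff B n b \<and> \<beta> = coh_class A (Suc n) a)"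


section \<open>The completed bicomplexes\<close>

definition Q_bicomplex :: "'x::metric_space set \<Rightarrow> ('x, 'v::complex_vector) xmodule
    \<Rightarrow> (nat \<Rightarrow> ('x, 'v) cochain) set bicomplex" where
  "Q_bicomplex X M =
     \<lparr>bi_obj = (\<lambda>p q. Q_completion (cochains X M p (int q))),
      bi_D = (\<lambda>p q. Q_map (cochains X M (Suc p) (int q)) (diff_D X p (int q))),
      bi_d = (\<lambda>p q. Q_map (cochains X M p (int (Suc q))) (diff_d X p (int q)))\<rparr>"

definition W_bicomplex :: "'x::metric_space set \<Rightarrow> ('x, 'v::complex_vector) xmodule
    \<Rightarrow> ((('x, 'v) cochain \<Rightarrow> complex) \<Rightarrow> complex) bicomplex" where
  "W_bicomplex X M =
     \<lparr>bi_obj = (\<lambda>p q. W_completion (cochains X M p (int q))),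
      bi_D = (\<lambda>p q. W_map (cochains X M p (int q)) (cochains X M (Suc p) (int q)) (diff_D X p (int q))),
      bi_d = (\<lambda>p q. W_map (cochains X M p (int q)) (cochains X M p (int (Suc q))) (diff_d X p (int q)))\<rparr>"

definition Q_pi :: "'x::metric_space set \<Rightarrow> nat \<Rightarrow> nat
    \<Rightarrow> (nat \<Rightarrow> ('x, 'x \<Rightarrow> complex) cochain) set \<Rightarrow> (nat \<Rightarrow> ('x, complex) cochain) set" where
  "Q_pi X p q = Q_map (cochains X scalars p (int q)) (push (l1_sum X))"

definition W_pi :: "'x::metric_space set \<Rightarrow> nat \<Rightarrow> nat
    \<Rightarrow> ((('x, 'x \<Rightarrow> complex) cochain \<Rightarrow> complex) \<Rightarrow> complex)
    \<Rightarrow> ((('x, complex) cochain \<Rightarrow> complex) \<Rightarrow> complex)" where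
  "W_pi X p q = W_map (cochains X (l1 X) p (int q)) (cochains X scalars p (int q)) (push (l1_sum X))"

text \<open>\<^const>\<open>l1_0\<close> and \<^const>\<open>l1\<close> have elements of the same type, and the inclusion of the former is
  the identity function.  It does not induce the identity function on completions.\<close>

definition Q_iota :: "'x::metric_space set \<Rightarrow> nat \<Rightarrow> nat
    \<Rightarrow> (nat \<Rightarrow> ('x, 'x \<Rightarrow> complex) cochain) set \<Rightarrow> (nat \<Rightarrow> ('x, 'x \<Rightarrow> complex) cochain) set" where
  "Q_iota X p q = Q_map (cochains X (l1 X) p (int q)) (push (\<lambda>f. f))"

definition W_iota :: "'x::metric_space set \<Rightarrow> nat \<Rightarrow> nat
    \<Rightarrow> ((('x, 'x \<Rightarrow> complex) cochain \<Rightarrow> complex) \<Rightarrow> complex)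
    \<Rightarrow> ((('x, 'x \<Rightarrow> complex) cochain \<Rightarrow> complex) \<Rightarrow> complex)" where
  "W_iota X p q = W_map (cochains X (l1_0 X) p (int q)) (cochains X (l1 X) p (int q)) (push (\<lambda>f. f))"

abbreviation "H_Q X M n \<equiv> cohomology (Q_bicomplex X M) n"
abbreviation "H_W X M n \<equiv> cohomology (W_bicomplex X M) n"

abbreviation "pi_star_Q X n \<equiv> coh_map (Q_bicomplex X scalars) (Q_pi X) n"
abbreviation "pi_star_W X n \<equiv> coh_map (W_bicomplex X scalars) (W_pi X) n"

abbreviation "connecting_Q X n \<equiv>
  connecting (Q_bicomplex X (l1_0 X)) (Q_bicomplex X (l1 X)) (Q_iota X) (Q_pi X) n"
abbreviation "connecting_W X n \<equiv>
  connecting (W_bicomplex X (l1_0 X)) (W_bicomplex X (l1 X)) (W_iota X) (W_pi X) n"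

definition one_Q_class :: "'x::metric_space set \<Rightarrow> (nat \<Rightarrow> (nat \<Rightarrow> ('x, complex) cochain) set) set" where
  "one_Q_class X = coh_class (Q_bicomplex X scalars) 0
     (\<lambda>p\<in>{..0}. Q_incl (cochains X scalars 0 0) (diff_d X 0 (-1) (const_one X)))"

definition one_W_class ::
    "'x::metric_space set \<Rightarrow> (nat \<Rightarrow> ((('x, complex) cochain \<Rightarrow> complex) \<Rightarrow> complex)) set" where
  "one_W_class X = coh_class (W_bicomplex X scalars) 0
     (\<lambda>p\<in>{..0}. W_incl (cochains X scalars 0 0) (diff_d X 0 (-1) (const_one X)))"

definition asymptotically_invariant_mean ::
    "'x::metric_space set \<Rightarrow> ((('x, 'x \<Rightarrow> complex) cochain \<Rightarrow> complex) \<Rightarrow> complex) \<Rightarrow> bool" where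
  "asymptotically_invariant_mean X \<mu> \<longleftrightarrow>
     \<mu> \<in> carrier (W_completion (cochains X (l1 X) 0 (-1))) \<and>
     W_map (cochains X (l1 X) 0 (-1)) (cochains X (l1 X) 1 (-1)) (diff_D X 0 (-1)) \<mu>
       = \<one>\<^bsub>W_completion (cochains X (l1 X) 1 (-1))\<^esub> \<and>
     W_map (cochains X (l1 X) 0 (-1)) (cochains X scalars 0 (-1)) (push (l1_sum X)) \<mu>
       = W_incl (cochains X scalars 0 (-1)) (const_one X)"

end

theory Submission
  imports Defs
begin

text \<open>A cocycle of degree zero is its own cohomology class. So \<open>1\<close> is in the image of \<open>\<pi>\<^sub>*\<close> if and only if it
  lifts to a cocycle of the completed space of cochains with values in \<open>l1 X\<close>. In the quotient
  completion such a lift is a bounded sequence of cochains \<open>\<phi>\<^sub>n\<close> with \<open>D \<phi>\<^sub>n\<close>, \<open>d \<phi>\<^sub>n\<close> and \<open>\<pi> \<phi>\<^sub>n - 1\<close>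
  tending to zero (\<open>cocycle_lifting_one_Q\<close>); in the weak-* completion it is an element of the bidual
  that satisfies the corresponding equations (\<open>cocycle_lifting_one_W\<close>). The connecting homomorphism
  kills the class of \<open>1\<close> if and only if there is a lift, which is exactness of the long exact sequence at
  one place. This exactness holds because \<open>\<pi>\<close> has a continuous linear right inverse on cochains, which
  puts \<open>\<lambda>(x, y)\<close> as a point mass at \<open>x\<^sub>0\<close>: both completions are additive functors, so they keep split
  sequences split. This yields \<open>Q_conditions_iff\<close> and \<open>W_conditions_iff\<close>.

  What remains is a circle of four implications.

  \<^item> Functions \<open>f\<^sub>n\<close> as in property A give the cochains \<open>\<phi>\<^sub>n (x, y) = f\<^sub>n x\<close>
    (\<open>property_A_imp_cocycle\<close>).

  \<^item> For a bounded sequence of cochains, \<open>\<alpha> \<mapsto> LIM \<alpha> \<phi>\<^sub>n\<close> is an element of the bidual, where \<open>LIM\<close> is a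
    linear extension of the limit to all bounded sequences (\<open>Q_cocycle_imp_W_cocycle\<close>).

  \<^item> Restriction of \<open>\<phi> (x, y)\<close> to the diagonal \<open>y = x\<close> turns a cocycle into an invariant mean, since
    \<open>\<phi> (x\<^sub>1, x\<^sub>1) - \<phi> (x\<^sub>0, x\<^sub>0)\<close> is a value of \<open>D \<phi>\<close> plus a value of \<open>d \<phi>\<close>
    (\<open>W_cocycle_imp_mean\<close>).

  \<^item> Let \<open>\<mu>\<close> be an invariant mean, let \<open>s\<close> be a cochain with \<open>\<pi> s = 1\<close>, and suppose that
    \<open>\<parallel>D \<phi>\<parallel>\<^sub>R \<ge> \<epsilon>\<close> for all cochains \<open>\<phi>\<close> with \<open>\<pi> \<phi> = 1\<close>. Then the Hahn--Banach theorem separates \<open>D s\<close> from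
    the image under \<open>D\<close> of the kernel of \<open>\<pi>\<close> by a continuous functional \<open>\<alpha>\<close>. As \<open>\<alpha> \<circ> D\<close> vanishes on the
    kernel of \<open>\<pi>\<close>, it is \<open>\<beta> \<circ> \<pi>\<close> for a continuous \<open>\<beta>\<close>. Evaluating \<open>\<mu>\<close> on it gives
    \<open>0 = (D \<mu>) \<alpha> = (\<pi> \<mu>) \<beta> = \<beta> 1 = \<alpha> (D s) \<noteq> 0\<close>. So there are \<open>\<phi>\<^sub>n\<close> with \<open>\<pi> \<phi>\<^sub>n = 1\<close> and
    \<open>\<parallel>D \<phi>\<^sub>n\<parallel>\<^sub>n < 1 / (n + 1)\<close>, and the normalized absolute values of the functions \<open>\<phi>\<^sub>n x\<close> witness
    property A (\<open>mean_imp_property_A\<close>).\<close>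

section \<open>The Hahn--Banach theorem for complex seminorms\<close>

lemma scaleC_zero_left [simp]: "0 *\<^sub>C (x :: 'v::complex_vector) = 0"
proof -
  have "0 *\<^sub>C x = 0 *\<^sub>C x + 0 *\<^sub>C x" by (metis scaleC_add_left add_0)
  then show ?thesis by simp
qed

lemma scaleC_zero_right [simp]: "c *\<^sub>C (0 :: 'v::complex_vector) = 0"
proof -
  have "c *\<^sub>C (0::'v) = c *\<^sub>C 0 + c *\<^sub>C 0" by (metis scaleC_add_right add_0)
  then show ?thesis by simp
qed

lemma scaleC_minus1: "(-1) *\<^sub>C (x :: 'v::complex_vector) = - x"
proof -
  have "(-1) *\<^sub>C x + x = (-1 + 1) *\<^sub>C x" by (simp only: scaleC_add_left scaleC_one)
  then show ?thesis by (simp add: eq_neg_iff_add_eq_0)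
qed

lemma scaleC_diff_right: "c *\<^sub>C (x - y) = c *\<^sub>C x - c *\<^sub>C (y :: 'v::complex_vector)"
proof -
  have "c *\<^sub>C (x - y) + c *\<^sub>C y = c *\<^sub>C x" by (simp add: scaleC_add_right[symmetric])
  then show ?thesis by (simp add: eq_diff_eq)
qed

lemma csubspaceD:
  assumes "csubspace V"
  shows "0 \<in> V" and "\<And>v w. v \<in> V \<Longrightarrow> w \<in> V \<Longrightarrow> v + w \<in> V" and "\<And>c v. v \<in> V \<Longrightarrow> c *\<^sub>C v \<in> V"
    and "\<And>v. v \<in> V \<Longrightarrow> - v \<in> V" and "\<And>v w. v \<in> V \<Longrightarrow> w \<in> V \<Longrightarrow> v - w \<in> V"
proof -
  show a: "\<And>v w. v \<in> V \<Longrightarrow> w \<in> V \<Longrightarrow> v + w \<in> V" and "0 \<in> V"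
    and s: "\<And>c v. v \<in> V \<Longrightarrow> c *\<^sub>C v \<in> V"
    using assms by (auto simp: csubspace_def)
  show m: "\<And>v. v \<in> V \<Longrightarrow> - v \<in> V" using s[of _ "-1"] by (simp add: scaleC_minus1)
  show "\<And>v w. v \<in> V \<Longrightarrow> w \<in> V \<Longrightarrow> v - w \<in> V" using a m by (metis diff_conv_add_uminus)
qed

definition sublinear_on :: "'v::complex_vector set \<Rightarrow> ('v \<Rightarrow> real) \<Rightarrow> bool" where
  "sublinear_on V q \<longleftrightarrow> (\<forall>x\<in>V. \<forall>y\<in>V. q (x + y) \<le> q x + q y)
     \<and> (\<forall>t\<ge>0. \<forall>x\<in>V. q (of_real t *\<^sub>C x) \<le> t * q x)"

context
  fixes V :: "'v::complex_vector set"
  assumes V: "csubspace V"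
begin

lemma sublinear_on_add: "sublinear_on V q \<Longrightarrow> x \<in> V \<Longrightarrow> y \<in> V \<Longrightarrow> q (x + y) \<le> q x + q y"
  by (simp add: sublinear_on_def)

lemma sublinear_on_zero: "sublinear_on V q \<Longrightarrow> q 0 = 0"
proof -
  assume q: "sublinear_on V q"
  then have "q (0 + 0) \<le> q 0 + q 0" "q (of_real 0 *\<^sub>C 0) \<le> 0 * q 0"
    using csubspaceD(1)[OF V] by (auto simp only: sublinear_on_def)
  then show "q 0 = 0" by simp
qed

lemma sublinear_on_scale:
  assumes q: "sublinear_on V q" and "t \<ge> 0" "x \<in> V"
  shows "q (of_real t *\<^sub>C x) = t * q x"
proof (cases "t = 0")
  case True then show ?thesis using sublinear_on_zero[OF q] by simp
next
  case False
  then have "x = of_real (inverse t) *\<^sub>C of_real t *\<^sub>C x"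
    by (simp add: scaleC_scaleC scaleC_one)
  moreover have "q (of_real (inverse t) *\<^sub>C of_real t *\<^sub>C x) \<le> inverse t * q (of_real t *\<^sub>C x)"
    using q[unfolded sublinear_on_def, THEN conjunct2, rule_format, of "inverse t"]
      assms csubspaceD(3)[OF V] by simp
  ultimately have "q x \<le> inverse t * q (of_real t *\<^sub>C x)" by simp
  then have "t * q x \<le> q (of_real t *\<^sub>C x)"
    using False assms(2) by (simp add: field_simps)
  with q assms show ?thesis by (force simp: sublinear_on_def)
qed

lemma sublinear_on_minus:
  assumes q: "sublinear_on V q" "x \<in> V"
  shows "- q (- x) \<le> q x"
proof -
  have "q (x + - x) \<le> q x + q (- x)"
    using q csubspaceD(4)[OF V] by (intro sublinear_on_add) auto
  then show ?thesis using sublinear_on_zero[OF q(1)] by simp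
qed

text \<open>Among the sublinear functionals below \<open>q\<close> and at most \<open>- q u\<close> at \<open>- u\<close>, this is the largest.
  It serves twice: a minimal sublinear functional is unchanged by it, hence is additive, and it
  forces a linear functional below it to take the prescribed value \<open>q u\<close> at \<open>u\<close>.\<close>

definition tilt :: "('v \<Rightarrow> real) \<Rightarrow> 'v \<Rightarrow> 'v \<Rightarrow> real" where
  "tilt q u x = (INF t\<in>{0..}. q (x + of_real t *\<^sub>C u) - t * q u)"

lemma tilt_bdd:
  assumes q: "sublinear_on V q" and "u \<in> V" "x \<in> V" and t: "t \<ge> 0"
  shows "- q (- x) \<le> q (x + of_real t *\<^sub>C u) - t * q u"
proof -
  have "q ((x + of_real t *\<^sub>C u) + - x) \<le> q (x + of_real t *\<^sub>C u) + q (- x)"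
    using q assms csubspaceD[OF V] by (intro sublinear_on_add) auto
  then show ?thesis using sublinear_on_scale[OF q t \<open>u \<in> V\<close>] by simp
qed

lemma tilt_le:
  assumes "sublinear_on V q" "u \<in> V" "x \<in> V" "t \<ge> 0"
  shows "tilt q u x \<le> q (x + of_real t *\<^sub>C u) - t * q u"
  unfolding tilt_def using assms tilt_bdd[OF assms(1-3)]
  by (intro cINF_lower bdd_belowI[where m = "- q (- x)"]) auto

lemma tilt_greatest:
  assumes "\<And>t. t \<ge> 0 \<Longrightarrow> c \<le> q (x + of_real t *\<^sub>C u) - t * q u"
  shows "c \<le> tilt q u x"
  unfolding tilt_def using assms by (intro cINF_greatest) auto

lemma sublinear_on_tilt:
  assumes q: "sublinear_on V q" and u: "u \<in> V"
  shows "sublinear_on V (tilt q u)"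
  unfolding sublinear_on_def
proof (intro conjI ballI allI impI)
  fix x y assume x: "x \<in> V" and y: "y \<in> V"
  have *: "tilt q u (x + y) \<le> (q (x + of_real s *\<^sub>C u) - s * q u) + (q (y + of_real t *\<^sub>C u) - t * q u)"
    if "s \<ge> 0" "t \<ge> 0" for s t
  proof -
    have "tilt q u (x + y) \<le> q ((x + y) + of_real (s + t) *\<^sub>C u) - (s + t) * q u"
      using that x y csubspaceD(2)[OF V] by (intro tilt_le q u) auto
    also have "(x + y) + of_real (s + t) *\<^sub>C u = (x + of_real s *\<^sub>C u) + (y + of_real t *\<^sub>C u)"
      by (simp add: scaleC_add_left)
    also have "q \<dots> \<le> q (x + of_real s *\<^sub>C u) + q (y + of_real t *\<^sub>C u)"
      using q x y u csubspaceD[OF V] by (intro sublinear_on_add) auto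
    finally show ?thesis by (simp add: algebra_simps)
  qed
  have "tilt q u (x + y) - tilt q u y \<le> q (x + of_real s *\<^sub>C u) - s * q u" if "s \<ge> 0" for s
  proof -
    have "tilt q u (x + y) - (q (x + of_real s *\<^sub>C u) - s * q u) \<le> tilt q u y"
      using *[OF that] by (intro tilt_greatest) (simp add: algebra_simps)
    then show ?thesis by simp
  qed
  then have "tilt q u (x + y) - tilt q u y \<le> tilt q u x" by (intro tilt_greatest)
  then show "tilt q u (x + y) \<le> tilt q u x + tilt q u y" by simp
next
  fix c :: real and x assume c: "c \<ge> 0" and x: "x \<in> V"
  show "tilt q u (of_real c *\<^sub>C x) \<le> c * tilt q u x"
  proof (cases "c = 0")
    case True
    then show ?thesis
      using tilt_le[OF q u csubspaceD(1)[OF V], of 0] sublinear_on_zero[OF q] by simp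
  next
    case False
    have "tilt q u (of_real c *\<^sub>C x) / c \<le> q (x + of_real t *\<^sub>C u) - t * q u" if "t \<ge> 0" for t
    proof -
      have "tilt q u (of_real c *\<^sub>C x) \<le> q (of_real c *\<^sub>C x + of_real (c * t) *\<^sub>C u) - (c * t) * q u"
        using c that x csubspaceD(3)[OF V] by (intro tilt_le q u) auto
      also have "of_real c *\<^sub>C x + of_real (c * t) *\<^sub>C u = of_real c *\<^sub>C (x + of_real t *\<^sub>C u)"
        by (simp add: scaleC_add_right scaleC_scaleC)
      also have "q \<dots> = c * q (x + of_real t *\<^sub>C u)"
        using c x u csubspaceD[OF V] by (intro sublinear_on_scale q) auto
      finally show ?thesis using c False by (simp add: field_simps)
    qed
    then have "tilt q u (of_real c *\<^sub>C x) / c \<le> tilt q u x" by (intro tilt_greatest)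
    then show ?thesis using c False by (simp add: field_simps)
  qed
qed

text \<open>Zorn's lemma applies because the infimum of a chain is finite: every \<open>q\<close> below \<open>p\<close> satisfies
  \<open>q x \<ge> - q (- x) \<ge> - p (- x)\<close>.\<close>

lemma ex_minimal_sublinear:
  assumes p: "sublinear_on V p"
  shows "\<exists>f. sublinear_on V f \<and> (\<forall>x\<in>V. f x \<le> p x)
    \<and> (\<forall>q. sublinear_on V q \<longrightarrow> (\<forall>x\<in>V. q x \<le> f x) \<longrightarrow> (\<forall>x\<in>V. q x = f x))"
proof -
  define S where "S = {q. sublinear_on V q \<and> vanishes_off V q \<and> (\<forall>x\<in>V. q x \<le> p x)}"
  define r where "r = {(q, q'). q \<in> S \<and> q' \<in> S \<and> (\<forall>x\<in>V. q' x \<le> q x)}"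
  have cut: "sublinear_on V (\<lambda>x. if x \<in> V then q x else 0) \<longleftrightarrow> sublinear_on V q" for q
    using csubspaceD[OF V] by (simp add: sublinear_on_def)
  have F: "Field r = S" by (auto simp: r_def Field_def)
  have po: "Partial_order r"
  proof -
    have "antisym r"
    proof (rule antisymI)
      fix q q' assume "(q, q') \<in> r" "(q', q) \<in> r"
      then have "\<forall>x\<in>V. q x = q' x" "vanishes_off V q" "vanishes_off V q'"
        by (auto simp: r_def S_def intro: order_antisym)
      then have "q x = q' x" for x by (cases "x \<in> V") (auto simp: vanishes_off_def)
      then show "q = q'" by (rule ext)
    qed
    moreover have "trans r"
    proof (rule transI)
      fix q1 q2 q3 assume "(q1, q2) \<in> r" "(q2, q3) \<in> r"
      then show "(q1, q3) \<in> r" unfolding r_def by (auto dest!: bspec)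
    qed
    moreover have "Refl r" unfolding F refl_on_def by (auto simp: r_def)
    moreover have "r \<subseteq> Field r \<times> Field r" by (auto simp: F) (auto simp: r_def)
    ultimately show ?thesis by (simp add: partial_order_on_def preorder_on_def)
  qed
  have "\<exists>u\<in>Field r. \<forall>a\<in>C. (a, u) \<in> r" if C: "C \<in> Chains r" for C
  proof (cases "C = {}")
    case True
    have "(\<lambda>x. if x \<in> V then p x else 0) \<in> S"
      using p by (simp add: S_def cut vanishes_off_def)
    then show ?thesis using True F by blast
  next
    case False
    have CS: "q \<in> S" if "q \<in> C" for q using C that by (auto simp: Chains_def r_def)
    then have Csub: "sublinear_on V q" if "q \<in> C" for q using that by (auto simp: S_def)
    have tot: "(\<forall>x\<in>V. q x \<le> q' x) \<or> (\<forall>x\<in>V. q' x \<le> q x)" if "q \<in> C" "q' \<in> C" for q q'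
      using C that by (auto simp: Chains_def r_def)
    define m where "m x = (if x \<in> V then INF q\<in>C. q x else 0)" for x
    have bdd: "bdd_below ((\<lambda>q. q x) ` C)" if "x \<in> V" for x
    proof (rule bdd_belowI2)
      fix q assume "q \<in> C"
      then have "- q (- x) \<le> q x" "q (- x) \<le> p (- x)"
        using sublinear_on_minus[OF Csub] that CS csubspaceD(4)[OF V] by (auto simp: S_def)
      then show "- p (- x) \<le> q x" by simp
    qed
    have lower: "m x \<le> q x" if "q \<in> C" "x \<in> V" for q x
      using that bdd by (auto simp: m_def intro: cINF_lower)
    have greatest: "c \<le> m x" if "x \<in> V" "\<And>q. q \<in> C \<Longrightarrow> c \<le> q x" for c x
      using that False by (auto simp: m_def intro: cINF_greatest)
    have "sublinear_on V m"
      unfolding sublinear_on_def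
    proof (intro conjI ballI allI impI)
      fix x y assume xy: "x \<in> V" "y \<in> V"
      have "m (x + y) \<le> q x + q' y" if qq: "q \<in> C" "q' \<in> C" for q q'
      proof -
        from tot[OF qq] obtain q0 where "q0 \<in> C" "q0 x \<le> q x" "q0 y \<le> q' y" using qq xy by blast
        moreover have "m (x + y) \<le> q0 (x + y)" using lower[OF \<open>q0 \<in> C\<close> csubspaceD(2)[OF V xy]] .
        moreover have "q0 (x + y) \<le> q0 x + q0 y"
          using Csub[OF \<open>q0 \<in> C\<close>] xy by (intro sublinear_on_add)
        ultimately show ?thesis by linarith
      qed
      then have "m (x + y) - q' y \<le> m x" if "q' \<in> C" for q'
        using that xy by (intro greatest) (auto simp: algebra_simps)
      then have "m (x + y) - m x \<le> m y" using xy by (intro greatest) (auto simp: algebra_simps)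
      then show "m (x + y) \<le> m x + m y" by simp
    next
      fix t :: real and x assume t: "t \<ge> 0" and x: "x \<in> V"
      have *: "m (of_real t *\<^sub>C x) \<le> t * q x" if "q \<in> C" for q
        using lower[OF that csubspaceD(3)[OF V x]] sublinear_on_scale[OF Csub[OF that] t x] by metis
      show "m (of_real t *\<^sub>C x) \<le> t * m x"
      proof (cases "t = 0")
        case True
        then show ?thesis using * False by auto
      next
        case False
        then have "m (of_real t *\<^sub>C x) / t \<le> m x"
          using * t x by (intro greatest) (auto simp: field_simps)
        then show ?thesis using False t by (simp add: field_simps)
      qed
    qed
    moreover have "\<forall>x\<in>V. m x \<le> p x"
    proof
      fix x assume "x \<in> V"
      obtain q where "q \<in> C" using False by blast
      then have "m x \<le> q x" "q x \<le> p x" using lower CS \<open>x \<in> V\<close> by (auto simp: S_def)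
      then show "m x \<le> p x" by simp
    qed
    ultimately have "m \<in> S" by (simp add: S_def vanishes_off_def m_def)
    then show ?thesis using CS lower F by (auto simp: r_def)
  qed
  then obtain f where f: "f \<in> Field r" "\<forall>a\<in>Field r. (f, a) \<in> r \<longrightarrow> a = f"
    using Zorns_po_lemma[OF po] by blast
  show ?thesis
  proof (intro exI conjI allI impI ballI)
    show "sublinear_on V f" "\<And>x. x \<in> V \<Longrightarrow> f x \<le> p x" using f(1) F by (auto simp: S_def)
    fix q x assume q: "sublinear_on V q" "\<forall>x\<in>V. q x \<le> f x" and x: "x \<in> V"
    let ?q = "\<lambda>x. if x \<in> V then q x else 0"
    have "q x \<le> p x" if "x \<in> V" for x
      using order_trans[of "q x" "f x" "p x"] q(2) that f(1) F by (auto simp: S_def)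
    then have "?q \<in> S" using q(1) cut[of q] by (auto simp: S_def vanishes_off_def)
    then have "(f, ?q) \<in> r" using f(1) q(2) F by (simp add: r_def)
    then have "?q = f" using f(2) F \<open>?q \<in> S\<close> by blast
    then show "q x = f x" using x by (auto dest: fun_cong[of _ _ x])
  qed
qed

text \<open>A minimal sublinear functional is linear, as tilting it in a direction \<open>y\<close> cannot make it smaller.\<close>

lemma ex_real_linear_below_sublinear:
  assumes p: "sublinear_on V p"
  shows "\<exists>f. (\<forall>x\<in>V. \<forall>y\<in>V. f (x + y) = f x + f y) \<and> (\<forall>t. \<forall>x\<in>V. f (of_real t *\<^sub>C x) = t * f x)
    \<and> (\<forall>x\<in>V. f x \<le> p x)"
proof -
  obtain f where f: "sublinear_on V f" "\<forall>x\<in>V. f x \<le> p x"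
    and min: "\<forall>q. sublinear_on V q \<longrightarrow> (\<forall>x\<in>V. q x \<le> f x) \<longrightarrow> (\<forall>x\<in>V. q x = f x)"
    using ex_minimal_sublinear[OF p] by (elim exE conjE)
  have add: "f (x + y) = f x + f y" if "x \<in> V" "y \<in> V" for x y
  proof -
    have "tilt f y z \<le> f z" if "z \<in> V" for z
      using tilt_le[OF f(1) \<open>y \<in> V\<close> that, of 0] by simp
    then have "tilt f y x = f x"
      using min[rule_format, OF sublinear_on_tilt[OF f(1) \<open>y \<in> V\<close>]] that by simp
    \<comment> \<open>the parameter \<open>1\<close> in the infimum that defines the tilt\<close>
    then have "f x \<le> f (x + y) - f y"
      using tilt_le[OF f(1) \<open>y \<in> V\<close> \<open>x \<in> V\<close>, of 1] by (simp add: scaleC_one)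
    moreover have "f (x + y) \<le> f x + f y" using f(1) that by (intro sublinear_on_add)
    ultimately show ?thesis by simp
  qed
  have neg: "f (- x) = - f x" if "x \<in> V" for x
    using add[OF that csubspaceD(4)[OF V that]] sublinear_on_zero[OF f(1)] by simp
  have scale: "f (of_real t *\<^sub>C x) = t * f x" if x: "x \<in> V" for t x
  proof (cases "t \<ge> 0")
    case True then show ?thesis using sublinear_on_scale[OF f(1) _ x] by simp
  next
    case False
    have "of_real t *\<^sub>C x = - (of_real (- t) *\<^sub>C x)"
      using scaleC_minus1[of "of_real (- t) *\<^sub>C x"] by (simp add: scaleC_scaleC)
    then show ?thesis
      using sublinear_on_scale[OF f(1) _ x, of "- t"] neg[OF csubspaceD(3)[OF V x]] False by simp
  qed
  show ?thesis using add scale f(2) by (intro exI[of _ f]) simp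
qed

text \<open>The functional is sought below the distance to \<open>W\<close>, a seminorm that vanishes on \<open>W\<close> and is
  positive at \<open>u\<close>; tilting it in the direction \<open>u\<close> prevents the functional from vanishing at \<open>u\<close>.
  A real linear functional \<open>f\<close> below it becomes complex linear as
  \<open>x \<mapsto> f x - \<i> f (\<i> x)\<close>, and the bound survives because a rotation of \<open>x\<close> makes this value real.\<close>

theorem Hahn_Banach_separation:
  fixes p :: "'v \<Rightarrow> real"
  assumes p_add: "\<And>x y. x \<in> V \<Longrightarrow> y \<in> V \<Longrightarrow> p (x + y) \<le> p x + p y"
    and p_scale: "\<And>c x. x \<in> V \<Longrightarrow> p (c *\<^sub>C x) \<le> cmod c * p x"
    and W: "csubspace W" "W \<subseteq> V" and u: "u \<in> V"
    and pos: "\<delta> > 0" "\<And>w. w \<in> W \<Longrightarrow> \<delta> \<le> p (u - w)"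
  shows "\<exists>F. clinear_on V F \<and> (\<forall>w\<in>W. F w = 0) \<and> F u \<noteq> 0 \<and> (\<forall>x\<in>V. cmod (F x) \<le> p x)"
proof -
  note Vs = csubspaceD[OF V] and Ws = csubspaceD[OF W(1)]
  have p_nonneg: "0 \<le> p x" if "x \<in> V" for x
  proof -
    have "p (x + - x) \<le> p x + p (- x)" using that Vs by (intro p_add) auto
    moreover have "p (- x) \<le> p x" using p_scale[OF that, of "-1"] by (simp add: scaleC_minus1)
    moreover have "0 \<le> p 0" using p_add[OF Vs(1) Vs(1)] by simp
    ultimately show ?thesis by simp
  qed
  define dist_W where "dist_W x = (INF w\<in>W. p (x - w))" for x
  have lower: "dist_W x \<le> p (x - w)" if "x \<in> V" "w \<in> W" for x w
    unfolding dist_W_def using that p_nonneg Vs W(2)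
    by (intro cINF_lower bdd_belowI2[where m = 0]) auto
  have greatest: "c \<le> dist_W x" if "\<And>w. w \<in> W \<Longrightarrow> c \<le> p (x - w)" for x c
    unfolding dist_W_def using that Ws(1) by (intro cINF_greatest) auto
  have dist_le_p: "dist_W x \<le> p x" if "x \<in> V" for x
    using lower[OF that Ws(1)] by simp
  have dist_W_0: "dist_W w \<le> 0" if "w \<in> W" for w
    using lower[of w w] that W(2) p_scale[OF Vs(1), of 0] by auto
  have dist_u: "0 < dist_W u" using greatest[of \<delta> u] pos by fastforce
  have dist_scale_le: "dist_W (c *\<^sub>C x) \<le> cmod c * dist_W x" if x: "x \<in> V" for c x
  proof (cases "c = 0")
    case True then show ?thesis using dist_W_0[OF Ws(1)] by simp
  next
    case False
    have "dist_W (c *\<^sub>C x) / cmod c \<le> dist_W x"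
    proof (rule greatest)
      fix w assume w: "w \<in> W"
      have "dist_W (c *\<^sub>C x) \<le> p (c *\<^sub>C x - c *\<^sub>C w)" using x w by (intro lower Vs Ws)
      also have "c *\<^sub>C x - c *\<^sub>C w = c *\<^sub>C (x - w)"
        by (simp add: scaleC_diff_right)
      also have "p \<dots> \<le> cmod c * p (x - w)" using x w W(2) Vs by (intro p_scale) auto
      finally show "dist_W (c *\<^sub>C x) / cmod c \<le> p (x - w)" using False by (simp add: field_simps)
    qed
    then show ?thesis using False by (simp add: field_simps)
  qed
  have sub: "sublinear_on V dist_W"
    unfolding sublinear_on_def
  proof (intro conjI ballI allI impI)
    fix x y assume xy: "x \<in> V" "y \<in> V"
    have *: "dist_W (x + y) \<le> p (x - w) + p (y - w')" if "w \<in> W" "w' \<in> W" for w w'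
    proof -
      have "dist_W (x + y) \<le> p ((x + y) - (w + w'))" using xy that by (intro lower Vs Ws)
      also have "(x + y) - (w + w') = (x - w) + (y - w')" by simp
      also have "p \<dots> \<le> p (x - w) + p (y - w')" using xy that W(2) Vs by (intro p_add) auto
      finally show ?thesis .
    qed
    have "dist_W (x + y) - p (y - w') \<le> dist_W x" if "w' \<in> W" for w'
      using *[OF _ that] by (intro greatest) (simp add: algebra_simps)
    then have "dist_W (x + y) - dist_W x \<le> dist_W y"
      by (intro greatest) (simp add: algebra_simps)
    then show "dist_W (x + y) \<le> dist_W x + dist_W y" by simp
  next
    fix t :: real and x assume "t \<ge> 0" "x \<in> V"
    then show "dist_W (of_real t *\<^sub>C x) \<le> t * dist_W x"
      using dist_scale_le[of x "of_real t"] by simp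
  qed
  have tilt_le_dist: "tilt dist_W u x \<le> dist_W x" if "x \<in> V" for x
    using tilt_le[OF sub u that, of 0] by simp
  obtain f where f: "\<forall>x\<in>V. \<forall>y\<in>V. f (x + y) = f x + f y" "\<forall>t. \<forall>x\<in>V. f (of_real t *\<^sub>C x) = t * f x"
    "\<forall>x\<in>V. f x \<le> tilt dist_W u x"
    using ex_real_linear_below_sublinear[OF sublinear_on_tilt[OF sub u]] by (elim exE conjE)
  note f_add = f(1)[rule_format] and f_scale = f(2)[rule_format] and f_le = f(3)[rule_format]
  have "f (- u) \<le> tilt dist_W u (- u)" using f_le[OF Vs(4)[OF u]] .
  also have "\<dots> \<le> dist_W 0 - dist_W u"
    using tilt_le[OF sub u Vs(4)[OF u], of 1] by (simp add: scaleC_one)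
  finally have fu: "f u > 0"
    using dist_u dist_W_0[OF Ws(1)] f_scale[OF u, of "-1"] by (simp add: scaleC_minus1)
  define F where "F x = Complex (f x) (- f (\<i> *\<^sub>C x))" for x
  have F_add: "F (x + y) = F x + F y" if "x \<in> V" "y \<in> V" for x y
    using that by (simp add: F_def f_add Vs scaleC_add_right complex_eq_iff)
  have F_scale: "F (c *\<^sub>C x) = c * F x" if x: "x \<in> V" for c x
  proof -
    have split: "f (c *\<^sub>C y) = Re c * f y + Im c * f (\<i> *\<^sub>C y)" if y: "y \<in> V" for c y
    proof -
      have "c = of_real (Re c) + of_real (Im c) * \<i>" by (simp add: complex_eq_iff)
      then have "c *\<^sub>C y = of_real (Re c) *\<^sub>C y + of_real (Im c) *\<^sub>C \<i> *\<^sub>C y"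
        by (metis scaleC_scaleC scaleC_add_left)
      then show ?thesis using y Vs by (simp add: f_add f_scale)
    qed
    have "f (\<i> *\<^sub>C c *\<^sub>C x) = - Im c * f x + Re c * f (\<i> *\<^sub>C x)"
      using split[OF x, of "\<i> * c"] by (simp add: scaleC_scaleC)
    then show ?thesis
      using split[OF x, of c] by (simp add: F_def complex_eq_iff algebra_simps)
  qed
  have F_le: "cmod (F x) \<le> dist_W x" if x: "x \<in> V" for x
  proof -
    obtain c where c: "cmod c = 1" "c * F x = of_real (cmod (F x))"
    proof (cases "F x = 0")
      case False
      then show ?thesis
        using that[of "of_real (cmod (F x)) / F x"] by (simp add: norm_divide)
    qed (use that[of 1] in auto)
    have "cmod (F x) = Re (F (c *\<^sub>C x))" using F_scale[OF x] c by simp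
    also have "\<dots> \<le> dist_W (c *\<^sub>C x)"
      using f_le[of "c *\<^sub>C x"] tilt_le_dist[of "c *\<^sub>C x"] x Vs by (simp add: F_def)
    also have "\<dots> \<le> dist_W x" using dist_scale_le[OF x, of c] c by simp
    finally show ?thesis .
  qed
  show ?thesis
  proof (intro exI conjI ballI)
    show "clinear_on V F" using F_add F_scale by (simp add: clinear_on_def)
    show "F w = 0" if "w \<in> W" for w
      using order_trans[OF F_le dist_W_0[OF that]] W(2) that by auto
    show "F u \<noteq> 0" using fu by (auto simp: F_def complex_eq_iff)
    show "cmod (F x) \<le> p x" if "x \<in> V" for x
      using F_le[OF that] dist_le_p[OF that] by simp
  qed
qed

end

text \<open>A substitute for the limit along an ultrafilter: separate the constant sequence \<open>1\<close> from the null
  sequences in the space of bounded sequences, from which it has sup-distance at least \<open>1\<close>.\<close>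

lemma ex_generalized_limit:
  "\<exists>L :: (nat \<Rightarrow> complex) \<Rightarrow> complex. clinear_on {a. Bseq a} L \<and> (\<forall>a. a \<longlonglongrightarrow> 0 \<longrightarrow> L a = 0)
     \<and> L (\<lambda>n. 1) = 1 \<and> (\<exists>K\<ge>0. \<forall>a C. (\<forall>n. cmod (a n) \<le> C) \<longrightarrow> cmod (L a) \<le> K * C)"
proof -
  let ?V = "{a :: nat \<Rightarrow> complex. Bseq a}" and ?W = "{a :: nat \<Rightarrow> complex. a \<longlonglongrightarrow> 0}"
  define p where "p a = (SUP n. cmod (a n))" for a :: "nat \<Rightarrow> complex"
  have bdd: "bdd_above (range (\<lambda>n. cmod (a n)))" if "Bseq a" for a :: "nat \<Rightarrow> complex"
    using that by (auto simp: Bseq_def bdd_above_def)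
  have upper: "cmod (a n) \<le> p a" if "Bseq a" for a n
    unfolding p_def using bdd[OF that] by (intro cSUP_upper) auto
  have least: "p a \<le> C" if "\<And>n. cmod (a n) \<le> C" for a C
    unfolding p_def using that by (intro cSUP_least) auto
  have Bseq_sum: "Bseq (\<lambda>n. a n + b n)" if "Bseq a" "Bseq b" for a b :: "nat \<Rightarrow> complex"
    using upper[OF that(1)] upper[OF that(2)]
    by (intro BseqI'[of _ "p a + p b"] norm_triangle_le add_mono)
  have V: "csubspace ?V"
    by (auto simp: csubspace_def plus_fun_def scaleC_fun_def zero_fun_def intro: Bseq_sum Bseq_mult)
  have W: "csubspace ?W" "?W \<subseteq> ?V"
    by (auto simp: csubspace_def plus_fun_def scaleC_fun_def zero_fun_def
        intro: tendsto_add_zero tendsto_mult_right_zero convergent_imp_Bseq convergentI)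
  have one: "(\<lambda>n. 1) \<in> ?V" by simp
  have p_add: "p (a + b) \<le> p a + p b" if "a \<in> ?V" "b \<in> ?V" for a b
  proof (rule least)
    fix n
    have "cmod ((a + b) n) \<le> cmod (a n) + cmod (b n)" by (simp add: norm_triangle_ineq)
    also have "\<dots> \<le> p a + p b" using that upper by (intro add_mono) auto
    finally show "cmod ((a + b) n) \<le> p a + p b" .
  qed
  have p_scale: "p (c *\<^sub>C a) \<le> cmod c * p a" if "a \<in> ?V" for c a
    using that upper by (intro least) (auto simp: norm_mult intro: mult_left_mono)
  have far: "1 \<le> p ((\<lambda>n. 1) - w)" if w: "w \<in> ?W" for w
  proof -
    have B: "Bseq ((\<lambda>n. 1) - w)" using csubspaceD(5)[OF V one] w W(2) by auto
    have "(\<lambda>n. cmod (1 - w n)) \<longlonglongrightarrow> cmod (1 - 0)"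
      using w by (intro tendsto_intros) simp
    then have "(\<lambda>n. cmod (((\<lambda>n. 1) - w) n)) \<longlonglongrightarrow> cmod (1 - 0)" by simp
    then have "cmod (1 - 0) \<le> p ((\<lambda>n. 1) - w)"
      by (rule LIMSEQ_le_const2) (use upper[OF B] in auto)
    then show ?thesis by simp
  qed
  have "\<exists>F. clinear_on ?V F \<and> (\<forall>w\<in>?W. F w = 0) \<and> F (\<lambda>n. 1) \<noteq> 0 \<and> (\<forall>a\<in>?V. cmod (F a) \<le> p a)"
    by (rule Hahn_Banach_separation[where p = p and \<delta> = 1, OF V p_add p_scale W one zero_less_one far])
  then obtain F where F: "clinear_on ?V F" "\<forall>w\<in>?W. F w = 0" "F (\<lambda>n. 1) \<noteq> 0"
    "\<forall>a\<in>?V. cmod (F a) \<le> p a"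
    by (elim exE conjE)
  show ?thesis
  proof (intro exI conjI allI impI)
    let ?L = "\<lambda>a. F a / F (\<lambda>n. 1)" and ?K = "inverse (cmod (F (\<lambda>n. 1)))"
    show "clinear_on ?V ?L" using F(1) by (auto simp: clinear_on_def add_divide_distrib)
    show "?L a = 0" if "a \<longlonglongrightarrow> 0" for a using F(2) that by simp
    show "?L (\<lambda>n. 1) = 1" using F(3) by simp
    show "cmod (?L a) \<le> ?K * C" if "\<forall>n. cmod (a n) \<le> C" for a C
    proof -
      note C = that[rule_format]
      have "Bseq a" using C by (rule BseqI')
      moreover have "p a \<le> C" by (rule least) (rule C)
      ultimately have "cmod (F a) \<le> C" using F(4) by fastforce
      then show ?thesis using F(3) by (simp add: norm_divide field_simps)
    qed
    show "?K \<ge> 0" by simp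
  qed
qed

section \<open>Seminormed spaces and their completions\<close>

text \<open>The seminorms are finite on the space, where real values are easier to compute with.\<close>

definition snorm :: "'e::complex_vector seminormed \<Rightarrow> nat \<Rightarrow> 'e \<Rightarrow> real" where
  "snorm E i \<phi> = enn2real (sn_norm E i \<phi>)"

text \<open>Since the seminorms increase, one of them suffices to bound a continuous functional.\<close>

locale seminormed_space =
  fixes E :: "'e::complex_vector seminormed"
  assumes subspace: "csubspace (sn_space E)"
    and finite: "\<phi> \<in> sn_space E \<Longrightarrow> sn_norm E i \<phi> < \<infinity>"
    and triangle: "\<lbrakk>\<phi> \<in> sn_space E; \<psi> \<in> sn_space E\<rbrakk> \<Longrightarrow> snorm E i (\<phi> + \<psi>) \<le> snorm E i \<phi> + snorm E i \<psi>"
    and scale: "\<phi> \<in> sn_space E \<Longrightarrow> snorm E i (c *\<^sub>C \<phi>) \<le> cmod c * snorm E i \<phi>"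
    and mono: "\<phi> \<in> sn_space E \<Longrightarrow> i \<le> j \<Longrightarrow> snorm E i \<phi> \<le> snorm E j \<phi>"
begin

lemmas space = csubspaceD[OF subspace]

lemma sn_norm_eq: "\<phi> \<in> sn_space E \<Longrightarrow> sn_norm E i \<phi> = ennreal (snorm E i \<phi>)"
  using finite[of \<phi> i] by (simp add: snorm_def less_top)

lemma snorm_nonneg [simp]: "0 \<le> snorm E i \<phi>"
  by (simp add: snorm_def)

lemma snorm_zero [simp]: "snorm E i 0 = 0"
  using scale[OF space(1), of i 0] by (simp add: order_antisym)

subsection \<open>Sequences\<close>

lemma bounded_seqs_iff:
  "s \<in> bounded_seqs E \<longleftrightarrow> (\<forall>n. s n \<in> sn_space E) \<and> (\<forall>i. \<exists>C. \<forall>n. snorm E i (s n) \<le> C)"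
proof -
  have "(SUP n. sn_norm E i (s n)) < \<infinity> \<longleftrightarrow> (\<exists>C. \<forall>n. snorm E i (s n) \<le> C)"
    if s: "\<forall>n. s n \<in> sn_space E" for i
  proof
    assume fin: "(SUP n. sn_norm E i (s n)) < \<infinity>"
    then obtain C where C: "(SUP n. sn_norm E i (s n)) = ennreal C" "C \<ge> 0"
      by (cases "SUP n. sn_norm E i (s n)") auto
    have "ennreal (snorm E i (s n)) \<le> ennreal C" for n
      using s C(1) sn_norm_eq by (metis SUP_upper UNIV_I)
    then show "\<exists>C. \<forall>n. snorm E i (s n) \<le> C" using C(2) by auto
  next
    assume "\<exists>C. \<forall>n. snorm E i (s n) \<le> C"
    then obtain C where "\<forall>n. snorm E i (s n) \<le> C" by blast
    then have "(SUP n. sn_norm E i (s n)) \<le> ennreal C"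
      using s by (intro SUP_least) (simp add: sn_norm_eq ennreal_leI)
    then show "(SUP n. sn_norm E i (s n)) < \<infinity>" by (simp add: order_le_less_trans)
  qed
  then show ?thesis by (auto simp: bounded_seqs_def)
qed

lemma bounded_seqs_bound: "s \<in> bounded_seqs E \<Longrightarrow> \<exists>C. \<forall>n. snorm E i (s n) \<le> C"
  by (simp add: bounded_seqs_iff)

lemma tendsto_0_bounded:
  assumes "(\<lambda>n. snorm E i (s n)) \<longlonglongrightarrow> 0" shows "\<exists>C. \<forall>n. snorm E i (s n) \<le> C"
proof -
  have "Bseq (\<lambda>n. snorm E i (s n))" using assms by (intro convergent_imp_Bseq convergentI)
  then show ?thesis by (auto simp: Bseq_def)
qed

lemma null_seqs_iff:
  "s \<in> null_seqs E \<longleftrightarrow> (\<forall>n. s n \<in> sn_space E) \<and> (\<forall>i. (\<lambda>n. snorm E i (s n)) \<longlonglongrightarrow> 0)"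
proof -
  have "(\<lambda>n. sn_norm E i (s n)) \<longlonglongrightarrow> 0 \<longleftrightarrow> (\<lambda>n. snorm E i (s n)) \<longlonglongrightarrow> 0"
    if s: "\<forall>n. s n \<in> sn_space E" for i
    using s tendsto_ennreal_iff[where f = "\<lambda>n. snorm E i (s n)" and x = 0 and F = sequentially]
    by (simp add: sn_norm_eq)
  then show ?thesis using tendsto_0_bounded unfolding null_seqs_def by (auto simp: bounded_seqs_iff)
qed

lemma bounded_seqs_csubspace: "csubspace (bounded_seqs E)"
  unfolding csubspace_def
proof (intro conjI ballI allI)
  show "0 \<in> bounded_seqs E" by (auto simp: bounded_seqs_iff space)
  fix s t assume st: "s \<in> bounded_seqs E" "t \<in> bounded_seqs E"
  have "\<exists>C. \<forall>n. snorm E i (s n + t n) \<le> C" for i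
  proof -
    obtain C D where "\<forall>n. snorm E i (s n) \<le> C" "\<forall>n. snorm E i (t n) \<le> D"
      using st[THEN bounded_seqs_bound, of i] by (elim exE)
    then have "snorm E i (s n) + snorm E i (t n) \<le> C + D" for n by (intro add_mono) auto
    moreover have "snorm E i (s n + t n) \<le> snorm E i (s n) + snorm E i (t n)" for n
      using st by (intro triangle) (auto simp: bounded_seqs_iff)
    ultimately have "snorm E i (s n + t n) \<le> C + D" for n by (rule order_trans[rotated])
    then show ?thesis by blast
  qed
  then show "s + t \<in> bounded_seqs E" using st by (auto simp: bounded_seqs_iff space)
next
  fix c s assume s: "s \<in> bounded_seqs E"
  have "\<exists>C. \<forall>n. snorm E i (c *\<^sub>C s n) \<le> C" for i
  proof -
    obtain C where C: "\<forall>n. snorm E i (s n) \<le> C" using bounded_seqs_bound[OF s] ..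
    have "snorm E i (c *\<^sub>C s n) \<le> cmod c * C" for n
      using scale[of "s n" i c] mult_left_mono[OF C[rule_format, of n], of "cmod c"] s
      by (simp add: bounded_seqs_iff)
    then show ?thesis by blast
  qed
  then show "c *\<^sub>C s \<in> bounded_seqs E" using s by (auto simp: bounded_seqs_iff space)
qed

lemma null_seqs_csubspace: "csubspace (null_seqs E)"
  unfolding csubspace_def
proof (intro conjI ballI allI)
  show "0 \<in> null_seqs E" by (auto simp: null_seqs_iff space)
  fix s t assume st: "s \<in> null_seqs E" "t \<in> null_seqs E"
  have "(\<lambda>n. snorm E i (s n + t n)) \<longlonglongrightarrow> 0" for i
  proof (rule tendsto_sandwich[of "\<lambda>n. 0" _ _ "\<lambda>n. snorm E i (s n) + snorm E i (t n)"])
    show "(\<lambda>n. snorm E i (s n) + snorm E i (t n)) \<longlonglongrightarrow> 0"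
      using st by (auto simp: null_seqs_iff intro: tendsto_add_zero)
  qed (use st triangle in \<open>auto simp: null_seqs_iff\<close>)
  then show "s + t \<in> null_seqs E" using st by (auto simp: null_seqs_iff space)
next
  fix c s assume s: "s \<in> null_seqs E"
  have "(\<lambda>n. snorm E i (c *\<^sub>C s n)) \<longlonglongrightarrow> 0" for i
  proof (rule tendsto_sandwich[of "\<lambda>n. 0" _ _ "\<lambda>n. cmod c * snorm E i (s n)"])
    show "(\<lambda>n. cmod c * snorm E i (s n)) \<longlonglongrightarrow> 0"
      using s by (auto simp: null_seqs_iff intro: tendsto_mult_right_zero)
  qed (use s scale in \<open>auto simp: null_seqs_iff\<close>)
  then show "c *\<^sub>C s \<in> null_seqs E" using s by (auto simp: null_seqs_iff space)
qed

lemma null_seqs_bounded: "null_seqs E \<subseteq> bounded_seqs E"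
  by (auto simp: null_seqs_def)

lemma const_bounded: "\<phi> \<in> sn_space E \<Longrightarrow> (\<lambda>n. \<phi>) \<in> bounded_seqs E"
  by (auto simp: bounded_seqs_iff)

end

subsection \<open>The quotient completion as an abelian group\<close>

lemma additive_group_simps [simp]:
  "carrier (additive_group V) = V" "monoid.mult (additive_group V) = (+)" "one (additive_group V) = 0"
  by (simp_all add: additive_group_def)

lemma comm_group_additive_group:
  assumes "csubspace V" shows "comm_group (additive_group V)"
  using csubspaceD[OF assms]
  by (intro comm_groupI) (auto simp: add.assoc add.commute intro!: bexI[of _ "- _"])

lemma subgroup_additive_group:
  assumes V: "csubspace V" and W: "csubspace W" "W \<subseteq> V"
  shows "subgroup W (additive_group V)"
proof -
  interpret V: comm_group "additive_group V" by (rule comm_group_additive_group[OF V])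
  have "inv\<^bsub>additive_group V\<^esub> x = - x" if "x \<in> V" for x
    using that csubspaceD(4)[OF V] by (intro V.inv_equality) auto
  then show ?thesis
    using csubspaceD[OF W(1)] W(2) by unfold_locales auto
qed

context seminormed_space
begin

lemma mem_Q_class: "t \<in> Q_class E s \<longleftrightarrow> t - s \<in> null_seqs E"
proof -
  have "t \<in> Q_class E s \<longleftrightarrow> (\<exists>h\<in>null_seqs E. t = h + s)"
    by (simp add: Q_class_def r_coset_def)
  also have "\<dots> \<longleftrightarrow> t - s \<in> null_seqs E"
    by (auto simp: algebra_simps intro!: bexI[of _ "t - s"])
  finally show ?thesis .
qed

lemma Q_class_eq_iff: "Q_class E s = Q_class E t \<longleftrightarrow> s - t \<in> null_seqs E"
proof
  assume "Q_class E s = Q_class E t"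
  moreover have "s \<in> Q_class E s" by (simp add: mem_Q_class csubspaceD[OF null_seqs_csubspace])
  ultimately show "s - t \<in> null_seqs E" by (simp add: mem_Q_class)
next
  assume st: "s - t \<in> null_seqs E"
  have "r - s \<in> null_seqs E \<longleftrightarrow> r - t \<in> null_seqs E" for r
    using csubspaceD(2)[OF null_seqs_csubspace _ st, of "r - s"]
      csubspaceD(5)[OF null_seqs_csubspace _ st, of "r - t"] by auto
  then show "Q_class E s = Q_class E t" by (auto simp: mem_Q_class)
qed

lemma normal_null_seqs: "null_seqs E \<lhd> additive_group (bounded_seqs E)"
  using comm_group.subgroup_imp_normal[OF comm_group_additive_group subgroup_additive_group]
    bounded_seqs_csubspace null_seqs_csubspace null_seqs_bounded by blast

lemma comm_group_Q: "comm_group (Q_completion E)"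
  unfolding Q_completion_def
  by (intro comm_group.abelian_FactGroup comm_group_additive_group subgroup_additive_group
      bounded_seqs_csubspace null_seqs_csubspace null_seqs_bounded)

lemma carrier_Q: "carrier (Q_completion E) = Q_class E ` bounded_seqs E"
  by (simp add: Q_completion_def carrier_FactGroup Q_class_def[abs_def])

lemma one_Q: "\<one>\<^bsub>Q_completion E\<^esub> = Q_class E 0"
  by (auto simp: Q_completion_def mem_Q_class)

lemma mult_Q:
  "s \<in> bounded_seqs E \<Longrightarrow> t \<in> bounded_seqs E
    \<Longrightarrow> Q_class E s \<otimes>\<^bsub>Q_completion E\<^esub> Q_class E t = Q_class E (s + t)"
  using normal.rcos_sum[OF normal_null_seqs, of s t] by (simp add: Q_completion_def Q_class_def)

lemma Q_class_eq_one_iff: "Q_class E s = \<one>\<^bsub>Q_completion E\<^esub> \<longleftrightarrow> s \<in> null_seqs E"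
  by (simp add: one_Q Q_class_eq_iff)

subsection \<open>Duals\<close>

lemma sn_ball_simps:
  assumes "\<phi> \<in> sn_space E" "\<psi> \<in> sn_space E"
  shows "sn_norm E i (\<psi> - \<phi>) < ennreal r \<longleftrightarrow> snorm E i (\<psi> - \<phi>) < r"
  using assms by (simp add: sn_norm_eq space ennreal_less_iff)

lemma topspace_sn: "topspace (sn_topology E) = sn_space E"
proof -
  let ?B = "\<lambda>\<phi> i r. {\<psi> \<in> sn_space E. sn_norm E i (\<psi> - \<phi>) < ennreal r}"
  have "\<phi> \<in> \<Union> {?B \<phi> i r | \<phi> i r. \<phi> \<in> sn_space E \<and> r > 0}" if "\<phi> \<in> sn_space E" for \<phi>
  proof (rule UnionI)
    show "?B \<phi> 0 1 \<in> {?B \<phi> i r | \<phi> i r. \<phi> \<in> sn_space E \<and> r > 0}"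
      using that zero_less_one by blast
    show "\<phi> \<in> ?B \<phi> 0 1" using that sn_ball_simps[OF that that, of 0 1] by simp
  qed
  moreover have "\<Union> {?B \<phi> i r | \<phi> i r. \<phi> \<in> sn_space E \<and> r > 0} \<subseteq> sn_space E" by auto
  ultimately have "\<Union> {?B \<phi> i r | \<phi> i r. \<phi> \<in> sn_space E \<and> r > 0} = sn_space E"
    by (rule subset_antisym[OF _ subsetI, rotated])
  then show ?thesis unfolding sn_topology_def topology_generated_by_topspace .
qed

text \<open>Since the seminorms increase, the finite intersections of basic neighbourhoods of a point contain
  a ball of a single seminorm.\<close>

lemma openin_sn_ball:
  assumes "openin (sn_topology E) U" "\<phi> \<in> U"
  shows "\<exists>i r. r > 0 \<and> (\<forall>\<psi>\<in>sn_space E. snorm E i (\<psi> - \<phi>) < r \<longrightarrow> \<psi> \<in> U)"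
proof -
  have \<phi>: "\<phi> \<in> sn_space E" using openin_subset[OF assms(1)] assms(2) topspace_sn by blast
  have "generate_topology_on {{\<psi> \<in> sn_space E. sn_norm E i (\<psi> - \<phi>) < ennreal r} | \<phi> i r. \<phi> \<in> sn_space E \<and> r > 0} U"
    using assms(1) unfolding sn_topology_def by (rule openin_topology_generated_by)
  then show ?thesis using assms(2)
  proof induction
    case Empty
    then show ?case by simp
  next
    case (Int a b)
    then obtain i r j s where r: "r > 0" "\<forall>\<psi>\<in>sn_space E. snorm E i (\<psi> - \<phi>) < r \<longrightarrow> \<psi> \<in> a"
      and s: "s > 0" "\<forall>\<psi>\<in>sn_space E. snorm E j (\<psi> - \<phi>) < s \<longrightarrow> \<psi> \<in> b" by blast
    have "\<psi> \<in> a \<inter> b" if "\<psi> \<in> sn_space E" "snorm E (max i j) (\<psi> - \<phi>) < min r s" for \<psi>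
      using that r s mono[of "\<psi> - \<phi>" i "max i j"] mono[of "\<psi> - \<phi>" j "max i j"] space(5)[OF that(1) \<phi>] by auto
    then show ?case using r(1) s(1) by (intro exI[of _ "max i j"] exI[of _ "min r s"]) auto
  next
    case (UN K)
    then show ?case by (meson UnionE UnionI)
  next
    case (Basis S)
    then obtain \<phi>0 i r where S: "S = {\<psi> \<in> sn_space E. sn_norm E i (\<psi> - \<phi>0) < ennreal r}"
      and \<phi>0: "\<phi>0 \<in> sn_space E" by auto
    have "snorm E i (\<phi> - \<phi>0) < r" using Basis S sn_ball_simps[OF \<phi>0 \<phi>] by simp
    moreover have "\<psi> \<in> S" if "\<psi> \<in> sn_space E" "snorm E i (\<psi> - \<phi>) < r - snorm E i (\<phi> - \<phi>0)" for \<psi>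
      using triangle[of "\<psi> - \<phi>" "\<phi> - \<phi>0" i] that \<phi> \<phi>0 sn_ball_simps[OF \<phi>0 that(1)] by (simp add: S space)
    ultimately show ?case by (intro exI[of _ i] exI[of _ "r - snorm E i (\<phi> - \<phi>0)"]) auto
  qed
qed

lemma ball_openin_sn:
  assumes "\<phi> \<in> sn_space E" "r > 0"
  shows "openin (sn_topology E) {\<psi> \<in> sn_space E. snorm E i (\<psi> - \<phi>) < r}"
proof -
  have "{\<psi> \<in> sn_space E. snorm E i (\<psi> - \<phi>) < r} = {\<psi> \<in> sn_space E. sn_norm E i (\<psi> - \<phi>) < ennreal r}"
    using sn_ball_simps[OF assms(1)] by blast
  then show ?thesis
    unfolding sn_topology_def using assms by (intro topology_generated_by_Basis) auto
qed

text \<open>A continuous functional has modulus less than \<open>1\<close> on a ball of a single seminorm around \<open>0\<close>, and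
  rescaling turns this into a bound by that seminorm.\<close>

lemma cdual_iff:
  "\<alpha> \<in> cdual E \<longleftrightarrow> clinear_on (sn_space E) \<alpha> \<and> vanishes_off (sn_space E) \<alpha>
    \<and> (\<exists>i C. \<forall>\<phi>\<in>sn_space E. cmod (\<alpha> \<phi>) \<le> C * snorm E i \<phi>)"
proof -
  have "continuous_map (sn_topology E) euclidean \<alpha>
      \<longleftrightarrow> (\<exists>i C. \<forall>\<phi>\<in>sn_space E. cmod (\<alpha> \<phi>) \<le> C * snorm E i \<phi>)"
    if lin: "clinear_on (sn_space E) \<alpha>"
  proof
    assume "continuous_map (sn_topology E) euclidean \<alpha>"
    then have op: "openin (sn_topology E) {\<phi> \<in> sn_space E. \<alpha> \<phi> \<in> ball 0 1}"
      using openin_continuous_map_preimage[of "sn_topology E" euclidean \<alpha> "ball 0 1"]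
      unfolding topspace_sn by simp
    have "\<alpha> (0 *\<^sub>C 0) = 0 * \<alpha> 0" using lin space(1) unfolding clinear_on_def by blast
    then have "0 \<in> {\<phi> \<in> sn_space E. \<alpha> \<phi> \<in> ball 0 1}" using space(1) by simp
    from openin_sn_ball[OF op this] obtain i r where r: "r > 0"
      and *: "\<forall>\<psi>\<in>sn_space E. snorm E i (\<psi> - 0) < r \<longrightarrow> \<psi> \<in> {\<phi> \<in> sn_space E. \<alpha> \<phi> \<in> ball 0 1}"
      by (elim exE conjE)
    have "cmod (\<alpha> \<phi>) \<le> (1 / r) * snorm E i \<phi>" if \<phi>: "\<phi> \<in> sn_space E" for \<phi>
    proof (rule ccontr)
      assume less: "\<not> cmod (\<alpha> \<phi>) \<le> (1 / r) * snorm E i \<phi>"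
      define a where "a = cmod (\<alpha> \<phi>)"
      have less': "snorm E i \<phi> < r * a" using less r by (simp add: a_def field_simps)
      then have "0 < r * a" using order_le_less_trans[OF snorm_nonneg] by blast
      then have a: "a > 0" using r by (simp add: zero_less_mult_iff)
      have "snorm E i (of_real (1 / a) *\<^sub>C \<phi>) \<le> (1 / a) * snorm E i \<phi>"
        using scale[OF \<phi>, of i "of_real (1 / a)"] a by (simp add: norm_divide)
      also have "\<dots> < r" using less' a by (simp add: field_simps)
      finally have "cmod (\<alpha> (of_real (1 / a) *\<^sub>C \<phi>)) < 1" using * \<phi> space by auto
      moreover have "cmod (\<alpha> (of_real (1 / a) *\<^sub>C \<phi>)) = (1 / a) * a"
        using lin \<phi> a by (simp add: clinear_on_def norm_mult a_def norm_divide)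
      ultimately show False using a by simp
    qed
    then show "\<exists>i C. \<forall>\<phi>\<in>sn_space E. cmod (\<alpha> \<phi>) \<le> C * snorm E i \<phi>" by blast
  next
    assume "\<exists>i C. \<forall>\<phi>\<in>sn_space E. cmod (\<alpha> \<phi>) \<le> C * snorm E i \<phi>"
    then obtain i C where C: "\<forall>\<phi>\<in>sn_space E. cmod (\<alpha> \<phi>) \<le> C * snorm E i \<phi>" by blast
    have C': "cmod (\<alpha> \<psi> - \<alpha> \<phi>) \<le> (\<bar>C\<bar> + 1) * snorm E i (\<psi> - \<phi>)"
      if "\<phi> \<in> sn_space E" "\<psi> \<in> sn_space E" for \<phi> \<psi>
    proof -
      have "\<alpha> ((\<psi> - \<phi>) + \<phi>) = \<alpha> (\<psi> - \<phi>) + \<alpha> \<phi>"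
        using lin that space(5) unfolding clinear_on_def by blast
      then have "cmod (\<alpha> \<psi> - \<alpha> \<phi>) \<le> C * snorm E i (\<psi> - \<phi>)" using C that space(5) by simp
      also have "\<dots> \<le> (\<bar>C\<bar> + 1) * snorm E i (\<psi> - \<phi>)" by (intro mult_right_mono) auto
      finally show ?thesis .
    qed
    show "continuous_map (sn_topology E) euclidean \<alpha>"
      unfolding continuous_map_def
    proof (intro conjI allI impI)
      fix U :: "complex set" assume "openin euclidean U"
      then have U: "open U" by simp
      show "openin (sn_topology E) {\<phi> \<in> topspace (sn_topology E). \<alpha> \<phi> \<in> U}"
      proof (subst openin_subopen, safe)
        fix \<phi> assume \<phi>: "\<phi> \<in> topspace (sn_topology E)" "\<alpha> \<phi> \<in> U"
        then obtain e where e: "e > 0" "ball (\<alpha> \<phi>) e \<subseteq> U" using U open_contains_ball by blast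
        let ?B = "{\<psi> \<in> sn_space E. snorm E i (\<psi> - \<phi>) < e / (\<bar>C\<bar> + 1)}"
        have "\<alpha> \<psi> \<in> U" if "\<psi> \<in> ?B" for \<psi>
        proof -
          have "cmod (\<alpha> \<psi> - \<alpha> \<phi>) \<le> (\<bar>C\<bar> + 1) * snorm E i (\<psi> - \<phi>)"
            using C'[of \<phi> \<psi>] that \<phi> topspace_sn by blast
          also have "\<dots> < e" using that by (simp add: field_simps)
          finally show ?thesis using e by (auto simp: dist_norm norm_minus_commute)
        qed
        then show "\<exists>T. openin (sn_topology E) T \<and> \<phi> \<in> T \<and> T \<subseteq> {\<phi> \<in> topspace (sn_topology E). \<alpha> \<phi> \<in> U}"
          using ball_openin_sn[of \<phi> "e / (\<bar>C\<bar> + 1)" i] \<phi> e(1)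
          by (intro exI[of _ ?B]) (auto simp: topspace_sn)
      qed
    qed simp
  qed
  then show ?thesis unfolding cdual_def by blast
qed

lemma cdualD:
  assumes "\<alpha> \<in> cdual E"
  shows "\<And>\<phi> \<psi>. \<phi> \<in> sn_space E \<Longrightarrow> \<psi> \<in> sn_space E \<Longrightarrow> \<alpha> (\<phi> + \<psi>) = \<alpha> \<phi> + \<alpha> \<psi>"
    and "\<And>\<phi> c. \<phi> \<in> sn_space E \<Longrightarrow> \<alpha> (c *\<^sub>C \<phi>) = c * \<alpha> \<phi>"
    and "\<And>\<phi>. \<phi> \<notin> sn_space E \<Longrightarrow> \<alpha> \<phi> = 0"
    and "\<exists>i C. C \<ge> 0 \<and> (\<forall>\<phi>\<in>sn_space E. cmod (\<alpha> \<phi>) \<le> C * snorm E i \<phi>)"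
proof -
  from assms obtain i C where "\<forall>\<phi>\<in>sn_space E. cmod (\<alpha> \<phi>) \<le> C * snorm E i \<phi>" by (auto simp: cdual_iff)
  moreover have "C * snorm E i \<phi> \<le> \<bar>C\<bar> * snorm E i \<phi>" for \<phi> by (intro mult_right_mono) auto
  ultimately have "\<forall>\<phi>\<in>sn_space E. cmod (\<alpha> \<phi>) \<le> \<bar>C\<bar> * snorm E i \<phi>" using order_trans by blast
  then show "\<exists>i C. C \<ge> 0 \<and> (\<forall>\<phi>\<in>sn_space E. cmod (\<alpha> \<phi>) \<le> C * snorm E i \<phi>)"
    by (intro exI[of _ i] exI[of _ "\<bar>C\<bar>"]) simp
qed (use assms in \<open>auto simp: cdual_iff clinear_on_def vanishes_off_def\<close>)

lemma cdual_csubspace: "csubspace (cdual E)"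
  unfolding csubspace_def
proof (intro conjI ballI allI)
  show "0 \<in> cdual E" by (auto simp: cdual_iff clinear_on_def vanishes_off_def intro!: exI[of _ 0])
  fix \<alpha> \<beta> assume \<alpha>: "\<alpha> \<in> cdual E" and \<beta>: "\<beta> \<in> cdual E"
  from cdualD(4)[OF \<alpha>] obtain i C where C: "C \<ge> 0" "\<forall>\<phi>\<in>sn_space E. cmod (\<alpha> \<phi>) \<le> C * snorm E i \<phi>" by blast
  from cdualD(4)[OF \<beta>] obtain j D where D: "D \<ge> 0" "\<forall>\<phi>\<in>sn_space E. cmod (\<beta> \<phi>) \<le> D * snorm E j \<phi>" by blast
  have "cmod ((\<alpha> + \<beta>) \<phi>) \<le> (C + D) * snorm E (max i j) \<phi>" if \<phi>: "\<phi> \<in> sn_space E" for \<phi>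
  proof -
    have "cmod (\<alpha> \<phi>) \<le> C * snorm E (max i j) \<phi>"
      using C \<phi> mult_left_mono[OF mono[OF \<phi>, of i "max i j"] C(1)] by fastforce
    moreover have "cmod (\<beta> \<phi>) \<le> D * snorm E (max i j) \<phi>"
      using D \<phi> mult_left_mono[OF mono[OF \<phi>, of j "max i j"] D(1)] by fastforce
    ultimately show ?thesis using norm_triangle_ineq[of "\<alpha> \<phi>" "\<beta> \<phi>"] by (simp add: distrib_right)
  qed
  then have "\<exists>i C. \<forall>\<phi>\<in>sn_space E. cmod ((\<alpha> + \<beta>) \<phi>) \<le> C * snorm E i \<phi>" by blast
  then show "\<alpha> + \<beta> \<in> cdual E"
    using cdualD(1-3)[OF \<alpha>] cdualD(1-3)[OF \<beta>] unfolding cdual_iff clinear_on_def vanishes_off_def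
    by (simp add: algebra_simps)
next
  fix c \<alpha> assume \<alpha>: "\<alpha> \<in> cdual E"
  from cdualD(4)[OF \<alpha>] obtain i C where C: "\<forall>\<phi>\<in>sn_space E. cmod (\<alpha> \<phi>) \<le> C * snorm E i \<phi>" by blast
  then have "\<forall>\<phi>\<in>sn_space E. cmod ((c *\<^sub>C \<alpha>) \<phi>) \<le> (cmod c * C) * snorm E i \<phi>"
    by (simp add: norm_mult mult.assoc mult_left_mono)
  then have "\<exists>i C. \<forall>\<phi>\<in>sn_space E. cmod ((c *\<^sub>C \<alpha>) \<phi>) \<le> C * snorm E i \<phi>" by blast
  then show "c *\<^sub>C \<alpha> \<in> cdual E"
    using cdualD(1-3)[OF \<alpha>] unfolding cdual_iff clinear_on_def vanishes_off_def
    by (simp add: algebra_simps)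
qed

lemma dual_norm_le_1_iff:
  assumes "\<alpha> \<in> cdual E"
  shows "dual_norm E i \<alpha> \<le> 1 \<longleftrightarrow> (\<forall>\<phi>\<in>sn_space E. cmod (\<alpha> \<phi>) \<le> snorm E i \<phi>)"
proof -
  have "dual_norm E i \<alpha> \<le> 1 \<longleftrightarrow> (\<forall>\<phi>\<in>sn_space E. snorm E i \<phi> \<le> 1 \<longrightarrow> cmod (\<alpha> \<phi>) \<le> 1)"
    unfolding dual_norm_def by (auto simp: SUP_le_iff sn_norm_eq)
  also have "\<dots> \<longleftrightarrow> (\<forall>\<phi>\<in>sn_space E. cmod (\<alpha> \<phi>) \<le> snorm E i \<phi>)"
  proof (intro iffI ballI)
    fix \<phi> assume *: "\<forall>\<phi>\<in>sn_space E. snorm E i \<phi> \<le> 1 \<longrightarrow> cmod (\<alpha> \<phi>) \<le> 1" and \<phi>: "\<phi> \<in> sn_space E"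
    show "cmod (\<alpha> \<phi>) \<le> snorm E i \<phi>"
    proof (rule field_le_epsilon)
      fix e :: real assume e: "e > 0"
      \<comment> \<open>The seminorm of \<open>\<phi>\<close> may be \<open>0\<close>; adding \<open>e\<close> makes it possible to divide by it.\<close>
      define b where "b = snorm E i \<phi> + e"
      have b: "b > 0" using e by (simp add: b_def add_nonneg_pos)
      have "snorm E i (of_real (1 / b) *\<^sub>C \<phi>) \<le> (1 / b) * snorm E i \<phi>"
        using scale[OF \<phi>, of i "of_real (1 / b)"] b by (simp add: norm_divide)
      also have "\<dots> \<le> 1" using b e by (simp add: b_def)
      finally have "cmod (\<alpha> (of_real (1 / b) *\<^sub>C \<phi>)) \<le> 1" using * space(3)[OF \<phi>] by blast
      then show "cmod (\<alpha> \<phi>) \<le> snorm E i \<phi> + e"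
        using b cdualD(2)[OF assms \<phi>] by (simp add: norm_mult norm_divide b_def[symmetric])
    qed
  qed force
  finally show ?thesis .
qed

lemma bidual_iff:
  "\<eta> \<in> bidual E \<longleftrightarrow> clinear_on (cdual E) \<eta> \<and> vanishes_off (cdual E) \<eta>
    \<and> (\<forall>i. \<exists>C. \<forall>\<alpha>\<in>cdual E. (\<forall>\<phi>\<in>sn_space E. cmod (\<alpha> \<phi>) \<le> snorm E i \<phi>) \<longrightarrow> cmod (\<eta> \<alpha>) \<le> C)"
proof -
  have "(SUP \<alpha>\<in>A. ennreal (cmod (\<eta> \<alpha>))) < \<infinity> \<longleftrightarrow> (\<exists>C. \<forall>\<alpha>\<in>A. cmod (\<eta> \<alpha>) \<le> C)" for A
  proof
    assume fin: "(SUP \<alpha>\<in>A. ennreal (cmod (\<eta> \<alpha>))) < \<infinity>"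
    then obtain C where C: "(SUP \<alpha>\<in>A. ennreal (cmod (\<eta> \<alpha>))) = ennreal C" "C \<ge> 0"
      by (cases "SUP \<alpha>\<in>A. ennreal (cmod (\<eta> \<alpha>))") auto
    have "ennreal (cmod (\<eta> \<alpha>)) \<le> ennreal C" if "\<alpha> \<in> A" for \<alpha>
      unfolding C(1)[symmetric] using that by (rule SUP_upper)
    then show "\<exists>C. \<forall>\<alpha>\<in>A. cmod (\<eta> \<alpha>) \<le> C" using C(2) by auto
  next
    assume "\<exists>C. \<forall>\<alpha>\<in>A. cmod (\<eta> \<alpha>) \<le> C"
    then obtain C where "\<forall>\<alpha>\<in>A. cmod (\<eta> \<alpha>) \<le> C" by blast
    then have "(SUP \<alpha>\<in>A. ennreal (cmod (\<eta> \<alpha>))) \<le> ennreal C"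
      by (intro SUP_least) (simp add: ennreal_leI)
    then show "(SUP \<alpha>\<in>A. ennreal (cmod (\<eta> \<alpha>))) < \<infinity>" by (simp add: order_le_less_trans)
  qed
  moreover have "{\<alpha> \<in> cdual E. dual_norm E i \<alpha> \<le> 1}
      = {\<alpha> \<in> cdual E. \<forall>\<phi>\<in>sn_space E. cmod (\<alpha> \<phi>) \<le> snorm E i \<phi>}" for i
    using dual_norm_le_1_iff by blast
  ultimately show ?thesis unfolding bidual_def by (simp add: imp_conjL Ball_def)
qed

lemma bidual_bound:
  "\<eta> \<in> bidual E \<Longrightarrow> \<exists>C. \<forall>\<alpha>\<in>cdual E. (\<forall>\<phi>\<in>sn_space E. cmod (\<alpha> \<phi>) \<le> snorm E i \<phi>) \<longrightarrow> cmod (\<eta> \<alpha>) \<le> C"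
  by (simp add: bidual_iff)

lemma bidual_csubspace: "csubspace (bidual E)"
  unfolding csubspace_def
proof (intro conjI ballI allI)
  show "0 \<in> bidual E" by (auto simp: bidual_iff clinear_on_def vanishes_off_def intro!: exI[of _ 0])
  fix \<eta> \<theta> assume a: "\<eta> \<in> bidual E" "\<theta> \<in> bidual E"
  have "\<exists>C. \<forall>\<alpha>\<in>cdual E. (\<forall>\<phi>\<in>sn_space E. cmod (\<alpha> \<phi>) \<le> snorm E i \<phi>) \<longrightarrow> cmod ((\<eta> + \<theta>) \<alpha>) \<le> C" for i
  proof -
    obtain C D
      where "\<forall>\<alpha>\<in>cdual E. (\<forall>\<phi>\<in>sn_space E. cmod (\<alpha> \<phi>) \<le> snorm E i \<phi>) \<longrightarrow> cmod (\<eta> \<alpha>) \<le> C"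
        "\<forall>\<alpha>\<in>cdual E. (\<forall>\<phi>\<in>sn_space E. cmod (\<alpha> \<phi>) \<le> snorm E i \<phi>) \<longrightarrow> cmod (\<theta> \<alpha>) \<le> D"
      using a[THEN bidual_bound, of i] by (elim exE)
    then show ?thesis by (intro exI[of _ "C + D"]) (auto intro!: norm_triangle_le add_mono)
  qed
  then show "\<eta> + \<theta> \<in> bidual E"
    using a unfolding bidual_iff clinear_on_def vanishes_off_def by (simp add: algebra_simps)
next
  fix c \<eta> assume a: "\<eta> \<in> bidual E"
  have "\<exists>C. \<forall>\<alpha>\<in>cdual E. (\<forall>\<phi>\<in>sn_space E. cmod (\<alpha> \<phi>) \<le> snorm E i \<phi>) \<longrightarrow> cmod ((c *\<^sub>C \<eta>) \<alpha>) \<le> C" for i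
  proof -
    obtain C
      where "\<forall>\<alpha>\<in>cdual E. (\<forall>\<phi>\<in>sn_space E. cmod (\<alpha> \<phi>) \<le> snorm E i \<phi>) \<longrightarrow> cmod (\<eta> \<alpha>) \<le> C"
      using bidual_bound[OF a] ..
    then show ?thesis by (intro exI[of _ "cmod c * C"]) (auto simp: norm_mult intro!: mult_left_mono)
  qed
  then show "c *\<^sub>C \<eta> \<in> bidual E"
    using a unfolding bidual_iff clinear_on_def vanishes_off_def by (simp add: algebra_simps)
qed

lemma W_completion_simps [simp]:
  "carrier (W_completion E) = bidual E" "monoid.mult (W_completion E) = (+)" "one (W_completion E) = 0"
  by (simp_all add: W_completion_def)

lemma comm_group_W: "comm_group (W_completion E)"
  unfolding W_completion_def by (intro comm_group_additive_group bidual_csubspace)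

end

subsection \<open>Continuous linear maps\<close>

locale cont_linear =
  E: seminormed_space E + F: seminormed_space F
  for E :: "'e::complex_vector seminormed" and F :: "'f::complex_vector seminormed" +
  fixes T :: "'e \<Rightarrow> 'f"
  assumes maps: "\<phi> \<in> sn_space E \<Longrightarrow> T \<phi> \<in> sn_space F"
    and add: "\<phi> \<in> sn_space E \<Longrightarrow> \<psi> \<in> sn_space E \<Longrightarrow> T (\<phi> + \<psi>) = T \<phi> + T \<psi>"
    and scaleC: "\<phi> \<in> sn_space E \<Longrightarrow> T (c *\<^sub>C \<phi>) = c *\<^sub>C T \<phi>"
    and bounded: "\<exists>i C. C \<ge> 0 \<and> (\<forall>\<phi>\<in>sn_space E. snorm F j (T \<phi>) \<le> C * snorm E i \<phi>)"
begin

lemma diff: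
  assumes "\<phi> \<in> sn_space E" "\<psi> \<in> sn_space E"
  shows "T (\<phi> - \<psi>) = T \<phi> - T \<psi>"
  using add[OF E.space(5)[OF assms] assms(2)] by simp

lemma bounded_seqs_map:
  assumes "s \<in> bounded_seqs E" shows "(\<lambda>n. T (s n)) \<in> bounded_seqs F"
proof -
  have "\<exists>K. \<forall>n. snorm F j (T (s n)) \<le> K" for j
  proof -
    obtain i C where C: "C \<ge> 0" "\<forall>\<phi>\<in>sn_space E. snorm F j (T \<phi>) \<le> C * snorm E i \<phi>"
      using bounded by blast
    obtain B where "\<forall>n. snorm E i (s n) \<le> B" using E.bounded_seqs_bound[OF assms] ..
    then have "snorm F j (T (s n)) \<le> C * B" for n
      using C assms mult_left_mono[of "snorm E i (s n)" B C]
      by (auto simp: E.bounded_seqs_iff intro: order_trans)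
    then show ?thesis by blast
  qed
  then show ?thesis using assms maps by (auto simp: E.bounded_seqs_iff F.bounded_seqs_iff)
qed

lemma null_seqs_map:
  assumes "s \<in> null_seqs E" shows "(\<lambda>n. T (s n)) \<in> null_seqs F"
proof -
  have "(\<lambda>n. snorm F j (T (s n))) \<longlonglongrightarrow> 0" for j
  proof -
    obtain i C where C: "C \<ge> 0" "\<forall>\<phi>\<in>sn_space E. snorm F j (T \<phi>) \<le> C * snorm E i \<phi>"
      using bounded by blast
    show ?thesis
    proof (rule tendsto_sandwich[of "\<lambda>n. 0" _ _ "\<lambda>n. C * snorm E i (s n)"])
      show "(\<lambda>n. C * snorm E i (s n)) \<longlonglongrightarrow> 0"
        using assms by (auto simp: E.null_seqs_iff intro: tendsto_mult_right_zero)
    qed (use assms C in \<open>auto simp: E.null_seqs_iff\<close>)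
  qed
  then show ?thesis using assms maps by (auto simp: E.null_seqs_iff F.null_seqs_iff)
qed

lemma Q_map_class:
  assumes s: "s \<in> bounded_seqs E"
  shows "Q_map F T (Q_class E s) = Q_class F (\<lambda>n. T (s n))"
proof -
  have "Q_class F (\<lambda>n. T (t n)) = Q_class F (\<lambda>n. T (s n))" if t: "t \<in> Q_class E s" for t
  proof -
    have ts: "t - s \<in> null_seqs E" using t by (simp add: E.mem_Q_class)
    then have "t - s + s \<in> bounded_seqs E"
      using s E.null_seqs_bounded csubspaceD(2)[OF E.bounded_seqs_csubspace] by blast
    then have "t n \<in> sn_space E" "s n \<in> sn_space E" for n using s by (auto simp: E.bounded_seqs_iff)
    then have "(\<lambda>n. T (t n)) - (\<lambda>n. T (s n)) = (\<lambda>n. T ((t - s) n))" by (auto simp: diff)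
    then show ?thesis using null_seqs_map[OF ts] by (simp add: F.Q_class_eq_iff)
  qed
  moreover have "s \<in> Q_class E s"
    by (simp add: E.mem_Q_class csubspaceD(1)[OF E.null_seqs_csubspace])
  ultimately show ?thesis unfolding Q_map_def by blast
qed

lemma Q_map_hom: "Q_map F T \<in> hom (Q_completion E) (Q_completion F)"
proof (rule homI)
  fix c assume "c \<in> carrier (Q_completion E)"
  then show "Q_map F T c \<in> carrier (Q_completion F)"
    using Q_map_class bounded_seqs_map by (auto simp: E.carrier_Q F.carrier_Q)
next
  fix c c' assume "c \<in> carrier (Q_completion E)" "c' \<in> carrier (Q_completion E)"
  then obtain s t where s: "s \<in> bounded_seqs E" "c = Q_class E s"
    and t: "t \<in> bounded_seqs E" "c' = Q_class E t" by (auto simp: E.carrier_Q)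
  have "(\<lambda>n. T ((s + t) n)) = (\<lambda>n. T (s n)) + (\<lambda>n. T (t n))"
    using s t by (auto simp: E.bounded_seqs_iff add)
  then show "Q_map F T (c \<otimes>\<^bsub>Q_completion E\<^esub> c') = Q_map F T c \<otimes>\<^bsub>Q_completion F\<^esub> Q_map F T c'"
    using s t csubspaceD(2)[OF E.bounded_seqs_csubspace] bounded_seqs_map
    by (simp add: E.mult_Q F.mult_Q Q_map_class)
qed

lemma transpose_map_cdual:
  assumes \<beta>: "\<beta> \<in> cdual F" shows "transpose_map E T \<beta> \<in> cdual E"
proof -
  obtain j D where D: "D \<ge> 0" "\<forall>\<psi>\<in>sn_space F. cmod (\<beta> \<psi>) \<le> D * snorm F j \<psi>"
    using F.cdualD(4)[OF \<beta>] by blast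
  obtain i C where C: "C \<ge> 0" "\<forall>\<phi>\<in>sn_space E. snorm F j (T \<phi>) \<le> C * snorm E i \<phi>"
    using bounded by blast
  have "cmod (transpose_map E T \<beta> \<phi>) \<le> (D * C) * snorm E i \<phi>" if \<phi>: "\<phi> \<in> sn_space E" for \<phi>
  proof -
    have "cmod (\<beta> (T \<phi>)) \<le> D * snorm F j (T \<phi>)" using D maps[OF \<phi>] by blast
    also have "\<dots> \<le> D * (C * snorm E i \<phi>)" using C \<phi> D(1) by (intro mult_left_mono) auto
    finally show ?thesis using \<phi> by (simp add: transpose_map_def mult.assoc)
  qed
  then show ?thesis
    unfolding E.cdual_iff
    by (auto simp: clinear_on_def vanishes_off_def transpose_map_def E.space add scaleC
        F.cdualD(1,2)[OF \<beta>] maps)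
qed

lemma transpose_map_add: "transpose_map E T (\<beta> + \<gamma>) = transpose_map E T \<beta> + transpose_map E T \<gamma>"
  and transpose_map_scaleC: "transpose_map E T (c *\<^sub>C \<beta>) = c *\<^sub>C transpose_map E T \<beta>"
  by (auto simp: transpose_map_def)

lemma W_map_bidual:
  assumes \<eta>: "\<eta> \<in> bidual E" shows "W_map E F T \<eta> \<in> bidual F"
proof -
  note lin = \<eta>[unfolded E.bidual_iff clinear_on_def]
  have "\<exists>K. \<forall>\<beta>\<in>cdual F. (\<forall>\<psi>\<in>sn_space F. cmod (\<beta> \<psi>) \<le> snorm F j \<psi>) \<longrightarrow> cmod (W_map E F T \<eta> \<beta>) \<le> K" for j
  proof -
    obtain i C0 where C0: "C0 \<ge> 0" "\<forall>\<phi>\<in>sn_space E. snorm F j (T \<phi>) \<le> C0 * snorm E i \<phi>"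
      using bounded by blast
    \<comment> \<open>a positive constant, by which functionals can be divided\<close>
    define C where "C = C0 + 1"
    have C: "C > 0" "snorm F j (T \<phi>) \<le> C * snorm E i \<phi>" if "\<phi> \<in> sn_space E" for \<phi>
      using C0 that by (auto simp: C_def distrib_right intro: add_increasing2)
    have Cpos: "C > 0" using C0(1) by (simp add: C_def)
    obtain K where K: "\<forall>\<alpha>\<in>cdual E. (\<forall>\<phi>\<in>sn_space E. cmod (\<alpha> \<phi>) \<le> snorm E i \<phi>) \<longrightarrow> cmod (\<eta> \<alpha>) \<le> K"
      using E.bidual_bound[OF \<eta>] ..
    have "cmod (W_map E F T \<eta> \<beta>) \<le> C * K"
      if \<beta>: "\<beta> \<in> cdual F" and le: "\<forall>\<psi>\<in>sn_space F. cmod (\<beta> \<psi>) \<le> snorm F j \<psi>" for \<beta>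
    proof -
      let ?\<alpha> = "transpose_map E T \<beta>"
      have \<alpha>: "?\<alpha> \<in> cdual E" using \<beta> by (rule transpose_map_cdual)
      have "cmod ((of_real (1 / C) *\<^sub>C ?\<alpha>) \<phi>) \<le> snorm E i \<phi>" if \<phi>: "\<phi> \<in> sn_space E" for \<phi>
      proof -
        have "cmod (\<beta> (T \<phi>)) \<le> C * snorm E i \<phi>"
          using le maps[OF \<phi>] C(2)[OF \<phi>] by fastforce
        then show ?thesis
          using Cpos \<phi> by (simp add: transpose_map_def norm_mult norm_divide field_simps)
      qed
      then have "cmod (\<eta> (of_real (1 / C) *\<^sub>C ?\<alpha>)) \<le> K"
        using K csubspaceD(3)[OF E.cdual_csubspace \<alpha>] by blast
      moreover have "\<eta> (of_real (1 / C) *\<^sub>C ?\<alpha>) = of_real (1 / C) * \<eta> ?\<alpha>" using lin \<alpha> by blast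
      ultimately have "cmod (\<eta> ?\<alpha>) / C \<le> K" using Cpos by (simp add: norm_mult norm_divide)
      then show ?thesis using Cpos \<beta> by (simp add: W_map_def field_simps)
    qed
    then show ?thesis by blast
  qed
  moreover have "clinear_on (cdual F) (W_map E F T \<eta>)"
    using lin csubspaceD(2,3)[OF F.cdual_csubspace] transpose_map_cdual
    by (simp add: clinear_on_def W_map_def transpose_map_add transpose_map_scaleC)
  ultimately show ?thesis by (simp add: F.bidual_iff vanishes_off_def W_map_def)
qed

lemma W_map_add: "W_map E F T (\<eta> + \<theta>) = W_map E F T \<eta> + W_map E F T \<theta>"
  by (auto simp: W_map_def)

lemma W_map_hom: "W_map E F T \<in> hom (W_completion E) (W_completion F)"
  by (rule homI) (simp_all add: W_map_bidual W_map_add)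

lemma W_map_incl: "\<phi> \<in> sn_space E \<Longrightarrow> W_map E F T (W_incl E \<phi>) = W_incl F (T \<phi>)"
  by (simp add: W_map_def W_incl_def transpose_map_cdual fun_eq_iff) (simp add: transpose_map_def)

lemma W_map_cong:
  assumes "\<And>\<phi>. \<phi> \<in> sn_space E \<Longrightarrow> S \<phi> = T \<phi>" shows "W_map E F S = W_map E F T"
proof -
  have "transpose_map E S = transpose_map E T" using assms by (auto simp: transpose_map_def fun_eq_iff)
  then show ?thesis by (simp add: W_map_def[abs_def] cong: if_cong)
qed

lemma Q_map_cong:
  assumes "\<And>\<phi>. \<phi> \<in> sn_space E \<Longrightarrow> S \<phi> = T \<phi>" "c \<in> carrier (Q_completion E)"
  shows "Q_map F S c = Q_map F T c"
proof -
  obtain s where s: "s \<in> bounded_seqs E" "c = Q_class E s" using assms(2) by (auto simp: E.carrier_Q)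
  have "t n \<in> sn_space E" if "t \<in> c" for t n
  proof -
    have "t - s \<in> bounded_seqs E"
      using that s E.mem_Q_class E.null_seqs_bounded by blast
    from csubspaceD(2)[OF E.bounded_seqs_csubspace this s(1)] show ?thesis
      by (simp add: E.bounded_seqs_iff)
  qed
  then have "(\<lambda>n. S (t n)) = (\<lambda>n. T (t n))" if "t \<in> c" for t using assms(1) that by blast
  then show ?thesis by (simp add: Q_map_def)
qed

end

text \<open>Both completions are additive functors. In particular, they preserve sequences that are split by
  continuous linear maps.\<close>

lemma cont_linear_id: "seminormed_space E \<Longrightarrow> cont_linear E E (\<lambda>\<phi>. \<phi>)"
proof (intro cont_linear.intro cont_linear_axioms.intro)
  show "\<exists>i C. C \<ge> 0 \<and> (\<forall>\<phi>\<in>sn_space E. snorm E j \<phi> \<le> C * snorm E i \<phi>)" for j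
    by (rule exI[of _ j], rule exI[of _ 1]) simp
qed simp_all

lemma cont_linear_comp:
  assumes T: "cont_linear E F T" and S: "cont_linear F G S"
  shows "cont_linear E G (\<lambda>\<phi>. S (T \<phi>))"
proof -
  interpret T: cont_linear E F T by (rule T)
  interpret S: cont_linear F G S by (rule S)
  show ?thesis
  proof
    fix k
    obtain j D where D: "D \<ge> 0" "\<forall>\<psi>\<in>sn_space F. snorm G k (S \<psi>) \<le> D * snorm F j \<psi>"
      using S.bounded by blast
    obtain i C where C: "C \<ge> 0" "\<forall>\<phi>\<in>sn_space E. snorm F j (T \<phi>) \<le> C * snorm E i \<phi>"
      using T.bounded by blast
    have "snorm G k (S (T \<phi>)) \<le> (D * C) * snorm E i \<phi>" if \<phi>: "\<phi> \<in> sn_space E" for \<phi>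
    proof -
      have "snorm G k (S (T \<phi>)) \<le> D * snorm F j (T \<phi>)" using D T.maps[OF \<phi>] by blast
      also have "\<dots> \<le> D * (C * snorm E i \<phi>)" using C \<phi> D(1) by (intro mult_left_mono) auto
      finally show ?thesis by (simp add: mult.assoc)
    qed
    then show "\<exists>i C. C \<ge> 0 \<and> (\<forall>\<phi>\<in>sn_space E. snorm G k (S (T \<phi>)) \<le> C * snorm E i \<phi>)"
      using C(1) D(1) by (intro exI[of _ i] exI[of _ "D * C"]) simp
  qed (simp_all add: T.maps S.maps T.add S.add T.scaleC S.scaleC)
qed

lemma cont_linear_add:
  assumes T: "cont_linear E F T" and S: "cont_linear E F S"
  shows "cont_linear E F (\<lambda>\<phi>. T \<phi> + S \<phi>)"
proof -
  interpret T: cont_linear E F T by (rule T)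
  interpret S: cont_linear E F S by (rule S)
  show ?thesis
  proof
    fix k
    obtain j D where D: "D \<ge> 0" "\<forall>\<phi>\<in>sn_space E. snorm F k (S \<phi>) \<le> D * snorm E j \<phi>"
      using S.bounded by blast
    obtain i C where C: "C \<ge> 0" "\<forall>\<phi>\<in>sn_space E. snorm F k (T \<phi>) \<le> C * snorm E i \<phi>"
      using T.bounded by blast
    have "snorm F k (T \<phi> + S \<phi>) \<le> (C + D) * snorm E (max i j) \<phi>" if \<phi>: "\<phi> \<in> sn_space E" for \<phi>
    proof -
      have "snorm F k (T \<phi> + S \<phi>) \<le> snorm F k (T \<phi>) + snorm F k (S \<phi>)"
        using \<phi> T.maps S.maps by (intro T.F.triangle)
      also have "\<dots> \<le> C * snorm E (max i j) \<phi> + D * snorm E (max i j) \<phi>"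
        using C D \<phi> T.E.mono[OF \<phi>]
        by (intro add_mono order_trans[OF C(2)[rule_format, OF \<phi>]] order_trans[OF D(2)[rule_format, OF \<phi>]]
            mult_left_mono) auto
      finally show ?thesis by (simp add: distrib_right)
    qed
    then show "\<exists>i C. C \<ge> 0 \<and> (\<forall>\<phi>\<in>sn_space E. snorm F k (T \<phi> + S \<phi>) \<le> C * snorm E i \<phi>)"
      using C(1) D(1) by (intro exI[of _ "max i j"] exI[of _ "C + D"]) simp
  qed (simp_all add: T.maps S.maps T.add S.add T.scaleC S.scaleC T.F.space scaleC_add_right ac_simps)
qed

lemma cont_linear_scaleC:
  assumes T: "cont_linear E F T"
  shows "cont_linear E F (\<lambda>\<phi>. c *\<^sub>C T \<phi>)"
proof -
  interpret T: cont_linear E F T by (rule T)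
  show ?thesis
  proof
    fix k
    obtain i C where C: "C \<ge> 0" "\<forall>\<phi>\<in>sn_space E. snorm F k (T \<phi>) \<le> C * snorm E i \<phi>"
      using T.bounded by blast
    have "snorm F k (c *\<^sub>C T \<phi>) \<le> (cmod c * C) * snorm E i \<phi>" if \<phi>: "\<phi> \<in> sn_space E" for \<phi>
      using T.F.scale[OF T.maps[OF \<phi>], of k c] mult_left_mono[OF C(2)[rule_format, OF \<phi>], of "cmod c"]
      by (simp add: mult.assoc)
    then show "\<exists>i C. C \<ge> 0 \<and> (\<forall>\<phi>\<in>sn_space E. snorm F k (c *\<^sub>C T \<phi>) \<le> C * snorm E i \<phi>)"
      using C(1) by (intro exI[of _ i] exI[of _ "cmod c * C"]) simp
  qed (simp_all add: T.maps T.add T.scaleC T.F.space scaleC_add_right scaleC_scaleC mult.commute)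
qed

lemma cont_linear_sum:
  assumes "finite I" "seminormed_space E" "seminormed_space F"
    and "\<And>i. i \<in> I \<Longrightarrow> cont_linear E F (T i)"
  shows "cont_linear E F (\<lambda>\<phi>. \<Sum>i\<in>I. T i \<phi>)"
  using assms(1,4)
proof induction
  case empty
  interpret F: seminormed_space F by fact
  interpret E: seminormed_space E by fact
  show ?case by unfold_locales (auto simp: F.space intro!: exI[of _ 0])
qed (simp add: cont_linear_add)

lemma Q_map_id:
  assumes "seminormed_space E" "c \<in> carrier (Q_completion E)" shows "Q_map E (\<lambda>\<phi>. \<phi>) c = c"
proof -
  interpret cont_linear E E "\<lambda>\<phi>. \<phi>" by (rule cont_linear_id[OF assms(1)])
  show ?thesis using assms(2) by (auto simp: E.carrier_Q Q_map_class)
qed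

lemma Q_map_comp:
  assumes T: "cont_linear E F T" and S: "cont_linear F G S"
    and c: "c \<in> carrier (Q_completion E)"
  shows "Q_map G S (Q_map F T c) = Q_map G (\<lambda>\<phi>. S (T \<phi>)) c"
proof -
  interpret T: cont_linear E F T by (rule T)
  interpret S: cont_linear F G S by (rule S)
  interpret ST: cont_linear E G "\<lambda>\<phi>. S (T \<phi>)" by (rule cont_linear_comp[OF T S])
  show ?thesis
    using c by (auto simp: T.E.carrier_Q T.Q_map_class S.Q_map_class ST.Q_map_class T.bounded_seqs_map)
qed

lemma Q_map_add:
  assumes T: "cont_linear E F T" and S: "cont_linear E F S"
    and c: "c \<in> carrier (Q_completion E)"
  shows "Q_map F (\<lambda>\<phi>. T \<phi> + S \<phi>) c = Q_map F T c \<otimes>\<^bsub>Q_completion F\<^esub> Q_map F S c"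
proof -
  interpret T: cont_linear E F T by (rule T)
  interpret S: cont_linear E F S by (rule S)
  interpret TS: cont_linear E F "\<lambda>\<phi>. T \<phi> + S \<phi>" by (rule cont_linear_add[OF T S])
  show ?thesis
    using c by (auto simp: T.E.carrier_Q T.Q_map_class S.Q_map_class TS.Q_map_class
        T.bounded_seqs_map S.bounded_seqs_map T.F.mult_Q plus_fun_def)
qed

lemma W_map_id:
  assumes "seminormed_space E" "\<eta> \<in> bidual E" shows "W_map E E (\<lambda>\<phi>. \<phi>) \<eta> = \<eta>"
proof -
  interpret seminormed_space E by fact
  have "transpose_map E (\<lambda>\<phi>. \<phi>) \<beta> = \<beta>" if "\<beta> \<in> cdual E" for \<beta>
    using cdualD(3)[OF that] by (auto simp: transpose_map_def)
  then show ?thesis using assms(2) by (auto simp: W_map_def bidual_iff vanishes_off_def)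
qed

lemma W_map_comp:
  assumes T: "cont_linear E F T" and S: "cont_linear F G S"
  shows "W_map F G S (W_map E F T \<eta>) = W_map E G (\<lambda>\<phi>. S (T \<phi>)) \<eta>"
proof -
  interpret T: cont_linear E F T by (rule T)
  interpret S: cont_linear F G S by (rule S)
  have "transpose_map E T (transpose_map F S \<gamma>) = transpose_map E (\<lambda>\<phi>. S (T \<phi>)) \<gamma>" for \<gamma>
    by (auto simp: transpose_map_def T.maps)
  then show ?thesis by (auto simp: W_map_def S.transpose_map_cdual)
qed

lemma W_map_sum:
  assumes T: "cont_linear E F T" and S: "cont_linear E F S"
    and \<eta>: "\<eta> \<in> bidual E"
  shows "W_map E F (\<lambda>\<phi>. T \<phi> + S \<phi>) \<eta> = W_map E F T \<eta> + W_map E F S \<eta>"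
proof -
  interpret T: cont_linear E F T by (rule T)
  interpret S: cont_linear E F S by (rule S)
  have "transpose_map E (\<lambda>\<phi>. T \<phi> + S \<phi>) \<beta> = transpose_map E T \<beta> + transpose_map E S \<beta>"
    if "\<beta> \<in> cdual F" for \<beta>
    using T.F.cdualD(1)[OF that] by (auto simp: transpose_map_def T.maps S.maps)
  then show ?thesis
    using \<eta> T.transpose_map_cdual S.transpose_map_cdual
    by (auto simp: W_map_def T.E.bidual_iff clinear_on_def)
qed

subsection \<open>From bounded sequences to the bidual\<close>

definition generalized_limit :: "(nat \<Rightarrow> complex) \<Rightarrow> complex" where
  "generalized_limit = (SOME L. clinear_on {a. Bseq a} L \<and> (\<forall>a. a \<longlonglongrightarrow> 0 \<longrightarrow> L a = 0) \<and> L (\<lambda>n. 1) = 1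
     \<and> (\<exists>K\<ge>0. \<forall>a C. (\<forall>n. cmod (a n) \<le> C) \<longrightarrow> cmod (L a) \<le> K * C))"

lemma generalized_limit:
  shows generalized_limit_add: "Bseq a \<Longrightarrow> Bseq b \<Longrightarrow> generalized_limit (\<lambda>n. a n + b n) = generalized_limit a + generalized_limit b"
    and generalized_limit_mult: "Bseq a \<Longrightarrow> generalized_limit (\<lambda>n. c * a n) = c * generalized_limit a"
    and generalized_limit_null: "a \<longlonglongrightarrow> 0 \<Longrightarrow> generalized_limit a = 0"
    and generalized_limit_const: "generalized_limit (\<lambda>n. c) = c"
    and generalized_limit_bound: "\<exists>K\<ge>0. \<forall>a C. (\<forall>n. cmod (a n) \<le> C) \<longrightarrow> cmod (generalized_limit a) \<le> K * C"
proof -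
  note spec = someI_ex[OF ex_generalized_limit, folded generalized_limit_def]
  note L = spec[THEN conjunct1] spec[THEN conjunct2, THEN conjunct1]
    spec[THEN conjunct2, THEN conjunct2, THEN conjunct1] spec[THEN conjunct2, THEN conjunct2, THEN conjunct2]
  show "Bseq a \<Longrightarrow> Bseq b \<Longrightarrow> generalized_limit (\<lambda>n. a n + b n) = generalized_limit a + generalized_limit b"
    using L(1) by (simp add: clinear_on_def plus_fun_def)
  show mult: "Bseq a \<Longrightarrow> generalized_limit (\<lambda>n. c * a n) = c * generalized_limit a" for c a
    using L(1) by (simp add: clinear_on_def scaleC_fun_def)
  show "a \<longlonglongrightarrow> 0 \<Longrightarrow> generalized_limit a = 0" using L(2) by blast
  show "generalized_limit (\<lambda>n. c) = c" using mult[of "\<lambda>n. 1" c] L(3) by simp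
  show "\<exists>K\<ge>0. \<forall>a C. (\<forall>n. cmod (a n) \<le> C) \<longrightarrow> cmod (generalized_limit a) \<le> K * C"
    by (rule L(4))
qed

text \<open>The weak-* limit of a bounded sequence along the generalized limit. It maps the quotient completion
  to the weak-* completion, naturally in the space.\<close>

definition W_limit :: "'e::complex_vector seminormed \<Rightarrow> (nat \<Rightarrow> 'e) \<Rightarrow> (('e \<Rightarrow> complex) \<Rightarrow> complex)" where
  "W_limit E s = (\<lambda>\<alpha>. if \<alpha> \<in> cdual E then generalized_limit (\<lambda>n. \<alpha> (s n)) else 0)"

context seminormed_space
begin

lemma Bseq_cdual:
  assumes "\<alpha> \<in> cdual E" "s \<in> bounded_seqs E" shows "Bseq (\<lambda>n. \<alpha> (s n))"
proof -
  obtain i C where C: "C \<ge> 0" "\<forall>\<phi>\<in>sn_space E. cmod (\<alpha> \<phi>) \<le> C * snorm E i \<phi>"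
    using cdualD(4)[OF assms(1)] by blast
  obtain B where B: "\<forall>n. snorm E i (s n) \<le> B" using bounded_seqs_bound[OF assms(2)] ..
  have "cmod (\<alpha> (s n)) \<le> C * B" for n
    using C(2) assms(2) mult_left_mono[OF B[rule_format] C(1)]
    by (auto simp: bounded_seqs_iff intro: order_trans)
  then show ?thesis by (rule BseqI')
qed

lemma W_limit_bidual:
  assumes s: "s \<in> bounded_seqs E" shows "W_limit E s \<in> bidual E"
proof -
  obtain K where K: "K \<ge> 0" "\<forall>a C. (\<forall>n. cmod (a n) \<le> C) \<longrightarrow> cmod (generalized_limit a) \<le> K * C"
    using generalized_limit_bound by (elim exE conjE)
  have "\<exists>C. \<forall>\<alpha>\<in>cdual E. (\<forall>\<phi>\<in>sn_space E. cmod (\<alpha> \<phi>) \<le> snorm E i \<phi>) \<longrightarrow> cmod (W_limit E s \<alpha>) \<le> C" for i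
  proof -
    obtain B where B: "\<forall>n. snorm E i (s n) \<le> B" using bounded_seqs_bound[OF s] ..
    have "cmod (W_limit E s \<alpha>) \<le> K * B"
      if "\<alpha> \<in> cdual E" "\<forall>\<phi>\<in>sn_space E. cmod (\<alpha> \<phi>) \<le> snorm E i \<phi>" for \<alpha>
    proof -
      have "\<forall>n. cmod (\<alpha> (s n)) \<le> B"
        using that(2) s B by (auto simp: bounded_seqs_iff intro: order_trans)
      then show ?thesis using K(2)[rule_format, of "\<lambda>n. \<alpha> (s n)" B] that(1) by (simp add: W_limit_def)
    qed
    then show ?thesis by blast
  qed
  moreover have "clinear_on (cdual E) (W_limit E s)"
    using Bseq_cdual[OF _ s] csubspaceD(2,3)[OF cdual_csubspace]
    by (simp add: clinear_on_def W_limit_def generalized_limit_add generalized_limit_mult)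
  ultimately show ?thesis by (simp add: bidual_iff vanishes_off_def W_limit_def)
qed

lemma W_limit_null:
  assumes s: "s \<in> null_seqs E" shows "W_limit E s = 0"
proof -
  have "(\<lambda>n. \<alpha> (s n)) \<longlonglongrightarrow> 0" if \<alpha>: "\<alpha> \<in> cdual E" for \<alpha>
  proof -
    obtain i C where C: "\<forall>\<phi>\<in>sn_space E. cmod (\<alpha> \<phi>) \<le> C * snorm E i \<phi>"
      using cdualD(4)[OF \<alpha>] by blast
    show ?thesis
    proof (rule Lim_null_comparison)
      show "\<forall>\<^sub>F n in sequentially. cmod (\<alpha> (s n)) \<le> C * snorm E i (s n)"
        using C s by (simp add: null_seqs_iff)
      show "(\<lambda>n. C * snorm E i (s n)) \<longlonglongrightarrow> 0"
        using s by (auto simp: null_seqs_iff intro: tendsto_mult_right_zero)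
    qed
  qed
  then show ?thesis by (auto simp: W_limit_def generalized_limit_null)
qed

lemma W_limit_eqI:
  assumes t: "t \<in> bounded_seqs E" and st: "s - t \<in> null_seqs E"
  shows "W_limit E s = W_limit E t"
proof -
  have b: "s - t \<in> bounded_seqs E" using st null_seqs_bounded by blast
  have "generalized_limit (\<lambda>n. \<alpha> (s n)) = generalized_limit (\<lambda>n. \<alpha> (t n))" if \<alpha>: "\<alpha> \<in> cdual E" for \<alpha>
  proof -
    have "\<alpha> (s n) = \<alpha> ((s - t) n) + \<alpha> (t n)" for n
      using cdualD(1)[OF \<alpha>, of "(s - t) n" "t n"] b t by (simp add: bounded_seqs_iff)
    then have "generalized_limit (\<lambda>n. \<alpha> (s n))
        = generalized_limit (\<lambda>n. \<alpha> ((s - t) n)) + generalized_limit (\<lambda>n. \<alpha> (t n))"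
      using generalized_limit_add[OF Bseq_cdual[OF \<alpha> b] Bseq_cdual[OF \<alpha> t]] by simp
    moreover have "generalized_limit (\<lambda>n. \<alpha> ((s - t) n)) = 0"
      using fun_cong[OF W_limit_null[OF st], of \<alpha>] \<alpha> by (simp add: W_limit_def)
    ultimately show ?thesis by simp
  qed
  then show ?thesis by (auto simp: W_limit_def)
qed

lemma W_limit_const: "W_limit E (\<lambda>n. \<phi>) = W_incl E \<phi>"
  by (auto simp: W_limit_def W_incl_def generalized_limit_const)

lemma W_incl_bidual: "\<phi> \<in> sn_space E \<Longrightarrow> W_incl E \<phi> \<in> bidual E"
  using W_limit_bidual[OF const_bounded] by (simp add: W_limit_const)

end

lemma (in cont_linear) W_map_limit:
  assumes "s \<in> bounded_seqs E" shows "W_map E F T (W_limit E s) = W_limit F (\<lambda>n. T (s n))"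
  using assms by (simp add: fun_eq_iff W_map_def W_limit_def transpose_map_cdual E.bounded_seqs_iff)
    (simp add: transpose_map_def)

section \<open>The bicomplex of controlled cochains\<close>

subsection \<open>Cochains form a seminormed space\<close>

lemma close_tuples_mono: "R \<le> R' \<Longrightarrow> close_tuples X R k \<subseteq> close_tuples X R' k"
  unfolding close_tuples_def using order_trans by blast

definition supports_within ::
    "'x::metric_space set \<Rightarrow> ('x, 'v) xmodule \<Rightarrow> nat \<Rightarrow> int \<Rightarrow> real \<Rightarrow> real \<Rightarrow> ('x, 'v) cochain \<Rightarrow> bool" where
  "supports_within X M p q R S \<phi> \<longleftrightarrow> (\<forall>xs ys z. (xs, ys) \<in> close_pairs X R (p + 1) (nat (q + 1))
     \<longrightarrow> z \<in> set xs \<union> set ys \<longrightarrow> m_supp M (\<phi> xs ys) \<subseteq> cball z S)"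

lemma controlled_supports_iff:
  "controlled_supports X M p q \<phi> \<longleftrightarrow> (\<forall>R>0. \<exists>S>0. supports_within X M p q R S \<phi>)"
  unfolding controlled_supports_def supports_within_def Ball_def split_paired_All prod.case
  by (simp only: imp_conjL all_simps)

context X_module
begin

lemmas m_space = csubspaceD[OF subspace]

lemma norm_zero: "m_norm M 0 = 0"
  using norm_eq_0[OF m_space(1)] by simp

lemma sn_space_cochains:
  "\<phi> \<in> sn_space (cochains X M p q) \<longleftrightarrow> (\<forall>xs ys. \<phi> xs ys \<in> m_space M)
    \<and> (\<forall>xs ys. (xs, ys) \<notin> tuples X (p + 1) \<times> tuples X (nat (q + 1)) \<longrightarrow> \<phi> xs ys = 0)
    \<and> controlled_supports X M p q \<phi>
    \<and> (\<forall>i. \<exists>C. \<forall>xs\<in>close_tuples X (real (Suc i)) (p + 1). \<forall>ys\<in>tuples X (nat (q + 1)). m_norm M (\<phi> xs ys) \<le> C)"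
proof -
  have fin: "cochain_norm X M p q R \<phi> < \<infinity>
      \<longleftrightarrow> (\<exists>C. \<forall>xs\<in>close_tuples X R (p + 1). \<forall>ys\<in>tuples X (nat (q + 1)). m_norm M (\<phi> xs ys) \<le> C)" for R
  proof
    assume "cochain_norm X M p q R \<phi> < \<infinity>"
    then obtain C where C: "cochain_norm X M p q R \<phi> = ennreal C" "C \<ge> 0"
      by (cases "cochain_norm X M p q R \<phi>") auto
    have "ennreal (m_norm M (\<phi> xs ys)) \<le> ennreal C"
      if "xs \<in> close_tuples X R (p + 1)" "ys \<in> tuples X (nat (q + 1))" for xs ys
      unfolding C(1)[symmetric] cochain_norm_def using that by (intro SUP_upper2[of "(xs, ys)"]) auto
    then show "\<exists>C. \<forall>xs\<in>close_tuples X R (p + 1). \<forall>ys\<in>tuples X (nat (q + 1)). m_norm M (\<phi> xs ys) \<le> C"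
      using C(2) by (intro exI[of _ C]) simp
  next
    assume "\<exists>C. \<forall>xs\<in>close_tuples X R (p + 1). \<forall>ys\<in>tuples X (nat (q + 1)). m_norm M (\<phi> xs ys) \<le> C"
    then obtain C where C: "\<forall>xs\<in>close_tuples X R (p + 1). \<forall>ys\<in>tuples X (nat (q + 1)). m_norm M (\<phi> xs ys) \<le> C" ..
    have "cochain_norm X M p q R \<phi> \<le> ennreal C"
      unfolding cochain_norm_def using C by (intro SUP_least) (auto intro: ennreal_leI)
    then show "cochain_norm X M p q R \<phi> < \<infinity>" by (simp add: order_le_less_trans)
  qed
  have "(\<forall>R>0. cochain_norm X M p q R \<phi> < \<infinity>) \<longleftrightarrow> (\<forall>i. cochain_norm X M p q (real (Suc i)) \<phi> < \<infinity>)"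
  proof (intro iffI allI impI)
    fix R :: real assume *: "\<forall>i. cochain_norm X M p q (real (Suc i)) \<phi> < \<infinity>"
    obtain i where "R \<le> real i" using real_arch_simple by blast
    then have R: "R \<le> real (Suc i)" by simp
    have "cochain_norm X M p q R \<phi> \<le> cochain_norm X M p q (real (Suc i)) \<phi>"
      unfolding cochain_norm_def using close_tuples_mono[OF R] by (intro SUP_subset_mono) auto
    then show "cochain_norm X M p q R \<phi> < \<infinity>" using * order_le_less_trans by blast
  qed simp
  then show ?thesis unfolding fin by (simp only: cochains_def seminormed.select_convs mem_Collect_eq fin)
qed

lemma snorm_cochains_le:
  assumes "C \<ge> 0"
    and "\<And>xs ys. xs \<in> close_tuples X (real (Suc i)) (p + 1) \<Longrightarrow> ys \<in> tuples X (nat (q + 1)) \<Longrightarrow> m_norm M (\<phi> xs ys) \<le> C"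
  shows "snorm (cochains X M p q) i \<phi> \<le> C"
proof -
  have "sn_norm (cochains X M p q) i \<phi> \<le> ennreal C"
    using assms(2) by (auto simp: cochains_def cochain_norm_def intro!: SUP_least ennreal_leI)
  then show ?thesis unfolding snorm_def using enn2real_mono[of _ "ennreal C"] assms(1) by fastforce
qed

lemma le_snorm_cochains:
  assumes "\<phi> \<in> sn_space (cochains X M p q)"
    and "xs \<in> close_tuples X (real (Suc i)) (p + 1)" "ys \<in> tuples X (nat (q + 1))"
  shows "m_norm M (\<phi> xs ys) \<le> snorm (cochains X M p q) i \<phi>"
proof -
  have "ennreal (m_norm M (\<phi> xs ys)) \<le> cochain_norm X M p q (real (Suc i)) \<phi>"
    unfolding cochain_norm_def using assms by (intro SUP_upper2[of "(xs, ys)"]) auto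
  moreover have "cochain_norm X M p q (real (Suc i)) \<phi> < \<infinity>"
    using assms(1) by (simp add: cochains_def)
  ultimately have "enn2real (ennreal (m_norm M (\<phi> xs ys))) \<le> enn2real (cochain_norm X M p q (real (Suc i)) \<phi>)"
    by (intro enn2real_mono) (auto simp: less_top)
  moreover have "\<phi> xs ys \<in> m_space M" using assms(1) by (simp add: cochains_def)
  then have "0 \<le> m_norm M (\<phi> xs ys)" by (rule norm_nonneg)
  ultimately show ?thesis by (simp add: snorm_def cochains_def)
qed

lemma snorm_cochains_nonneg: "0 \<le> snorm (cochains X M p q) i \<phi>"
  by (simp add: snorm_def)

lemma cochain_in_m_space: "\<phi> \<in> sn_space (cochains X M p q) \<Longrightarrow> \<phi> xs ys \<in> m_space M"
  by (simp add: sn_space_cochains)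

lemma controlled_supports_add:
  assumes "controlled_supports X M p q \<phi>" "controlled_supports X M p q \<psi>"
    and "\<And>xs ys. m_supp M (\<theta> xs ys) \<subseteq> m_supp M (\<phi> xs ys) \<union> m_supp M (\<psi> xs ys)"
  shows "controlled_supports X M p q \<theta>"
  unfolding controlled_supports_iff
proof (intro allI impI)
  fix R :: real assume R: "R > 0"
  obtain S where S: "S > 0" "supports_within X M p q R S \<phi>"
    using assms(1) R unfolding controlled_supports_iff by blast
  obtain T where T: "T > 0" "supports_within X M p q R T \<psi>"
    using assms(2) R unfolding controlled_supports_iff by blast
  have "m_supp M (\<theta> xs ys) \<subseteq> cball z (max S T)"
    if "(xs, ys) \<in> close_pairs X R (p + 1) (nat (q + 1))" "z \<in> set xs \<union> set ys" for xs ys z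
  proof -
    have "m_supp M (\<phi> xs ys) \<subseteq> cball z (max S T)"
      using S(2)[unfolded supports_within_def, rule_format, OF that] by (rule order_trans) (simp add: subset_cball)
    moreover have "m_supp M (\<psi> xs ys) \<subseteq> cball z (max S T)"
      using T(2)[unfolded supports_within_def, rule_format, OF that] by (rule order_trans) (simp add: subset_cball)
    ultimately show ?thesis using assms(3)[of xs ys] by blast
  qed
  then show "\<exists>S>0. supports_within X M p q R S \<theta>"
    using S(1) by (intro exI[of _ "max S T"]) (auto simp: supports_within_def)
qed

lemma seminormed_space_cochains: "seminormed_space (cochains X M p q)"
proof
  let ?E = "cochains X M p q"
  have norm_sum: "m_norm M ((\<phi> + \<psi>) xs ys) \<le> snorm ?E i \<phi> + snorm ?E i \<psi>"
    if "\<phi> \<in> sn_space ?E" "\<psi> \<in> sn_space ?E"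
      "xs \<in> close_tuples X (real (Suc i)) (p + 1)" "ys \<in> tuples X (nat (q + 1))" for \<phi> \<psi> i xs ys
    using norm_triangle[of "\<phi> xs ys" "\<psi> xs ys"] le_snorm_cochains[OF that(1,3,4)]
      le_snorm_cochains[OF that(2,3,4)] that(1,2)[THEN cochain_in_m_space] by simp
  have norm_mult: "m_norm M ((c *\<^sub>C \<phi>) xs ys) \<le> cmod c * snorm ?E i \<phi>"
    if "\<phi> \<in> sn_space ?E" "xs \<in> close_tuples X (real (Suc i)) (p + 1)" "ys \<in> tuples X (nat (q + 1))"
    for \<phi> i xs ys c
    using norm_scale[of "\<phi> xs ys" c] le_snorm_cochains[OF that]
      that(1)[THEN cochain_in_m_space] by (simp add: mult_left_mono)
  show "csubspace (sn_space ?E)"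
    unfolding csubspace_def
  proof (intro conjI ballI allI)
    show "0 \<in> sn_space ?E"
      by (auto simp: sn_space_cochains m_space norm_zero supp_zero controlled_supports_def
          intro!: exI[of _ 0] exI[of _ "1::real"])
  next
    fix \<phi> \<psi> assume a: "\<phi> \<in> sn_space ?E" "\<psi> \<in> sn_space ?E"
    have "controlled_supports X M p q (\<phi> + \<psi>)"
    proof (rule controlled_supports_add)
      show "m_supp M ((\<phi> + \<psi>) xs ys) \<subseteq> m_supp M (\<phi> xs ys) \<union> m_supp M (\<psi> xs ys)" for xs ys
        using supp_add[OF cochain_in_m_space[OF a(1)] cochain_in_m_space[OF a(2)]] by simp
    qed (use a in \<open>auto simp: sn_space_cochains\<close>)
    moreover have "\<exists>C. \<forall>xs\<in>close_tuples X (real (Suc i)) (p + 1). \<forall>ys\<in>tuples X (nat (q + 1)). m_norm M ((\<phi> + \<psi>) xs ys) \<le> C" for i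
      using norm_sum[OF a] by blast
    ultimately show "\<phi> + \<psi> \<in> sn_space ?E" using a unfolding sn_space_cochains by (auto simp: m_space)
  next
    fix c \<phi> assume a: "\<phi> \<in> sn_space ?E"
    have "controlled_supports X M p q (c *\<^sub>C \<phi>)"
    proof (rule controlled_supports_add)
      show "m_supp M ((c *\<^sub>C \<phi>) xs ys) \<subseteq> m_supp M (\<phi> xs ys) \<union> m_supp M (\<phi> xs ys)" for xs ys
        using supp_scale[OF cochain_in_m_space[OF a]] supp_zero by (cases "c = 0") auto
    qed (use a in \<open>auto simp: sn_space_cochains\<close>)
    moreover have "\<exists>C. \<forall>xs\<in>close_tuples X (real (Suc i)) (p + 1). \<forall>ys\<in>tuples X (nat (q + 1)). m_norm M ((c *\<^sub>C \<phi>) xs ys) \<le> C" for i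
      using norm_mult[OF a] by blast
    ultimately show "c *\<^sub>C \<phi> \<in> sn_space ?E" using a unfolding sn_space_cochains by (auto simp: m_space)
  qed
  show "snorm ?E i (\<phi> + \<psi>) \<le> snorm ?E i \<phi> + snorm ?E i \<psi>" if "\<phi> \<in> sn_space ?E" "\<psi> \<in> sn_space ?E" for i \<phi> \<psi>
    using norm_sum[OF that] snorm_cochains_nonneg by (intro snorm_cochains_le) auto
  show "snorm ?E i (c *\<^sub>C \<phi>) \<le> cmod c * snorm ?E i \<phi>" if "\<phi> \<in> sn_space ?E" for i c \<phi>
    using norm_mult[OF that] snorm_cochains_nonneg by (intro snorm_cochains_le) auto
  show "sn_norm ?E i \<phi> < \<infinity>" if "\<phi> \<in> sn_space ?E" for i \<phi>
    using that by (simp add: cochains_def)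
  show "snorm ?E i \<phi> \<le> snorm ?E j \<phi>" if "\<phi> \<in> sn_space ?E" "i \<le> j" for i j \<phi>
  proof (rule snorm_cochains_le[OF snorm_cochains_nonneg])
    fix xs ys assume "xs \<in> close_tuples X (real (Suc i)) (p + 1)" and ys: "ys \<in> tuples X (nat (q + 1))"
    then have "xs \<in> close_tuples X (real (Suc j)) (p + 1)"
      using subsetD[OF close_tuples_mono[of "real (Suc i)" "real (Suc j)"]] that(2) by simp
    then show "m_norm M (\<phi> xs ys) \<le> snorm ?E j \<phi>" by (rule le_snorm_cochains[OF that(1) _ ys])
  qed
qed

end

text \<open>All maps of cochains below are sums of multiples of maps that increase none of the seminorms.\<close>

lemma contraction_cochains:
  assumes M: "X_module X M" and N: "X_module X N"
    and maps: "\<And>\<phi> xs ys. \<phi> \<in> sn_space (cochains X M p q) \<Longrightarrow> T \<phi> xs ys \<in> m_space N"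
    and off: "\<And>\<phi> xs ys. \<phi> \<in> sn_space (cochains X M p q) \<Longrightarrow>
        \<not> (xs \<in> tuples X (p' + 1) \<and> ys \<in> tuples X (nat (q' + 1))) \<Longrightarrow> T \<phi> xs ys = 0"
    and supp: "\<And>\<phi>. \<phi> \<in> sn_space (cochains X M p q) \<Longrightarrow> controlled_supports X N p' q' (T \<phi>)"
    and add: "\<And>\<phi> \<psi>. \<phi> \<in> sn_space (cochains X M p q) \<Longrightarrow> \<psi> \<in> sn_space (cochains X M p q) \<Longrightarrow> T (\<phi> + \<psi>) = T \<phi> + T \<psi>"
    and scaleC: "\<And>c \<phi>. \<phi> \<in> sn_space (cochains X M p q) \<Longrightarrow> T (c *\<^sub>C \<phi>) = c *\<^sub>C T \<phi>"
    and bound: "\<And>\<phi> i xs ys. \<phi> \<in> sn_space (cochains X M p q) \<Longrightarrow> xs \<in> close_tuples X (real (Suc i)) (p' + 1) \<Longrightarrow>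
        ys \<in> tuples X (nat (q' + 1)) \<Longrightarrow> m_norm N (T \<phi> xs ys) \<le> snorm (cochains X M p q) i \<phi>"
  shows "cont_linear (cochains X M p q) (cochains X N p' q') T"
proof (intro cont_linear.intro cont_linear_axioms.intro add scaleC)
  interpret M: X_module X M by (rule M)
  interpret N: X_module X N by (rule N)
  show "seminormed_space (cochains X M p q)" "seminormed_space (cochains X N p' q')"
    by (rule M.seminormed_space_cochains N.seminormed_space_cochains)+
  show "T \<phi> \<in> sn_space (cochains X N p' q')" if \<phi>: "\<phi> \<in> sn_space (cochains X M p q)" for \<phi>
    unfolding N.sn_space_cochains using maps[OF \<phi>] off[OF \<phi>] supp[OF \<phi>] bound[OF \<phi>] by blast
  have "snorm (cochains X N p' q') j (T \<phi>) \<le> 1 * snorm (cochains X M p q) j \<phi>"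
    if \<phi>: "\<phi> \<in> sn_space (cochains X M p q)" for j \<phi>
    using bound[OF \<phi>] M.snorm_cochains_nonneg by (intro N.snorm_cochains_le) auto
  then show "\<exists>i C. C \<ge> 0 \<and> (\<forall>\<phi>\<in>sn_space (cochains X M p q).
      snorm (cochains X N p' q') j (T \<phi>) \<le> C * snorm (cochains X M p q) i \<phi>)" for j
    by (intro exI[of _ j] exI[of _ "1::real"]) simp
qed

subsection \<open>Reindexing cochains, and the differentials\<close>

text \<open>Each term of the differentials \<open>D\<close> and \<open>d\<close>, and the restriction to the diagonal, rearranges the
  arguments of a cochain in this way.\<close>

definition reindex :: "'x set \<Rightarrow> nat \<Rightarrow> nat \<Rightarrow> ('x list \<Rightarrow> 'x list \<Rightarrow> 'x list) \<Rightarrow> ('x list \<Rightarrow> 'x list \<Rightarrow> 'x list)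
    \<Rightarrow> ('x, 'v::zero) cochain \<Rightarrow> ('x, 'v) cochain" where
  "reindex X k l g h \<phi> = (\<lambda>xs ys. if xs \<in> tuples X k \<and> ys \<in> tuples X l then \<phi> (g xs ys) (h xs ys) else 0)"

lemma close_pairs_iff:
  "(xs, ys) \<in> close_pairs X R k l \<longleftrightarrow> xs \<in> tuples X k \<and> ys \<in> tuples X l
    \<and> (\<forall>a\<in>set xs \<union> set ys. \<forall>b\<in>set xs \<union> set ys. dist a b \<le> R)"
  by (simp add: close_pairs_def)

text \<open>The new arguments consist of entries of the old ones, so they are at least as close to each other. A
  support within distance \<open>S\<close> of one of the new entries is within \<open>S + R\<close> of all of the old ones.\<close>

lemma (in X_module) cont_linear_reindex:
  assumes g: "\<And>xs ys. xs \<in> tuples X (p' + 1) \<Longrightarrow> ys \<in> tuples X (nat (q' + 1)) \<Longrightarrow>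
        g xs ys \<in> tuples X (p + 1) \<and> set (g xs ys) \<subseteq> set xs"
    and h: "\<And>xs ys. xs \<in> tuples X (p' + 1) \<Longrightarrow> ys \<in> tuples X (nat (q' + 1)) \<Longrightarrow>
        h xs ys \<in> tuples X (nat (q + 1)) \<and> set (h xs ys) \<subseteq> set xs \<union> set ys"
  shows "cont_linear (cochains X M p q) (cochains X M p' q') (reindex X (p' + 1) (nat (q' + 1)) g h)"
proof (rule contraction_cochains)
  let ?E = "cochains X M p q" and ?T = "reindex X (p' + 1) (nat (q' + 1)) g h"
  show "X_module X M" "X_module X M" by unfold_locales
  fix \<phi> assume \<phi>: "\<phi> \<in> sn_space ?E"
  show "?T \<phi> xs ys \<in> m_space M" for xs ys
    using \<phi> m_space(1) by (simp add: reindex_def sn_space_cochains)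
  show "?T \<phi> xs ys = 0" if "\<not> (xs \<in> tuples X (p' + 1) \<and> ys \<in> tuples X (nat (q' + 1)))" for xs ys
    using that by (auto simp: reindex_def)
  show "?T (\<phi> + \<psi>) = ?T \<phi> + ?T \<psi>" for \<psi> by (auto simp: reindex_def fun_eq_iff)
  show "?T (c *\<^sub>C \<phi>) = c *\<^sub>C ?T \<phi>" for c by (auto simp: reindex_def fun_eq_iff)
  show "m_norm M (?T \<phi> xs ys) \<le> snorm ?E i \<phi>"
    if "xs \<in> close_tuples X (real (Suc i)) (p' + 1)" "ys \<in> tuples X (nat (q' + 1))" for i xs ys
  proof -
    have xs: "xs \<in> tuples X (p' + 1)" using that by (simp add: close_tuples_def)
    have "g xs ys \<in> close_tuples X (real (Suc i)) (p + 1)"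
      using g[OF xs that(2)] that(1) unfolding close_tuples_def by blast
    then show ?thesis using xs that(2) h[OF xs that(2)] le_snorm_cochains[OF \<phi>] by (simp add: reindex_def)
  qed
  show "controlled_supports X M p' q' (?T \<phi>)"
    unfolding controlled_supports_iff
  proof (intro allI impI)
    fix R :: real assume R: "R > 0"
    have "controlled_supports X M p q \<phi>" using \<phi> by (simp add: sn_space_cochains)
    then obtain S where S: "S > 0" "supports_within X M p q R S \<phi>"
      using R unfolding controlled_supports_iff by blast
    have "m_supp M (?T \<phi> xs ys) \<subseteq> cball z (S + R)"
      if xy: "(xs, ys) \<in> close_pairs X R (p' + 1) (nat (q' + 1))" and z: "z \<in> set xs \<union> set ys" for xs ys z
    proof -
      have t: "xs \<in> tuples X (p' + 1)" "ys \<in> tuples X (nat (q' + 1))" using xy by (auto simp: close_pairs_iff)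
      have gh: "(g xs ys, h xs ys) \<in> close_pairs X R (p + 1) (nat (q + 1))"
        using g[OF t] h[OF t] xy unfolding close_pairs_iff by blast
      have "length (g xs ys) = p + 1" using g[OF t] by (simp add: tuples_def)
      then obtain z' where z': "z' \<in> set (g xs ys)" by (metis length_greater_0_conv list.set_sel(1) trans_less_add2 zero_less_one)
      have "m_supp M (\<phi> (g xs ys) (h xs ys)) \<subseteq> cball z' S"
        using S(2)[unfolded supports_within_def, rule_format, OF gh] z' by blast
      moreover have "dist z z' \<le> R" using xy z z' g[OF t] unfolding close_pairs_iff by blast
      then have "cball z' S \<subseteq> cball z (S + R)"
        using dist_triangle[of z _ z'] by (fastforce intro: order_trans)
      ultimately show ?thesis using t by (simp add: reindex_def)
    qed
    then show "\<exists>S>0. supports_within X M p' q' R S (?T \<phi>)"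
      using S(1) R by (intro exI[of _ "S + R"]) (auto simp: supports_within_def)
  qed
qed

lemma sum_fun_apply: "(\<Sum>i\<in>I. f i) x = (\<Sum>i\<in>I. f i x)"
  by (induction I rule: infinite_finite_induct) auto

lemma set_omit: "set (omit i xs) \<subseteq> set xs"
  by (auto simp: omit_def dest: in_set_takeD in_set_dropD)

lemma omit_tuples: "xs \<in> tuples X (Suc k) \<Longrightarrow> i \<le> k \<Longrightarrow> omit i xs \<in> tuples X k"
  using set_omit[of i xs] by (auto simp: tuples_def omit_def)

context X_module
begin

lemma cont_linear_D:
  "cont_linear (cochains X M p q) (cochains X M (Suc p) q) (diff_D X p q)"
proof -
  have eq: "diff_D X p q = (\<lambda>\<phi>. \<Sum>i\<in>{0..p + 1}.
      (-1) ^ i *\<^sub>C reindex X (Suc p + 1) (nat (q + 1)) (\<lambda>xs ys. omit i xs) (\<lambda>xs ys. ys) (\<phi> :: ('x, 'v) cochain))"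
    by (auto simp: fun_eq_iff diff_D_def sum_fun_apply reindex_def)
  show ?thesis unfolding eq
    by (intro cont_linear_sum cont_linear_scaleC cont_linear_reindex
        seminormed_space_cochains) (auto simp: omit_tuples dest: subsetD[OF set_omit])
qed

lemma cont_linear_d:
  assumes "q \<ge> -1"
  shows "cont_linear (cochains X M p q) (cochains X M p (q + 1)) (diff_d X p q)"
proof -
  have q: "nat (2 + q) = Suc (nat (q + 1))" "nat (q + 2) = Suc (nat (q + 1))" "nat (q + 1 + 1) = Suc (nat (q + 1))" using assms by auto
  have eq: "diff_d X p q = (\<lambda>\<phi>. \<Sum>i\<in>{0..nat (q + 1)}.
      (-1) ^ (i + p) *\<^sub>C reindex X (p + 1) (nat (q + 1 + 1)) (\<lambda>xs ys. xs) (\<lambda>xs ys. omit i ys) (\<phi> :: ('x, 'v) cochain))"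
    by (auto simp: fun_eq_iff diff_d_def sum_fun_apply reindex_def q)
  show ?thesis unfolding eq
    by (intro cont_linear_sum cont_linear_scaleC cont_linear_reindex
        seminormed_space_cochains) (auto simp: q omit_tuples dest: subsetD[OF set_omit])
qed

end

subsection \<open>Coefficient maps\<close>

lemma cont_linear_push:
  assumes M: "X_module X M" and N: "X_module X N"
    and f: "\<And>v. v \<in> m_space M \<Longrightarrow> f v \<in> m_space N"
      "\<And>v w. v \<in> m_space M \<Longrightarrow> w \<in> m_space M \<Longrightarrow> f (v + w) = f v + f w"
      "\<And>c v. v \<in> m_space M \<Longrightarrow> f (c *\<^sub>C v) = c *\<^sub>C f v"
      "\<And>v. v \<in> m_space M \<Longrightarrow> m_norm N (f v) \<le> m_norm M v"
      "\<And>v. v \<in> m_space M \<Longrightarrow> m_supp N (f v) \<subseteq> m_supp M v"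
  shows "cont_linear (cochains X M p q) (cochains X N p q) (push f)"
proof (rule contraction_cochains[OF M N])
  interpret M: X_module X M by (rule M)
  have f0: "f 0 = 0" using f(3)[OF M.m_space(1), of 0] by simp
  fix \<phi> assume \<phi>: "\<phi> \<in> sn_space (cochains X M p q)"
  note \<phi>m = M.cochain_in_m_space[OF \<phi>]
  show "push f \<phi> xs ys \<in> m_space N" for xs ys using f(1)[OF \<phi>m] by (simp add: push_def)
  show "push f \<phi> xs ys = 0" if "\<not> (xs \<in> tuples X (p + 1) \<and> ys \<in> tuples X (nat (q + 1)))" for xs ys
    using that \<phi> f0 by (auto simp: push_def M.sn_space_cochains)
  show "push f (\<phi> + \<psi>) = push f \<phi> + push f \<psi>" if "\<psi> \<in> sn_space (cochains X M p q)" for \<psi>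
    using f(2)[OF \<phi>m M.cochain_in_m_space[OF that]] by (auto simp: push_def fun_eq_iff)
  show "push f (c *\<^sub>C \<phi>) = c *\<^sub>C push f \<phi>" for c using f(3)[OF \<phi>m] by (auto simp: push_def fun_eq_iff)
  show "m_norm N (push f \<phi> xs ys) \<le> snorm (cochains X M p q) i \<phi>"
    if "xs \<in> close_tuples X (real (Suc i)) (p + 1)" "ys \<in> tuples X (nat (q + 1))" for i xs ys
    using order_trans[OF f(4)[OF \<phi>m] M.le_snorm_cochains[OF \<phi> that]] by (simp add: push_def)
  show "controlled_supports X N p q (push f \<phi>)"
  proof -
    have "controlled_supports X M p q \<phi>" using \<phi> by (simp add: M.sn_space_cochains)
    moreover have "m_supp N (push f \<phi> xs ys) \<subseteq> m_supp M (\<phi> xs ys)" for xs ys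
      using f(5)[OF \<phi>m] by (simp add: push_def)
    ultimately show ?thesis unfolding controlled_supports_iff supports_within_def by (meson order_trans)
  qed
qed

lemma cochains_l1_0:
  "\<phi> \<in> sn_space (cochains X (l1_0 X) p q) \<longleftrightarrow> \<phi> \<in> sn_space (cochains X (l1 X) p q) \<and> (\<forall>xs ys. l1_sum X (\<phi> xs ys) = 0)"
  "snorm (cochains X (l1_0 X) p q) = snorm (cochains X (l1 X) p q)"
proof -
  have supp: "controlled_supports X (l1_0 X) p q \<phi> = controlled_supports X (l1 X) p q \<phi>" for \<phi>
    unfolding controlled_supports_def l1_0_selectors ..
  have norm: "cochain_norm X (l1_0 X) p q R \<phi> = cochain_norm X (l1 X) p q R \<phi>" for R \<phi>
    unfolding cochain_norm_def l1_0_selectors ..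
  show "\<phi> \<in> sn_space (cochains X (l1_0 X) p q) \<longleftrightarrow> \<phi> \<in> sn_space (cochains X (l1 X) p q) \<and> (\<forall>xs ys. l1_sum X (\<phi> xs ys) = 0)"
    unfolding cochains_def seminormed.select_convs mem_Collect_eq l1_0_selectors(1) supp norm by blast
  show "snorm (cochains X (l1_0 X) p q) = snorm (cochains X (l1 X) p q)"
    by (simp add: fun_eq_iff snorm_def cochains_def norm)
qed

text \<open>Summation has a right inverse on cochains: it puts the value at \<open>(xs, ys)\<close> as a point mass at the
  first entry of \<open>xs\<close>, which is close to all other entries. It is not compatible with the differential
  \<open>D\<close>, and this failure is what the connecting homomorphism measures.\<close>

definition sect :: "('x, complex) cochain \<Rightarrow> ('x, 'x \<Rightarrow> complex) cochain" where
  "sect \<kappa> = (\<lambda>xs ys z. if z = hd xs then \<kappa> xs ys else 0)"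

lemma point_mass:
  assumes "x \<in> X"
  shows point_mass_l1: "(\<lambda>z. if z = x then c else 0) \<in> m_space (l1 X)"
    and point_mass_norm: "m_norm (l1 X) (\<lambda>z. if z = x then c else 0) = cmod c"
    and point_mass_sum: "l1_sum X (\<lambda>z. if z = x then c else 0) = c"
proof -
  have "((\<lambda>z. cmod (if z = x then c else 0)) has_sum (\<Sum>z\<in>{x}. cmod (if z = x then c else 0))) X"
    using assms by (intro has_sum_finite_neutralI[of "{x}"]) auto
  then have n: "((\<lambda>z. cmod (if z = x then c else 0)) has_sum cmod c) X" by simp
  have "((\<lambda>z. if z = x then c else 0) has_sum (\<Sum>z\<in>{x}. if z = x then c else 0)) X"
    using assms by (intro has_sum_finite_neutralI[of "{x}"]) auto
  then have s: "((\<lambda>z. if z = x then c else 0) has_sum c) X" by simp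
  show "(\<lambda>z. if z = x then c else 0) \<in> m_space (l1 X)"
    using assms has_sum_imp_summable[OF n] by (auto simp: vanishes_off_def)
  show "m_norm (l1 X) (\<lambda>z. if z = x then c else 0) = cmod c" using infsumI[OF n] by simp
  show "l1_sum X (\<lambda>z. if z = x then c else 0) = c" using infsumI[OF s] by (simp add: l1_sum_def)
qed

lemma cont_linear_l1_sum:
  "cont_linear (cochains X (l1 X) p q) (cochains X scalars p q) (push (l1_sum X))"
  using l1_sum_add[of _ X] l1_sum_scale[of X] l1_sum_bound[of _ X]
  by (intro cont_linear_push X_module_l1 X_module_scalars)
    (auto simp del: l1_selectors simp: scalars_def)

lemma cont_linear_inclusion:
  "cont_linear (cochains X (l1_0 X) p q) (cochains X (l1 X) p q) (push (\<lambda>f. f))"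
  by (intro cont_linear_push X_module_l1 X_module_l1_0) simp_all

lemma hd_tuples: "xs \<in> tuples X (p + 1) \<Longrightarrow> hd xs \<in> X" "xs \<in> tuples X (p + 1) \<Longrightarrow> hd xs \<in> set xs"
  by (cases xs; auto simp: tuples_def)+

lemma sect_values:
  assumes "\<kappa> \<in> sn_space (cochains X scalars p q)"
  shows "sect \<kappa> xs ys \<in> m_space (l1 X)" "m_norm (l1 X) (sect \<kappa> xs ys) = cmod (\<kappa> xs ys)"
    "l1_sum X (sect \<kappa> xs ys) = \<kappa> xs ys"
proof -
  interpret S: X_module X "scalars :: ('a, complex) xmodule" by (rule X_module_scalars)
  interpret L: X_module X "l1 X" by (rule X_module_l1)
  have "sect \<kappa> xs ys \<in> m_space (l1 X) \<and> m_norm (l1 X) (sect \<kappa> xs ys) = cmod (\<kappa> xs ys)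
      \<and> l1_sum X (sect \<kappa> xs ys) = \<kappa> xs ys"
  proof (cases "xs \<in> tuples X (p + 1)")
    case True
    then show ?thesis unfolding sect_def using hd_tuples(1)[OF True] point_mass by metis
  next
    case False
    then have "\<kappa> xs ys = 0" using assms by (simp add: S.sn_space_cochains)
    moreover from this have "sect \<kappa> xs ys = 0" by (auto simp: sect_def)
    ultimately show ?thesis using L.m_space(1) L.norm_zero by (simp add: l1_sum_def del: l1_selectors)
  qed
  then show "sect \<kappa> xs ys \<in> m_space (l1 X)" "m_norm (l1 X) (sect \<kappa> xs ys) = cmod (\<kappa> xs ys)"
    "l1_sum X (sect \<kappa> xs ys) = \<kappa> xs ys" by blast+
qed

lemma cont_linear_sect:
  "cont_linear (cochains X scalars p q) (cochains X (l1 X) p q) sect"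
proof (rule contraction_cochains[OF X_module_scalars X_module_l1])
  interpret S: X_module X "scalars :: ('a, complex) xmodule" by (rule X_module_scalars)
  fix \<kappa> assume \<kappa>: "\<kappa> \<in> sn_space (cochains X scalars p q)"
  show "sect \<kappa> xs ys \<in> m_space (l1 X)" for xs ys by (rule sect_values(1)[OF \<kappa>])
  show "sect \<kappa> xs ys = 0" if "\<not> (xs \<in> tuples X (p + 1) \<and> ys \<in> tuples X (nat (q + 1)))" for xs ys
    using \<kappa> that by (auto simp: sect_def S.sn_space_cochains fun_eq_iff)
  show "sect (\<kappa> + \<mu>) = sect \<kappa> + sect \<mu>" for \<mu> by (auto simp: sect_def fun_eq_iff)
  show "sect (c *\<^sub>C \<kappa>) = c *\<^sub>C sect \<kappa>" for c by (auto simp: sect_def fun_eq_iff)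
  show "m_norm (l1 X) (sect \<kappa> xs ys) \<le> snorm (cochains X scalars p q) i \<kappa>"
    if "xs \<in> close_tuples X (real (Suc i)) (p + 1)" "ys \<in> tuples X (nat (q + 1))" for i xs ys
    using S.le_snorm_cochains[OF \<kappa> that] unfolding sect_values(2)[OF \<kappa>] by (simp add: scalars_def)
  show "controlled_supports X (l1 X) p q (sect \<kappa>)"
    unfolding controlled_supports_iff supports_within_def
  proof (intro allI impI exI conjI)
    fix R :: real and xs ys z assume R: "R > 0"
      and xy: "(xs, ys) \<in> close_pairs X R (p + 1) (nat (q + 1))" and z: "z \<in> set xs \<union> set ys"
    have "dist z (hd xs) \<le> R" using xy z hd_tuples(2)[of xs X p] unfolding close_pairs_iff by blast
    then show "m_supp (l1 X) (sect \<kappa> xs ys) \<subseteq> cball z R" by (auto simp: sect_def split: if_splits)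
  qed
qed

lemma push_sum_sect: "\<kappa> \<in> sn_space (cochains X scalars p q) \<Longrightarrow> push (l1_sum X) (sect \<kappa>) = \<kappa>"
  by (simp add: push_def sect_values(3))

text \<open>The projection of cochains onto the kernel of the summation along the range of \<open>sect\<close>.\<close>

definition retr :: "'x set \<Rightarrow> ('x, 'x \<Rightarrow> complex) cochain \<Rightarrow> ('x, 'x \<Rightarrow> complex) cochain" where
  "retr X \<phi> = \<phi> + (-1) *\<^sub>C sect (push (l1_sum X) \<phi>)"

lemma cont_linear_retr:
  "cont_linear (cochains X (l1 X) p q) (cochains X (l1_0 X) p q) (retr X)"
proof -
  let ?E = "cochains X (l1 X) p q" and ?S = "cochains X scalars p q"
  interpret P: cont_linear ?E ?S "push (l1_sum X)" by (rule cont_linear_l1_sum)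
  interpret S: cont_linear ?S ?E sect by (rule cont_linear_sect)
  interpret T: cont_linear ?E ?E "retr X"
    unfolding retr_def
    by (intro cont_linear_add cont_linear_scaleC cont_linear_id P.E.seminormed_space_axioms
        cont_linear_comp[OF P.cont_linear_axioms S.cont_linear_axioms])
  interpret L: X_module X "l1 X" by (rule X_module_l1)
  interpret L0: X_module X "l1_0 X" by (rule X_module_l1_0)
  have zero: "l1_sum X (retr X \<phi> xs ys) = 0" if \<phi>: "\<phi> \<in> sn_space ?E" for \<phi> xs ys
  proof -
    note m = L.cochain_in_m_space[OF \<phi>, of xs ys] sect_values(1)[OF P.maps[OF \<phi>], of xs ys]
    have "l1_sum X (retr X \<phi> xs ys) = l1_sum X (\<phi> xs ys) + (-1) * l1_sum X (sect (push (l1_sum X) \<phi>) xs ys)"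
      using l1_sum_add[OF m(1) L.m_space(3)[OF m(2)], of "-1"] by (simp only: retr_def plus_fun_apply scaleC_fun_apply l1_sum_scale)
    then show ?thesis using sect_values(3)[OF P.maps[OF \<phi>], of xs ys] by (simp add: push_def)
  qed
  show ?thesis
    by (intro cont_linear.intro cont_linear_axioms.intro L0.seminormed_space_cochains
        P.E.seminormed_space_axioms)
      (simp_all add: cochains_l1_0 zero T.maps T.add T.scaleC T.bounded)
qed

lemma retr_inclusion:
  assumes "\<phi> \<in> sn_space (cochains X (l1_0 X) p q)" shows "retr X (push (\<lambda>f. f) \<phi>) = \<phi>"
proof -
  have "sect (push (l1_sum X) \<phi>) = 0" using assms by (auto simp: cochains_l1_0 push_def sect_def fun_eq_iff)
  then show ?thesis by (simp add: retr_def push_def)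
qed

lemma retr_sect_sum: "push (\<lambda>f. f) (retr X \<phi>) + sect (push (l1_sum X) \<phi>) = \<phi>"
  using scaleC_minus1[of "sect (push (l1_sum X) \<phi>)"] by (simp add: retr_def push_def fun_eq_iff)

lemma push_D:
  assumes "\<And>v w. v \<in> m_space M \<Longrightarrow> w \<in> m_space M \<Longrightarrow> f (v + w) = f v + f w"
    and "\<And>c v. v \<in> m_space M \<Longrightarrow> f (c *\<^sub>C v) = c *\<^sub>C f v"
    and M: "X_module X M" and \<phi>: "\<phi> \<in> sn_space (cochains X M p q)"
  shows "push f (diff_D X p q \<phi>) = diff_D X p q (push f \<phi>)" "push f (diff_d X p q \<phi>) = diff_d X p q (push f \<phi>)"
proof -
  interpret M: X_module X M by (rule M)
  note m = M.cochain_in_m_space[OF \<phi>]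
  have f0: "f 0 = 0" using assms(2)[OF M.m_space(1), of 0] by simp
  have "f (\<Sum>i\<in>I. c i *\<^sub>C v i) = (\<Sum>i\<in>I. c i *\<^sub>C f (v i)) \<and> (\<Sum>i\<in>I. c i *\<^sub>C v i) \<in> m_space M"
    if "\<And>i. v i \<in> m_space M" for I :: "nat set" and c v
    by (induction I rule: infinite_finite_induct) (simp_all add: f0 assms(1,2) M.m_space that)
  then have sum: "f (\<Sum>i\<in>I. c i *\<^sub>C v i) = (\<Sum>i\<in>I. c i *\<^sub>C f (v i))"
    if "\<And>i. v i \<in> m_space M" for I :: "nat set" and c v using that by blast
  show "push f (diff_D X p q \<phi>) = diff_D X p q (push f \<phi>)"
    by (auto simp: fun_eq_iff push_def diff_D_def f0 sum[OF m] simp del: sum.cl_ivl_Suc)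
  show "push f (diff_d X p q \<phi>) = diff_d X p q (push f \<phi>)"
    by (auto simp: fun_eq_iff push_def diff_d_def f0 sum[OF m] simp del: sum.cl_ivl_Suc)
qed

section \<open>The connecting homomorphism in degree zero\<close>

text \<open>A class of degree zero is a single cocycle, and a class of degree one is a coset of the group of
  differentials of elements of bidegree \<open>(0, 0)\<close>. Both are determined by the differentials that start at
  this bidegree.\<close>

locale group_bicomplex =
  fixes B :: "'b bicomplex"
  assumes comm_group: "comm_group (bi_obj B p q)"
    and D_hom: "bi_D B p q \<in> hom (bi_obj B p q) (bi_obj B (Suc p) q)"
    and d_hom: "bi_d B p q \<in> hom (bi_obj B p q) (bi_obj B p (Suc q))"
begin

lemma group_obj: "group (bi_obj B p q)"
  using comm_group by (rule comm_group.axioms(2))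

lemma monoid_obj: "monoid (bi_obj B p q)"
  using group_obj by (rule group.is_monoid)

lemma group_hom_D: "group_hom (bi_obj B p q) (bi_obj B (Suc p) q) (bi_D B p q)"
  and group_hom_d: "group_hom (bi_obj B p q) (bi_obj B p (Suc q)) (bi_d B p q)"
  by (simp_all add: group_hom.intro group_hom_axioms.intro group_obj D_hom d_hom)

text \<open>Elements of total degree zero are families indexed by \<open>{..0}\<close>.\<close>

definition single :: "'b \<Rightarrow> nat \<Rightarrow> 'b" where
  "single x = (\<lambda>p\<in>{..0}. x)"

lemma single_0 [simp]: "single x 0 = x"
  by (simp add: single_def)

lemma carrier_total_0: "carrier (total B 0) = single ` carrier (bi_obj B 0 0)"
proof (intro subset_antisym subsetI)
  fix z assume "z \<in> carrier (total B 0)"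
  then have z: "z \<in> (\<Pi>\<^sub>E p\<in>{..0}. carrier (bi_obj B p (0 - p)))" by (simp add: total_def)
  then have "z = single (z 0)" by (auto simp: single_def PiE_iff extensional_def fun_eq_iff)
  moreover have "z 0 \<in> carrier (bi_obj B 0 0)" using z by (auto simp: PiE_iff)
  ultimately show "z \<in> single ` carrier (bi_obj B 0 0)" by blast
qed (auto simp: total_def single_def PiE_iff)

lemma group_total: "group (total B n)"
  unfolding total_def by (intro product_group group_obj)

lemma coh_class_0: "z \<in> carrier (total B 0) \<Longrightarrow> coh_class B 0 z = {z}"
  using monoid.l_one[OF group.is_monoid[OF group_total]] by (simp add: coh_class_def r_coset_def)

lemma total_diff_single:
  assumes "x \<in> carrier (bi_obj B 0 0)"
  shows "total_diff B 0 (single x) = (\<lambda>p\<in>{..Suc 0}. if p = 0 then bi_d B 0 0 x else bi_D B 0 0 x)"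
proof -
  have "bi_d B 0 0 x \<in> carrier (bi_obj B 0 1)" "bi_D B 0 0 x \<in> carrier (bi_obj B 1 0)"
    using assms d_hom[of 0 0] D_hom[of 0 0] by (auto simp: hom_def)
  then show ?thesis
    using monoid.l_one[OF monoid_obj, of _ 0 1] monoid.r_one[OF monoid_obj, of _ 1 0]
    by (auto simp: total_diff_def fun_eq_iff le_Suc_eq)
qed

lemma total_1_eq_iff:
  assumes "a \<in> carrier (total B (Suc 0))" "b \<in> carrier (total B (Suc 0))"
  shows "a = b \<longleftrightarrow> a 0 = b 0 \<and> a 1 = b 1"
proof
  assume eq: "a 0 = b 0 \<and> a 1 = b 1"
  show "a = b"
  proof (rule PiE_ext[OF assms[unfolded total_def carrier_product_group]])
    fix p assume "p \<in> {..Suc 0}"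
    then have "p = 0 \<or> p = 1" by auto
    then show "a p = b p" using eq by auto
  qed
qed simp

lemma mem_total_1:
  "(\<lambda>p\<in>{..Suc 0}. if p = 0 then a else b) \<in> carrier (total B (Suc 0))
    \<longleftrightarrow> a \<in> carrier (bi_obj B 0 1) \<and> b \<in> carrier (bi_obj B 1 0)"
  by (auto simp: total_def PiE_iff le_Suc_eq)

lemma total_1D:
  assumes "a \<in> carrier (total B (Suc 0))"
  shows "a 0 \<in> carrier (bi_obj B 0 1)" "a 1 \<in> carrier (bi_obj B 1 0)"
proof -
  have "a p \<in> carrier (bi_obj B p (Suc 0 - p))" if "p \<le> Suc 0" for p
    using assms that by (auto simp: total_def PiE_iff)
  from this[of 0] this[of 1] show "a 0 \<in> carrier (bi_obj B 0 1)" "a 1 \<in> carrier (bi_obj B 1 0)"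
    by simp_all
qed

lemma total_diff_hom: "total_diff B 0 \<in> hom (total B 0) (total B (Suc 0))"
proof (rule homI)
  fix z assume "z \<in> carrier (total B 0)"
  then obtain x where x: "x \<in> carrier (bi_obj B 0 0)" "z = single x" by (auto simp: carrier_total_0)
  then show "total_diff B 0 z \<in> carrier (total B (Suc 0))"
    using d_hom[of 0 0] D_hom[of 0 0] by (simp only: total_diff_single mem_total_1) (auto simp: hom_def)
next
  fix z w assume "z \<in> carrier (total B 0)" "w \<in> carrier (total B 0)"
  then obtain x y where x: "x \<in> carrier (bi_obj B 0 0)" "z = single x"
    and y: "y \<in> carrier (bi_obj B 0 0)" "w = single y" by (auto simp: carrier_total_0)
  have xy: "x \<otimes>\<^bsub>bi_obj B 0 0\<^esub> y \<in> carrier (bi_obj B 0 0)"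
    using monoid.m_closed[OF monoid_obj] x(1) y(1) by blast
  have "z \<otimes>\<^bsub>total B 0\<^esub> w = single (x \<otimes>\<^bsub>bi_obj B 0 0\<^esub> y)"
    by (auto simp: x y total_def single_def fun_eq_iff)
  then show "total_diff B 0 (z \<otimes>\<^bsub>total B 0\<^esub> w) = total_diff B 0 z \<otimes>\<^bsub>total B (Suc 0)\<^esub> total_diff B 0 w"
    using hom_mult[OF d_hom x(1) y(1)] hom_mult[OF D_hom x(1) y(1)]
    by (simp only: total_diff_single x y xy) (auto simp: total_def fun_eq_iff le_Suc_eq)
qed

lemma cocycles_0:
  "cocycles B 0 = single ` {x \<in> carrier (bi_obj B 0 0). bi_d B 0 0 x = \<one>\<^bsub>bi_obj B 0 1\<^esub> \<and> bi_D B 0 0 x = \<one>\<^bsub>bi_obj B 1 0\<^esub>}"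
proof -
  have "total_diff B 0 (single x) = \<one>\<^bsub>total B (Suc 0)\<^esub>
      \<longleftrightarrow> bi_d B 0 0 x = \<one>\<^bsub>bi_obj B 0 1\<^esub> \<and> bi_D B 0 0 x = \<one>\<^bsub>bi_obj B 1 0\<^esub>"
    if x: "x \<in> carrier (bi_obj B 0 0)" for x
  proof -
    have "total_diff B 0 (single x) \<in> carrier (total B (Suc 0))"
      using total_diff_hom x by (auto simp: hom_def carrier_total_0)
    then show ?thesis
      using total_1_eq_iff[OF _ monoid.one_closed[OF group.is_monoid[OF group_total]]] x
      by (simp add: total_diff_single) (simp add: total_def)
  qed
  then show ?thesis unfolding cocycles_def kernel_def carrier_total_0 by auto
qed

lemma subgroup_coboundaries_1: "subgroup (coboundaries B (Suc 0)) (total B (Suc 0))"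
proof -
  interpret group_hom "total B 0" "total B (Suc 0)" "total_diff B 0"
    by (simp add: group_hom.intro group_hom_axioms.intro group_total total_diff_hom)
  show ?thesis using img_is_subgroup by simp
qed

lemma coh_class_1_eq_one_iff:
  assumes "a \<in> carrier (total B (Suc 0))"
  shows "coh_class B (Suc 0) a = \<one>\<^bsub>cohomology B (Suc 0)\<^esub> \<longleftrightarrow> a \<in> coboundaries B (Suc 0)"
  unfolding coh_class_def cohomology_def one_FactGroup
  using group.coset_join1[OF group_total _ assms subgroup_coboundaries_1]
    group.coset_join2[OF group_total assms subgroup_coboundaries_1] by blast

lemma coh_class_1_eqI:
  assumes "h \<in> coboundaries B (Suc 0)" "a \<in> carrier (total B (Suc 0))"
  shows "coh_class B (Suc 0) (h \<otimes>\<^bsub>total B (Suc 0)\<^esub> a) = coh_class B (Suc 0) a"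
proof -
  have h: "h \<in> carrier (total B (Suc 0))" using assms(1) subgroup.subset[OF subgroup_coboundaries_1] by blast
  show ?thesis
    unfolding coh_class_def
    using group.coset_mult_assoc[OF group_total subgroup.subset[OF subgroup_coboundaries_1] h assms(2)]
      group.coset_join2[OF group_total h subgroup_coboundaries_1 assms(1)] by simp
qed

end

text \<open>The splittings \<open>\<rho>\<close> and \<open>\<sigma>\<close> are homomorphisms in each bidegree. They are not assumed to commute with
  the differentials: otherwise every cocycle of \<open>C\<close> would lift to a cocycle of \<open>B\<close>.\<close>

locale split_exact_bicomplexes =
  A: group_bicomplex A + B: group_bicomplex B + C: group_bicomplex C
  for A :: "'a bicomplex" and B :: "'b bicomplex" and C :: "'c bicomplex" +
  fixes i :: "nat \<Rightarrow> nat \<Rightarrow> 'a \<Rightarrow> 'b" and r :: "nat \<Rightarrow> nat \<Rightarrow> 'b \<Rightarrow> 'c"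
    and \<rho> :: "nat \<Rightarrow> nat \<Rightarrow> 'b \<Rightarrow> 'a" and \<sigma> :: "nat \<Rightarrow> nat \<Rightarrow> 'c \<Rightarrow> 'b"
  assumes i_hom: "i p q \<in> hom (bi_obj A p q) (bi_obj B p q)"
    and r_hom: "r p q \<in> hom (bi_obj B p q) (bi_obj C p q)"
    and \<rho>_hom: "\<rho> p q \<in> hom (bi_obj B p q) (bi_obj A p q)"
    and \<sigma>_hom: "\<sigma> p q \<in> hom (bi_obj C p q) (bi_obj B p q)"
    and \<rho>_i: "a \<in> carrier (bi_obj A p q) \<Longrightarrow> \<rho> p q (i p q a) = a"
    and r_\<sigma>: "c \<in> carrier (bi_obj C p q) \<Longrightarrow> r p q (\<sigma> p q c) = c"
    and split: "b \<in> carrier (bi_obj B p q) \<Longrightarrow> i p q (\<rho> p q b) \<otimes>\<^bsub>bi_obj B p q\<^esub> \<sigma> p q (r p q b) = b"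
    and i_D: "a \<in> carrier (bi_obj A p q) \<Longrightarrow> i (Suc p) q (bi_D A p q a) = bi_D B p q (i p q a)"
    and i_d: "a \<in> carrier (bi_obj A p q) \<Longrightarrow> i p (Suc q) (bi_d A p q a) = bi_d B p q (i p q a)"
    and r_D: "b \<in> carrier (bi_obj B p q) \<Longrightarrow> r (Suc p) q (bi_D B p q b) = bi_D C p q (r p q b)"
    and r_d: "b \<in> carrier (bi_obj B p q) \<Longrightarrow> r p (Suc q) (bi_d B p q b) = bi_d C p q (r p q b)"
begin

lemma group_hom_i: "group_hom (bi_obj A p q) (bi_obj B p q) (i p q)"
  and group_hom_r: "group_hom (bi_obj B p q) (bi_obj C p q) (r p q)"
  and group_hom_\<sigma>: "group_hom (bi_obj C p q) (bi_obj B p q) (\<sigma> p q)"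
  by (simp_all add: group_hom.intro group_hom_axioms.intro A.group_obj B.group_obj C.group_obj
      i_hom r_hom \<sigma>_hom)

lemma closed:
  "a \<in> carrier (bi_obj A p q) \<Longrightarrow> i p q a \<in> carrier (bi_obj B p q)"
  "b \<in> carrier (bi_obj B p q) \<Longrightarrow> r p q b \<in> carrier (bi_obj C p q)"
  "b \<in> carrier (bi_obj B p q) \<Longrightarrow> \<rho> p q b \<in> carrier (bi_obj A p q)"
  "c \<in> carrier (bi_obj C p q) \<Longrightarrow> \<sigma> p q c \<in> carrier (bi_obj B p q)"
  "a \<in> carrier (bi_obj A p q) \<Longrightarrow> bi_D A p q a \<in> carrier (bi_obj A (Suc p) q)"
  "a \<in> carrier (bi_obj A p q) \<Longrightarrow> bi_d A p q a \<in> carrier (bi_obj A p (Suc q))"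
  "b \<in> carrier (bi_obj B p q) \<Longrightarrow> bi_D B p q b \<in> carrier (bi_obj B (Suc p) q)"
  "b \<in> carrier (bi_obj B p q) \<Longrightarrow> bi_d B p q b \<in> carrier (bi_obj B p (Suc q))"
  by (blast intro: hom_in_carrier i_hom r_hom \<rho>_hom \<sigma>_hom A.D_hom A.d_hom B.D_hom B.d_hom)+

lemma i_inj: "a \<in> carrier (bi_obj A p q) \<Longrightarrow> a' \<in> carrier (bi_obj A p q) \<Longrightarrow> i p q a = i p q a' \<Longrightarrow> a = a'"
  using \<rho>_i by metis

lemma kernel_r:
  assumes "b \<in> carrier (bi_obj B p q)" "r p q b = \<one>\<^bsub>bi_obj C p q\<^esub>"
  shows "i p q (\<rho> p q b) = b"
  using split[OF assms(1)] assms group_hom.hom_one[OF group_hom_\<sigma>]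
    monoid.r_one[OF B.monoid_obj closed(1)[OF closed(3)[OF assms(1)]]] by simp

lemma r_i:
  assumes "a \<in> carrier (bi_obj A p q)" shows "r p q (i p q a) = \<one>\<^bsub>bi_obj C p q\<^esub>"
proof -
  let ?b = "i p q a"
  have b: "?b \<in> carrier (bi_obj B p q)" by (rule closed(1)[OF assms])
  have "?b \<otimes>\<^bsub>bi_obj B p q\<^esub> \<sigma> p q (r p q ?b) = ?b" using split[OF b] \<rho>_i[OF assms] by simp
  then have "\<sigma> p q (r p q ?b) = \<one>\<^bsub>bi_obj B p q\<^esub>"
    using group.l_cancel_one[OF B.group_obj b closed(4)[OF closed(2)[OF b]]] by simp
  then show ?thesis
    using r_\<sigma>[OF closed(2)[OF b]] group_hom.hom_one[OF group_hom_r] by metis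
qed

context
  fixes x
  assumes x: "x \<in> carrier (bi_obj C 0 0)"
    and dx: "bi_d C 0 0 x = \<one>\<^bsub>bi_obj C 0 1\<^esub>" and Dx: "bi_D C 0 0 x = \<one>\<^bsub>bi_obj C 1 0\<^esub>"
begin

abbreviation lifts_to_cocycle :: bool where
  "lifts_to_cocycle \<equiv> (\<exists>y\<in>carrier (bi_obj B 0 0). r 0 0 y = x
     \<and> bi_d B 0 0 y = \<one>\<^bsub>bi_obj B 0 1\<^esub> \<and> bi_D B 0 0 y = \<one>\<^bsub>bi_obj B 1 0\<^esub>)"

lemma single_in: "C.single x \<in> carrier (total C 0)"
  using x by (auto simp: C.carrier_total_0)

lemma in_image_iff:
  "coh_class C 0 (C.single x) \<in> coh_map C r 0 ` carrier (cohomology B 0) \<longleftrightarrow> lifts_to_cocycle"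
proof -
  have r_single: "total_map r 0 (B.single y) = C.single (r 0 0 y)" for y
    by (auto simp: total_map_def B.single_def C.single_def)
  have carrier: "carrier (cohomology B 0) = (\<lambda>z. {z}) ` cocycles B 0"
  proof -
    have "coboundaries B 0 #>\<^bsub>total B 0\<lparr>carrier := cocycles B 0\<rparr>\<^esub> z = {z}" if "z \<in> cocycles B 0" for z
      using B.coh_class_0[of z] that by (auto simp: cocycles_def kernel_def coh_class_def r_coset_def)
    then show ?thesis by (auto simp: cohomology_def carrier_FactGroup)
  qed
  have "coh_map C r 0 {B.single y} = {C.single (r 0 0 y)}" if "y \<in> carrier (bi_obj B 0 0)" for y
    using C.coh_class_0 closed(2)[OF that] by (simp add: coh_map_def r_single C.carrier_total_0)
  then have "coh_map C r 0 ` carrier (cohomology B 0) = {{C.single (r 0 0 y)} | y. y \<in> carrier (bi_obj B 0 0)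
      \<and> bi_d B 0 0 y = \<one>\<^bsub>bi_obj B 0 1\<^esub> \<and> bi_D B 0 0 y = \<one>\<^bsub>bi_obj B 1 0\<^esub>}"
    unfolding carrier B.cocycles_0 by (auto simp: image_image)
  moreover have "C.single u = C.single v \<longleftrightarrow> u = v" for u v by (metis C.single_0)
  ultimately show ?thesis
    unfolding C.coh_class_0[OF single_in] by auto
qed

text \<open>Two lifts of \<open>x\<close> to \<open>B\<close> differ by an element of \<open>A\<close>, and their differentials by the differential of
  this element. Hence the class of the differential of a lift does not depend on the lift, and it is
  trivial if and only if some lift has differential zero.\<close>

lemma connecting_iff:
  "connecting A B i r 0 (coh_class C 0 (C.single x)) = \<one>\<^bsub>cohomology A (Suc 0)\<^esub> \<longleftrightarrow> lifts_to_cocycle"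
proof -
  define is_lift where "is_lift y a \<longleftrightarrow> y \<in> carrier (bi_obj B 0 0) \<and> r 0 0 y = x \<and> a \<in> carrier (total A (Suc 0))
     \<and> i 0 1 (a 0) = bi_d B 0 0 y \<and> i 1 0 (a 1) = bi_D B 0 0 y" for y a
  have witness: "(\<exists>z\<in>coh_class C 0 (C.single x). \<exists>b\<in>carrier (total B 0). \<exists>a\<in>carrier (total A (Suc 0)).
      total_map r 0 b = z \<and> total_map i (Suc 0) a = total_diff B 0 b \<and> \<beta> = coh_class A (Suc 0) a)
    \<longleftrightarrow> (\<exists>y a. is_lift y a \<and> \<beta> = coh_class A (Suc 0) a)" for \<beta>
  proof -
    have 1: "total_map r 0 (B.single y) = C.single x \<longleftrightarrow> r 0 0 y = x" for y
    proof -
      have "total_map r 0 (B.single y) = C.single (r 0 0 y)"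
        by (auto simp: total_map_def B.single_def C.single_def)
      then show ?thesis by (metis C.single_0)
    qed
    have 2: "total_map i (Suc 0) a = total_diff B 0 (B.single y)
        \<longleftrightarrow> i 0 1 (a 0) = bi_d B 0 0 y \<and> i 1 0 (a 1) = bi_D B 0 0 y"
      if a: "a \<in> carrier (total A (Suc 0))" and y: "y \<in> carrier (bi_obj B 0 0)" for a y
    proof -
      have "total_map i (Suc 0) a = (\<lambda>p\<in>{..Suc 0}. if p = 0 then i 0 1 (a 0) else i 1 0 (a 1))"
        by (auto simp: total_map_def fun_eq_iff le_Suc_eq)
      moreover have "(\<lambda>p\<in>{..Suc 0}. if p = 0 then u else v) = (\<lambda>p\<in>{..Suc 0}. if p = 0 then u' else v')
          \<longleftrightarrow> u = u' \<and> v = v'" for u v u' v' :: 'b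
        by (auto simp: fun_eq_iff dest: spec[of _ 0] spec[of _ "Suc 0"])
      ultimately show ?thesis by (simp only: B.total_diff_single[OF y])
    qed
    show ?thesis
      unfolding C.coh_class_0[OF single_in] is_lift_def B.carrier_total_0 using 1 2 by auto
  qed
  have unique: "\<exists>c\<in>carrier (bi_obj A 0 0). i 0 0 c = y \<otimes>\<^bsub>bi_obj B 0 0\<^esub> inv\<^bsub>bi_obj B 0 0\<^esub> y'
      \<and> a = total_diff A 0 (A.single c) \<otimes>\<^bsub>total A (Suc 0)\<^esub> a'"
    if l: "is_lift y a" and l': "is_lift y' a'" for y y' a a'
  proof -
    interpret B00: group "bi_obj B 0 0" by (rule B.group_obj)
    interpret C00: group "bi_obj C 0 0" by (rule C.group_obj)
    interpret r: group_hom "bi_obj B 0 0" "bi_obj C 0 0" "r 0 0" by (rule group_hom_r)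
    interpret T: group "total A (Suc 0)" by (rule A.group_total)
    let ?u = "y \<otimes>\<^bsub>bi_obj B 0 0\<^esub> inv\<^bsub>bi_obj B 0 0\<^esub> y'"
    define c where "c = \<rho> 0 0 ?u"
    have y: "y \<in> carrier (bi_obj B 0 0)" "r 0 0 y = x" and y': "y' \<in> carrier (bi_obj B 0 0)" "r 0 0 y' = x"
      and a: "a \<in> carrier (total A (Suc 0))" and a': "a' \<in> carrier (total A (Suc 0))"
      using l l' by (auto simp: is_lift_def)
    have u: "?u \<in> carrier (bi_obj B 0 0)" using y y' by simp
    have "r 0 0 ?u = \<one>\<^bsub>bi_obj C 0 0\<^esub>" using y y' x by simp
    then have ic: "i 0 0 c = ?u" unfolding c_def using u by (rule kernel_r[rotated])
    have c: "c \<in> carrier (bi_obj A 0 0)" unfolding c_def using u by (rule closed(3))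
    have uy': "?u \<otimes>\<^bsub>bi_obj B 0 0\<^esub> y' = y" using y y' by (simp add: B00.m_assoc)
    have "i 0 1 (bi_d A 0 0 c \<otimes>\<^bsub>bi_obj A 0 1\<^esub> a' 0) = i 0 1 (bi_d A 0 0 c) \<otimes>\<^bsub>bi_obj B 0 1\<^esub> i 0 1 (a' 0)"
      using hom_mult[OF i_hom, of "bi_d A 0 0 c" 0 1 "a' 0"] closed(6)[OF c] A.total_1D[OF a'] by simp
    also have "\<dots> = bi_d B 0 0 ?u \<otimes>\<^bsub>bi_obj B 0 1\<^esub> bi_d B 0 0 y'"
      using i_d[OF c] ic l' by (simp add: is_lift_def)
    also have "\<dots> = bi_d B 0 0 y" using hom_mult[OF B.d_hom u y'(1)] uy' by simp
    also have "\<dots> = i 0 1 (a 0)" using l by (simp add: is_lift_def)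
    finally have d: "bi_d A 0 0 c \<otimes>\<^bsub>bi_obj A 0 1\<^esub> a' 0 = a 0"
      using closed(6)[OF c] A.total_1D[OF a'] A.total_1D[OF a]
      by (intro i_inj) (auto intro: monoid.m_closed[OF A.monoid_obj])
    have "i 1 0 (bi_D A 0 0 c \<otimes>\<^bsub>bi_obj A 1 0\<^esub> a' 1) = i 1 0 (bi_D A 0 0 c) \<otimes>\<^bsub>bi_obj B 1 0\<^esub> i 1 0 (a' 1)"
      using hom_mult[OF i_hom, of "bi_D A 0 0 c" 1 0 "a' 1"] closed(5)[OF c] A.total_1D[OF a'] by simp
    also have "\<dots> = bi_D B 0 0 ?u \<otimes>\<^bsub>bi_obj B 1 0\<^esub> bi_D B 0 0 y'"
      using i_D[OF c] ic l' by (simp add: is_lift_def)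
    also have "\<dots> = bi_D B 0 0 y" using hom_mult[OF B.D_hom u y'(1)] uy' by simp
    also have "\<dots> = i 1 0 (a 1)" using l by (simp add: is_lift_def)
    finally have D: "bi_D A 0 0 c \<otimes>\<^bsub>bi_obj A 1 0\<^esub> a' 1 = a 1"
      using closed(5)[OF c] A.total_1D[OF a'] A.total_1D[OF a]
      by (intro i_inj) (auto intro: monoid.m_closed[OF A.monoid_obj])
    have dc: "total_diff A 0 (A.single c) \<in> carrier (total A (Suc 0))"
      using A.total_diff_hom c by (auto simp: hom_def A.carrier_total_0)
    have "total_diff A 0 (A.single c) \<otimes>\<^bsub>total A (Suc 0)\<^esub> a' = a"
      using A.total_1_eq_iff[OF T.m_closed[OF dc a'] a] d D
      by (simp add: A.total_diff_single[OF c]) (simp add: total_def)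
    then show ?thesis using c ic by metis
  qed
  \<comment> \<open>the lift given by the splitting\<close>
  define y0 where "y0 = \<sigma> 0 0 x"
  define a0 where "a0 = (\<lambda>p\<in>{..Suc 0}. if p = 0 then \<rho> 0 1 (bi_d B 0 0 y0) else \<rho> 1 0 (bi_D B 0 0 y0))"
  have y0: "y0 \<in> carrier (bi_obj B 0 0)" "r 0 0 y0 = x"
    unfolding y0_def using closed(4)[OF x] r_\<sigma>[OF x] by auto
  have dy0: "bi_d B 0 0 y0 \<in> carrier (bi_obj B 0 1)" "bi_D B 0 0 y0 \<in> carrier (bi_obj B 1 0)"
    using closed(7,8)[OF y0(1)] by auto
  have "i 0 1 (\<rho> 0 1 (bi_d B 0 0 y0)) = bi_d B 0 0 y0" "i 1 0 (\<rho> 1 0 (bi_D B 0 0 y0)) = bi_D B 0 0 y0"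
    using kernel_r[OF dy0(1)] kernel_r[OF dy0(2)] r_d[OF y0(1)] r_D[OF y0(1)] y0(2) dx Dx by auto
  moreover have "a0 \<in> carrier (total A (Suc 0))"
    unfolding a0_def A.mem_total_1 using closed(3)[OF dy0(1)] closed(3)[OF dy0(2)] by blast
  ultimately have l0: "is_lift y0 a0" using y0 unfolding is_lift_def by (simp add: a0_def)
  then have a0: "a0 \<in> carrier (total A (Suc 0))" by (simp add: is_lift_def)
  have coh_eq: "coh_class A (Suc 0) a = coh_class A (Suc 0) a0" if l: "is_lift y a" for y a
  proof -
    obtain c where "c \<in> carrier (bi_obj A 0 0)" "a = total_diff A 0 (A.single c) \<otimes>\<^bsub>total A (Suc 0)\<^esub> a0"
      using unique[OF l l0] by blast
    then show ?thesis using A.coh_class_1_eqI[OF _ a0] by (auto simp: A.carrier_total_0)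
  qed
  have "connecting A B i r 0 (coh_class C 0 (C.single x)) = coh_class A (Suc 0) a0"
    unfolding connecting_def witness using l0 coh_eq by (intro the_equality) blast+
  then have "connecting A B i r 0 (coh_class C 0 (C.single x)) = \<one>\<^bsub>cohomology A (Suc 0)\<^esub>
      \<longleftrightarrow> a0 \<in> coboundaries A (Suc 0)"
    using A.coh_class_1_eq_one_iff[OF a0] by simp
  also have "\<dots> \<longleftrightarrow> lifts_to_cocycle"
  proof
    assume "a0 \<in> coboundaries A (Suc 0)"
    then obtain c where c: "c \<in> carrier (bi_obj A 0 0)" "a0 = total_diff A 0 (A.single c)"
      by (auto simp: A.carrier_total_0)
    interpret B00: group "bi_obj B 0 0" by (rule B.group_obj)
    interpret C00: group "bi_obj C 0 0" by (rule C.group_obj)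
    interpret r: group_hom "bi_obj B 0 0" "bi_obj C 0 0" "r 0 0" by (rule group_hom_r)
    interpret d: group_hom "bi_obj B 0 0" "bi_obj B 0 (Suc 0)" "bi_d B 0 0" by (rule B.group_hom_d)
    interpret D: group_hom "bi_obj B 0 0" "bi_obj B (Suc 0) 0" "bi_D B 0 0" by (rule B.group_hom_D)
    define y where "y = y0 \<otimes>\<^bsub>bi_obj B 0 0\<^esub> inv\<^bsub>bi_obj B 0 0\<^esub> i 0 0 c"
    have ic: "i 0 0 c \<in> carrier (bi_obj B 0 0)" by (rule closed(1)[OF c(1)])
    have "bi_d B 0 0 (i 0 0 c) = bi_d B 0 0 y0" "bi_D B 0 0 (i 0 0 c) = bi_D B 0 0 y0"
      using l0 i_d[OF c(1)] i_D[OF c(1)] by (auto simp: is_lift_def c(2) A.total_diff_single[OF c(1)])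
    then have "bi_d B 0 0 y = \<one>\<^bsub>bi_obj B 0 (Suc 0)\<^esub>" "bi_D B 0 0 y = \<one>\<^bsub>bi_obj B (Suc 0) 0\<^esub>"
      using y0 ic by (simp_all add: y_def)
    moreover have "r 0 0 y = x" using y0 ic r_i[OF c(1)] x by (simp add: y_def)
    moreover have "y \<in> carrier (bi_obj B 0 0)" using y0 ic by (simp add: y_def)
    ultimately show lifts_to_cocycle by (intro bexI[of _ y]) simp_all
  next
    assume lifts_to_cocycle
    then obtain y where y: "y \<in> carrier (bi_obj B 0 0)" "r 0 0 y = x"
      "bi_d B 0 0 y = \<one>\<^bsub>bi_obj B 0 1\<^esub>" "bi_D B 0 0 y = \<one>\<^bsub>bi_obj B 1 0\<^esub>"
      by (elim bexE conjE)
    let ?e = "\<one>\<^bsub>total A (Suc 0)\<^esub>"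
    interpret T: group "total A (Suc 0)" by (rule A.group_total)
    have "is_lift y ?e"
      using y group_hom.hom_one[OF group_hom_i, of 0 1] group_hom.hom_one[OF group_hom_i, of 1 0] T.one_closed
      unfolding is_lift_def by (simp add: total_def)
    then have "coh_class A (Suc 0) a0 = coh_class A (Suc 0) ?e" using coh_eq by simp
    moreover have "?e \<in> coboundaries A (Suc 0)" by (rule subgroup.one_closed[OF A.subgroup_coboundaries_1])
    ultimately show "a0 \<in> coboundaries A (Suc 0)"
      using A.coh_class_1_eq_one_iff[OF a0] A.coh_class_1_eq_one_iff[OF T.one_closed] by simp
  qed
  finally show ?thesis .
qed

end

end

section \<open>The completed bicomplexes\<close>

lemma (in X_module) cont_linear_d_nat:
  "cont_linear (cochains X M p (int q)) (cochains X M p (int (Suc q))) (diff_d X p (int q))"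
  using cont_linear_d[of "int q" p] by (simp add: add.commute)

lemma (in X_module) group_bicomplex_Q: "group_bicomplex (Q_bicomplex X M)"
  by (rule group_bicomplex.intro)
    (simp_all add: Q_bicomplex_def seminormed_space.comm_group_Q[OF seminormed_space_cochains]
      cont_linear.Q_map_hom[OF cont_linear_D]
      cont_linear.Q_map_hom[OF cont_linear_d_nat, simplified])

lemma (in X_module) group_bicomplex_W: "group_bicomplex (W_bicomplex X M)"
  by (rule group_bicomplex.intro)
    (simp_all add: W_bicomplex_def seminormed_space.comm_group_W[OF seminormed_space_cochains]
      cont_linear.W_map_hom[OF cont_linear_D]
      cont_linear.W_map_hom[OF cont_linear_d_nat, simplified])

lemma Q_map_square:
  assumes T: "cont_linear E F T" and S: "cont_linear F G S"
    and T': "cont_linear E F' T'" and S': "cont_linear F' G S'"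
    and eq: "\<And>\<phi>. \<phi> \<in> sn_space E \<Longrightarrow> S (T \<phi>) = S' (T' \<phi>)"
    and c: "c \<in> carrier (Q_completion E)"
  shows "Q_map G S (Q_map F T c) = Q_map G S' (Q_map F' T' c)"
  unfolding Q_map_comp[OF T S c] Q_map_comp[OF T' S' c]
  by (rule cont_linear.Q_map_cong[OF cont_linear_comp[OF T' S'] eq c])

lemma W_map_square:
  assumes T: "cont_linear E F T" and S: "cont_linear F G S"
    and T': "cont_linear E F' T'" and S': "cont_linear F' G S'"
    and eq: "\<And>\<phi>. \<phi> \<in> sn_space E \<Longrightarrow> S (T \<phi>) = S' (T' \<phi>)"
  shows "W_map F G S (W_map E F T \<eta>) = W_map F' G S' (W_map E F' T' \<eta>)"
  unfolding W_map_comp[OF T S] W_map_comp[OF T' S']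
  by (simp only: cont_linear.W_map_cong[OF cont_linear_comp[OF T' S'] eq])

lemma push_sum_D:
  assumes "\<phi> \<in> sn_space (cochains X (l1 X) p q)"
  shows "push (l1_sum X) (diff_D X p q \<phi>) = diff_D X p q (push (l1_sum X) \<phi>)"
    "push (l1_sum X) (diff_d X p q \<phi>) = diff_d X p q (push (l1_sum X) \<phi>)"
  by (rule push_D[OF _ _ X_module_l1 assms]; simp add: l1_sum_add l1_sum_scale del: l1_selectors)+

lemma split_exact_Q:
  "split_exact_bicomplexes (Q_bicomplex X (l1_0 X)) (Q_bicomplex X (l1 X)) (Q_bicomplex X scalars)
    (Q_iota X) (Q_pi X) (\<lambda>p q. Q_map (cochains X (l1_0 X) p (int q)) (retr X))
    (\<lambda>p q. Q_map (cochains X (l1 X) p (int q)) sect)"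
proof (intro split_exact_bicomplexes.intro split_exact_bicomplexes_axioms.intro
    X_module.group_bicomplex_Q X_module_l1 X_module_l1_0 X_module_scalars)
  note i = cont_linear_inclusion and r = cont_linear_l1_sum
    and \<rho> = cont_linear_retr and \<sigma> = cont_linear_sect
  note D = X_module.cont_linear_D[OF X_module_l1] X_module.cont_linear_D[OF X_module_l1_0]
      X_module.cont_linear_D[OF X_module_scalars]
    and d = X_module.cont_linear_d_nat[OF X_module_l1] X_module.cont_linear_d_nat[OF X_module_l1_0]
      X_module.cont_linear_d_nat[OF X_module_scalars]
  note sn = X_module.seminormed_space_cochains
  fix p q
  let ?EA = "cochains X (l1_0 X) p (int q)" and ?A = "bi_obj (Q_bicomplex X (l1_0 X)) p q"
    and ?EB = "cochains X (l1 X) p (int q)" and ?B = "bi_obj (Q_bicomplex X (l1 X)) p q"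
    and ?EC = "cochains X scalars p (int q)" and ?C = "bi_obj (Q_bicomplex X scalars) p q"
  show "Q_iota X p q \<in> hom ?A ?B"
    by (simp add: Q_bicomplex_def Q_iota_def cont_linear.Q_map_hom[OF i])
  show "Q_pi X p q \<in> hom ?B ?C"
    by (simp add: Q_bicomplex_def Q_pi_def cont_linear.Q_map_hom[OF r])
  show "Q_map ?EA (retr X) \<in> hom ?B ?A"
    by (simp add: Q_bicomplex_def cont_linear.Q_map_hom[OF \<rho>])
  show "Q_map ?EB sect \<in> hom ?C ?B"
    by (simp add: Q_bicomplex_def cont_linear.Q_map_hom[OF \<sigma>])
  {
    fix a assume "a \<in> carrier ?A"
    then have a: "a \<in> carrier (Q_completion ?EA)" by (simp add: Q_bicomplex_def)
    show "Q_map ?EA (retr X) (Q_iota X p q a) = a"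
      unfolding Q_iota_def Q_map_comp[OF i \<rho> a]
      using cont_linear.Q_map_cong[OF cont_linear_id[OF sn[OF X_module_l1_0]] retr_inclusion a]
        Q_map_id[OF sn[OF X_module_l1_0] a] by simp
    show "Q_iota X (Suc p) q (bi_D (Q_bicomplex X (l1_0 X)) p q a) = bi_D (Q_bicomplex X (l1 X)) p q (Q_iota X p q a)"
      unfolding Q_iota_def Q_bicomplex_def bicomplex.select_convs
      by (rule Q_map_square[OF D(2) i i D(1) _ a]) (simp add: push_def)
    show "Q_iota X p (Suc q) (bi_d (Q_bicomplex X (l1_0 X)) p q a) = bi_d (Q_bicomplex X (l1 X)) p q (Q_iota X p q a)"
      unfolding Q_iota_def Q_bicomplex_def bicomplex.select_convs
      by (rule Q_map_square[OF d(2) i i d(1) _ a]) (simp add: push_def)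
  }
  {
    fix c assume "c \<in> carrier ?C"
    then have c: "c \<in> carrier (Q_completion ?EC)" by (simp add: Q_bicomplex_def)
    show "Q_pi X p q (Q_map ?EB sect c) = c"
      unfolding Q_pi_def Q_map_comp[OF \<sigma> r c]
      using cont_linear.Q_map_cong[OF cont_linear_id[OF sn[OF X_module_scalars]] push_sum_sect c]
        Q_map_id[OF sn[OF X_module_scalars] c] by simp
  }
  {
    fix b assume "b \<in> carrier ?B"
    then have b: "b \<in> carrier (Q_completion ?EB)" by (simp add: Q_bicomplex_def)
    show "Q_iota X p q (Q_map ?EA (retr X) b) \<otimes>\<^bsub>?B\<^esub>
        Q_map ?EB sect (Q_pi X p q b) = b"
      unfolding Q_iota_def Q_pi_def Q_bicomplex_def bicomplex.select_convs Q_map_comp[OF \<rho> i b] Q_map_comp[OF r \<sigma> b]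
        Q_map_add[OF cont_linear_comp[OF \<rho> i] cont_linear_comp[OF r \<sigma>] b, symmetric]
        retr_sect_sum by (rule Q_map_id[OF sn[OF X_module_l1] b])
    show "Q_pi X (Suc p) q (bi_D (Q_bicomplex X (l1 X)) p q b) = bi_D (Q_bicomplex X scalars) p q (Q_pi X p q b)"
      unfolding Q_pi_def Q_bicomplex_def bicomplex.select_convs
      by (rule Q_map_square[OF D(1) r r D(3) _ b]) (rule push_sum_D(1))
    show "Q_pi X p (Suc q) (bi_d (Q_bicomplex X (l1 X)) p q b) = bi_d (Q_bicomplex X scalars) p q (Q_pi X p q b)"
      unfolding Q_pi_def Q_bicomplex_def bicomplex.select_convs
      by (rule Q_map_square[OF d(1) r r d(3) _ b]) (rule push_sum_D(2))
  }
qed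

lemma split_exact_W:
  "split_exact_bicomplexes (W_bicomplex X (l1_0 X)) (W_bicomplex X (l1 X)) (W_bicomplex X scalars)
    (W_iota X) (W_pi X) (\<lambda>p q. W_map (cochains X (l1 X) p (int q)) (cochains X (l1_0 X) p (int q)) (retr X))
    (\<lambda>p q. W_map (cochains X scalars p (int q)) (cochains X (l1 X) p (int q)) sect)"
proof (intro split_exact_bicomplexes.intro split_exact_bicomplexes_axioms.intro
    X_module.group_bicomplex_W X_module_l1 X_module_l1_0 X_module_scalars)
  note i = cont_linear_inclusion and r = cont_linear_l1_sum
    and \<rho> = cont_linear_retr and \<sigma> = cont_linear_sect
  note D = X_module.cont_linear_D[OF X_module_l1] X_module.cont_linear_D[OF X_module_l1_0]
      X_module.cont_linear_D[OF X_module_scalars]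
    and d = X_module.cont_linear_d_nat[OF X_module_l1] X_module.cont_linear_d_nat[OF X_module_l1_0]
      X_module.cont_linear_d_nat[OF X_module_scalars]
  note sn = X_module.seminormed_space_cochains
  note car = seminormed_space.W_completion_simps(1)[OF sn]
  fix p q
  let ?EA = "cochains X (l1_0 X) p (int q)" and ?A = "bi_obj (W_bicomplex X (l1_0 X)) p q"
    and ?EB = "cochains X (l1 X) p (int q)" and ?B = "bi_obj (W_bicomplex X (l1 X)) p q"
    and ?EC = "cochains X scalars p (int q)" and ?C = "bi_obj (W_bicomplex X scalars) p q"
  show "W_iota X p q \<in> hom ?A ?B"
    by (simp add: W_bicomplex_def W_iota_def cont_linear.W_map_hom[OF i])
  show "W_pi X p q \<in> hom ?B ?C"
    by (simp add: W_bicomplex_def W_pi_def cont_linear.W_map_hom[OF r])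
  show "W_map ?EB ?EA (retr X) \<in> hom ?B ?A"
    by (simp add: W_bicomplex_def cont_linear.W_map_hom[OF \<rho>])
  show "W_map ?EC ?EB sect \<in> hom ?C ?B"
    by (simp add: W_bicomplex_def cont_linear.W_map_hom[OF \<sigma>])
  {
    fix a assume "a \<in> carrier ?A"
    then have a: "a \<in> bidual ?EA"
      by (simp add: W_bicomplex_def car[OF X_module_l1_0])
    show "W_map ?EB ?EA (retr X) (W_iota X p q a) = a"
    proof -
      have "W_map ?EA ?EA (\<lambda>\<phi>. retr X (push (\<lambda>f. f) \<phi>))
          = W_map ?EA ?EA (\<lambda>\<phi>. \<phi>)"
        by (rule cont_linear.W_map_cong[OF cont_linear_id[OF sn[OF X_module_l1_0]]])
          (rule retr_inclusion)
      then show ?thesis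
        unfolding W_iota_def W_map_comp[OF i \<rho>] using W_map_id[OF sn[OF X_module_l1_0] a] by simp
    qed
    show "W_iota X (Suc p) q (bi_D (W_bicomplex X (l1_0 X)) p q a) = bi_D (W_bicomplex X (l1 X)) p q (W_iota X p q a)"
      unfolding W_iota_def W_bicomplex_def bicomplex.select_convs
      by (rule W_map_square[OF D(2) i i D(1)]) (simp add: push_def)
    show "W_iota X p (Suc q) (bi_d (W_bicomplex X (l1_0 X)) p q a) = bi_d (W_bicomplex X (l1 X)) p q (W_iota X p q a)"
      unfolding W_iota_def W_bicomplex_def bicomplex.select_convs
      by (rule W_map_square[OF d(2) i i d(1)]) (simp add: push_def)
  }
  {
    fix c assume "c \<in> carrier ?C"
    then have c: "c \<in> bidual ?EC"
      by (simp add: W_bicomplex_def car[OF X_module_scalars])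
    show "W_pi X p q (W_map ?EC ?EB sect c) = c"
    proof -
      have "W_map ?EC ?EC (\<lambda>\<kappa>. push (l1_sum X) (sect \<kappa>))
          = W_map ?EC ?EC (\<lambda>\<kappa>. \<kappa>)"
        by (rule cont_linear.W_map_cong[OF cont_linear_id[OF sn[OF X_module_scalars]]])
          (rule push_sum_sect)
      then show ?thesis
        unfolding W_pi_def W_map_comp[OF \<sigma> r] using W_map_id[OF sn[OF X_module_scalars] c] by simp
    qed
  }
  {
    fix b assume "b \<in> carrier ?B"
    then have b: "b \<in> bidual ?EB"
      by (simp add: W_bicomplex_def car[OF X_module_l1])
    show "W_iota X p q (W_map ?EB ?EA (retr X) b) \<otimes>\<^bsub>?B\<^esub>
        W_map ?EC ?EB sect (W_pi X p q b) = b"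
      unfolding W_iota_def W_pi_def W_bicomplex_def bicomplex.select_convs W_map_comp[OF \<rho> i] W_map_comp[OF r \<sigma>]
        seminormed_space.W_completion_simps(2)[OF sn[OF X_module_l1]]
        W_map_sum[OF cont_linear_comp[OF \<rho> i] cont_linear_comp[OF r \<sigma>] b, symmetric]
        retr_sect_sum by (rule W_map_id[OF sn[OF X_module_l1] b])
    show "W_pi X (Suc p) q (bi_D (W_bicomplex X (l1 X)) p q b) = bi_D (W_bicomplex X scalars) p q (W_pi X p q b)"
      unfolding W_pi_def W_bicomplex_def bicomplex.select_convs
      by (rule W_map_square[OF D(1) r r D(3)]) (rule push_sum_D(1))
    show "W_pi X p (Suc q) (bi_d (W_bicomplex X (l1 X)) p q b) = bi_d (W_bicomplex X scalars) p q (W_pi X p q b)"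
      unfolding W_pi_def W_bicomplex_def bicomplex.select_convs
      by (rule W_map_square[OF d(1) r r d(3)]) (rule push_sum_D(2))
  }
qed

subsection \<open>The constant cochain\<close>

abbreviation one_cochain :: "'x set \<Rightarrow> ('x, complex) cochain" where
  "one_cochain X \<equiv> diff_d X 0 (-1) (const_one X)"

lemma const_one_in: "const_one X \<in> sn_space (cochains X scalars 0 (-1))"
proof -
  interpret S: X_module X "scalars :: ('a, complex) xmodule" by (rule X_module_scalars)
  show ?thesis
    unfolding S.sn_space_cochains controlled_supports_iff supports_within_def
    by (auto simp: const_one_def scalars_def intro!: exI[of _ "1::real"])
qed

lemma one_cochain_in: "one_cochain X \<in> sn_space (cochains X scalars 0 0)"
  using cont_linear.maps[OF X_module.cont_linear_d[OF X_module_scalars, of "-1" X 0] const_one_in]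
  by simp

lemma tuples_1: "xs \<in> tuples X (Suc 0) \<longleftrightarrow> (\<exists>x\<in>X. xs = [x])"
  by (auto simp: tuples_def length_Suc_conv)

lemma tuples_2: "xs \<in> tuples X (Suc (Suc 0)) \<longleftrightarrow> (\<exists>x\<in>X. \<exists>y\<in>X. xs = [x, y])"
  by (auto simp: tuples_def length_Suc_conv)

lemma tuples_0: "xs \<in> tuples X 0 \<longleftrightarrow> xs = []"
  by (auto simp: tuples_def)

lemma one_cochain_apply: "one_cochain X xs ys = (if xs \<in> tuples X 1 \<and> ys \<in> tuples X 1 then 1 else 0)"
  by (auto simp: diff_d_def const_one_def tuples_1 tuples_0 omit_def)

lemma one_cochain_cocycle: "diff_D X 0 0 (one_cochain X) = 0" "diff_d X 0 0 (one_cochain X) = 0"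
  by (auto simp: fun_eq_iff diff_D_def[of X 0 0] diff_d_def[of X 0 0] one_cochain_apply tuples_1 tuples_2 omit_def
      numeral_2_eq_2)

text \<open>A bounded sequence whose class in the quotient completion is a cocycle that \<open>\<pi>\<close> maps to \<open>1\<close>.\<close>

definition cocycle_lifting_one_Q :: "'x::metric_space set \<Rightarrow> (nat \<Rightarrow> ('x, 'x \<Rightarrow> complex) cochain) \<Rightarrow> bool" where
  "cocycle_lifting_one_Q X s \<longleftrightarrow> s \<in> bounded_seqs (cochains X (l1 X) 0 0)
     \<and> (\<lambda>n. diff_D X 0 0 (s n)) \<in> null_seqs (cochains X (l1 X) 1 0)
     \<and> (\<lambda>n. diff_d X 0 0 (s n)) \<in> null_seqs (cochains X (l1 X) 0 1)
     \<and> (\<lambda>n. push (l1_sum X) (s n)) - (\<lambda>n. one_cochain X) \<in> null_seqs (cochains X scalars 0 0)"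

definition cocycle_lifting_one_W ::
    "'x::metric_space set \<Rightarrow> ((('x, 'x \<Rightarrow> complex) cochain \<Rightarrow> complex) \<Rightarrow> complex) \<Rightarrow> bool" where
  "cocycle_lifting_one_W X \<eta> \<longleftrightarrow> \<eta> \<in> bidual (cochains X (l1 X) 0 0)
     \<and> W_map (cochains X (l1 X) 0 0) (cochains X (l1 X) 1 0) (diff_D X 0 0) \<eta> = 0
     \<and> W_map (cochains X (l1 X) 0 0) (cochains X (l1 X) 0 1) (diff_d X 0 0) \<eta> = 0
     \<and> W_map (cochains X (l1 X) 0 0) (cochains X scalars 0 0) (push (l1_sum X)) \<eta>
         = W_incl (cochains X scalars 0 0) (one_cochain X)"

text \<open>Both conditions say that the class of \<open>1\<close> lifts to a cocycle; such a cocycle is represented by a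
  bounded sequence, and its equations hold up to null sequences.\<close>

theorem Q_conditions_iff:
  "one_Q_class X \<in> pi_star_Q X 0 ` carrier (H_Q X (l1 X) 0) \<longleftrightarrow> (\<exists>s. cocycle_lifting_one_Q X s)"
  "connecting_Q X 0 (one_Q_class X) = \<one>\<^bsub>H_Q X (l1_0 X) 1\<^esub> \<longleftrightarrow> (\<exists>s. cocycle_lifting_one_Q X s)"
proof -
  interpret split_exact_bicomplexes "Q_bicomplex X (l1_0 X)" "Q_bicomplex X (l1 X)" "Q_bicomplex X scalars"
    "Q_iota X" "Q_pi X" "\<lambda>p q. Q_map (cochains X (l1_0 X) p (int q)) (retr X)"
    "\<lambda>p q. Q_map (cochains X (l1 X) p (int q)) sect"
    by (rule split_exact_Q)
  note D = X_module.cont_linear_D[of X _ 0 0, simplified] and d = X_module.cont_linear_d[of X _ 0 0, simplified]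
  interpret DL: cont_linear "cochains X (l1 X) 0 0" "cochains X (l1 X) (Suc 0) 0" "diff_D X 0 0"
    by (rule D[OF X_module_l1])
  interpret dL: cont_linear "cochains X (l1 X) 0 0" "cochains X (l1 X) 0 1" "diff_d X 0 0"
    by (rule d[OF X_module_l1])
  interpret DS: cont_linear "cochains X scalars 0 0" "cochains X scalars (Suc 0) 0" "diff_D X 0 0"
    by (rule D[OF X_module_scalars])
  interpret dS: cont_linear "cochains X scalars 0 0" "cochains X scalars 0 1" "diff_d X 0 0"
    by (rule d[OF X_module_scalars])
  interpret P: cont_linear "cochains X (l1 X) 0 0" "cochains X scalars 0 0" "push (l1_sum X)"
    by (rule cont_linear_l1_sum)
  let ?x = "Q_incl (cochains X scalars 0 0) (one_cochain X)"
  note const = DS.E.const_bounded[OF one_cochain_in]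
  have x: "?x \<in> carrier (bi_obj (Q_bicomplex X scalars) 0 0)"
    using const by (simp add: Q_bicomplex_def DS.E.carrier_Q Q_incl_def)
  have dx: "bi_d (Q_bicomplex X scalars) 0 0 ?x = \<one>\<^bsub>bi_obj (Q_bicomplex X scalars) 0 1\<^esub>"
    using dS.Q_map_class[OF const] one_cochain_cocycle(2)[of X]
    by (simp add: Q_bicomplex_def Q_incl_def dS.F.one_Q zero_fun_def)
  have Dx: "bi_D (Q_bicomplex X scalars) 0 0 ?x = \<one>\<^bsub>bi_obj (Q_bicomplex X scalars) 1 0\<^esub>"
    using DS.Q_map_class[OF const] one_cochain_cocycle(1)[of X]
    by (simp add: Q_bicomplex_def Q_incl_def DS.F.one_Q zero_fun_def)
  have cls: "one_Q_class X = coh_class (Q_bicomplex X scalars) 0 (C.single ?x)"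
    by (simp only: one_Q_class_def C.single_def)
  have "(\<exists>y\<in>carrier (bi_obj (Q_bicomplex X (l1 X)) 0 0). Q_pi X 0 0 y = ?x
      \<and> bi_d (Q_bicomplex X (l1 X)) 0 0 y = \<one>\<^bsub>bi_obj (Q_bicomplex X (l1 X)) 0 1\<^esub>
      \<and> bi_D (Q_bicomplex X (l1 X)) 0 0 y = \<one>\<^bsub>bi_obj (Q_bicomplex X (l1 X)) 1 0\<^esub>)
    \<longleftrightarrow> (\<exists>s. cocycle_lifting_one_Q X s)" (is "?L \<longleftrightarrow> ?R")
  proof -
    have "?L \<longleftrightarrow> (\<exists>s\<in>bounded_seqs (cochains X (l1 X) 0 0).
        Q_map (cochains X scalars 0 0) (push (l1_sum X)) (Q_class (cochains X (l1 X) 0 0) s) = ?x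
        \<and> Q_map (cochains X (l1 X) 0 1) (diff_d X 0 0) (Q_class (cochains X (l1 X) 0 0) s) = \<one>\<^bsub>Q_completion (cochains X (l1 X) 0 1)\<^esub>
        \<and> Q_map (cochains X (l1 X) (Suc 0) 0) (diff_D X 0 0) (Q_class (cochains X (l1 X) 0 0) s) = \<one>\<^bsub>Q_completion (cochains X (l1 X) (Suc 0) 0)\<^esub>)"
      by (simp add: Q_bicomplex_def Q_pi_def DL.E.carrier_Q)
    also have "\<dots> \<longleftrightarrow> ?R"
      unfolding cocycle_lifting_one_Q_def
      by (auto simp: P.Q_map_class dL.Q_map_class DL.Q_map_class Q_incl_def DS.E.Q_class_eq_iff
          dL.F.Q_class_eq_one_iff DL.F.Q_class_eq_one_iff)
    finally show ?thesis .
  qed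
  then show "one_Q_class X \<in> pi_star_Q X 0 ` carrier (H_Q X (l1 X) 0) \<longleftrightarrow> (\<exists>s. cocycle_lifting_one_Q X s)"
    "connecting_Q X 0 (one_Q_class X) = \<one>\<^bsub>H_Q X (l1_0 X) 1\<^esub> \<longleftrightarrow> (\<exists>s. cocycle_lifting_one_Q X s)"
    using in_image_iff[OF x dx Dx] connecting_iff[OF x dx Dx] unfolding cls by simp_all
qed

theorem W_conditions_iff:
  "one_W_class X \<in> pi_star_W X 0 ` carrier (H_W X (l1 X) 0) \<longleftrightarrow> (\<exists>\<eta>. cocycle_lifting_one_W X \<eta>)"
  "connecting_W X 0 (one_W_class X) = \<one>\<^bsub>H_W X (l1_0 X) 1\<^esub> \<longleftrightarrow> (\<exists>\<eta>. cocycle_lifting_one_W X \<eta>)"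
proof -
  interpret split_exact_bicomplexes "W_bicomplex X (l1_0 X)" "W_bicomplex X (l1 X)" "W_bicomplex X scalars"
    "W_iota X" "W_pi X" "\<lambda>p q. W_map (cochains X (l1 X) p (int q)) (cochains X (l1_0 X) p (int q)) (retr X)"
    "\<lambda>p q. W_map (cochains X scalars p (int q)) (cochains X (l1 X) p (int q)) sect"
    by (rule split_exact_W)
  note D = X_module.cont_linear_D[of X _ 0 0, simplified] and d = X_module.cont_linear_d[of X _ 0 0, simplified]
  interpret DL: cont_linear "cochains X (l1 X) 0 0" "cochains X (l1 X) (Suc 0) 0" "diff_D X 0 0"
    by (rule D[OF X_module_l1])
  interpret dL: cont_linear "cochains X (l1 X) 0 0" "cochains X (l1 X) 0 1" "diff_d X 0 0"
    by (rule d[OF X_module_l1])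
  interpret DS: cont_linear "cochains X scalars 0 0" "cochains X scalars (Suc 0) 0" "diff_D X 0 0"
    by (rule D[OF X_module_scalars])
  interpret dS: cont_linear "cochains X scalars 0 0" "cochains X scalars 0 1" "diff_d X 0 0"
    by (rule d[OF X_module_scalars])
  let ?x = "W_incl (cochains X scalars 0 0) (one_cochain X)"
  have incl_0: "W_incl (cochains X scalars p q) 0 = 0" for p q
  proof -
    interpret seminormed_space "cochains X scalars p q"
      by (rule X_module.seminormed_space_cochains[OF X_module_scalars])
    have "\<alpha> 0 = 0" if "\<alpha> \<in> cdual (cochains X scalars p q)" for \<alpha>
      using cdualD(2)[OF that space(1), of 0] by simp
    then show ?thesis by (auto simp: W_incl_def)
  qed
  have x: "?x \<in> carrier (bi_obj (W_bicomplex X scalars) 0 0)"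
    using DS.E.W_incl_bidual[OF one_cochain_in] by (simp add: W_bicomplex_def DS.E.W_completion_simps)
  have dx: "bi_d (W_bicomplex X scalars) 0 0 ?x = \<one>\<^bsub>bi_obj (W_bicomplex X scalars) 0 1\<^esub>"
    using dS.W_map_incl[OF one_cochain_in] one_cochain_cocycle(2)[of X]
    by (simp add: W_bicomplex_def dS.F.W_completion_simps incl_0)
  have Dx: "bi_D (W_bicomplex X scalars) 0 0 ?x = \<one>\<^bsub>bi_obj (W_bicomplex X scalars) 1 0\<^esub>"
    using DS.W_map_incl[OF one_cochain_in] one_cochain_cocycle(1)[of X]
    by (simp add: W_bicomplex_def DS.F.W_completion_simps incl_0)
  have cls: "one_W_class X = coh_class (W_bicomplex X scalars) 0 (C.single ?x)"
    by (simp only: one_W_class_def C.single_def)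
  have "(\<exists>y\<in>carrier (bi_obj (W_bicomplex X (l1 X)) 0 0). W_pi X 0 0 y = ?x
      \<and> bi_d (W_bicomplex X (l1 X)) 0 0 y = \<one>\<^bsub>bi_obj (W_bicomplex X (l1 X)) 0 1\<^esub>
      \<and> bi_D (W_bicomplex X (l1 X)) 0 0 y = \<one>\<^bsub>bi_obj (W_bicomplex X (l1 X)) 1 0\<^esub>)
    \<longleftrightarrow> (\<exists>\<eta>. cocycle_lifting_one_W X \<eta>)" (is "?L \<longleftrightarrow> ?R")
    unfolding cocycle_lifting_one_W_def
    by (auto simp: W_bicomplex_def W_pi_def DL.E.W_completion_simps dL.F.W_completion_simps DL.F.W_completion_simps)
  then show "one_W_class X \<in> pi_star_W X 0 ` carrier (H_W X (l1 X) 0) \<longleftrightarrow> (\<exists>\<eta>. cocycle_lifting_one_W X \<eta>)"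
    "connecting_W X 0 (one_W_class X) = \<one>\<^bsub>H_W X (l1_0 X) 1\<^esub> \<longleftrightarrow> (\<exists>\<eta>. cocycle_lifting_one_W X \<eta>)"
    using in_image_iff[OF x dx Dx] connecting_iff[OF x dx Dx] unfolding cls by simp_all
qed

section \<open>Property A and invariant means\<close>

subsection \<open>From property A to a cocycle of bounded sequences\<close>

lemma diff_D_singleton:
  "x \<in> X \<Longrightarrow> y \<in> X \<Longrightarrow> ys \<in> tuples X (nat (q + 1)) \<Longrightarrow> diff_D X 0 q \<phi> [x, y] ys = \<phi> [y] ys - \<phi> [x] ys"
  using scaleC_minus1[of "\<phi> [x] ys"]
  by (simp add: diff_D_def tuples_2 numeral_2_eq_2 omit_def scaleC_one scaleC_minus1)

lemma diff_d_singleton: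
  "z \<in> X \<Longrightarrow> x \<in> X \<Longrightarrow> y \<in> X \<Longrightarrow> diff_d X 0 0 \<phi> [z] [x, y] = \<phi> [z] [y] - \<phi> [z] [x]"
  by (simp add: diff_d_def tuples_1 tuples_2 numeral_2_eq_2 omit_def scaleC_one scaleC_minus1)

lemma prob_on_sum: "f \<in> prob_on X \<Longrightarrow> l1_sum X f = 1"
proof -
  assume f: "f \<in> prob_on X"
  then have "f x = of_real (cmod (f x))" if "x \<in> X" for x
    using that by (auto simp: prob_on_def nonneg_Reals_def)
  then have "l1_sum X f = (\<Sum>\<^sub>\<infinity>x\<in>X. of_real (cmod (f x)))" unfolding l1_sum_def by (intro infsum_cong)
  also have "\<dots> = of_real (\<Sum>\<^sub>\<infinity>x\<in>X. cmod (f x))" using f by (intro infsumI has_sum_of_real_iff[THEN iffD2] has_sum_infsum) (simp add: prob_on_def)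
  finally show ?thesis using f by (simp add: prob_on_def)
qed

text \<open>The cochains \<open>\<phi>\<^sub>n (x, y) = f\<^sub>n x\<close> do not depend on \<open>y\<close>, so \<open>d\<close> annihilates them, and \<open>D \<phi>\<^sub>n\<close> is the
  difference of two values of \<open>f\<^sub>n\<close> at points within distance \<open>R\<close>.\<close>

theorem property_A_imp_cocycle:
  assumes "property_A X"
  shows "\<exists>s. cocycle_lifting_one_Q X s"
proof -
  let ?E = "cochains X (l1 X) 0 0" and ?F = "cochains X (l1 X) (Suc 0) 0"
  interpret L: X_module X "l1 X" by (rule X_module_l1)
  interpret S: X_module X "scalars :: ('a, complex) xmodule" by (rule X_module_scalars)
  interpret E: seminormed_space ?E by (rule L.seminormed_space_cochains)
  interpret ED: cont_linear ?E ?F "diff_D X 0 0"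
    by (rule L.cont_linear_D)
  interpret Ed: cont_linear ?E "cochains X (l1 X) 0 1" "diff_d X 0 0"
    using L.cont_linear_d[of 0 0] by simp
  obtain f S where f: "\<forall>n. \<forall>x\<in>X. f n x \<in> prob_on X \<and> m_supp (l1 X) (f n x) \<subseteq> cball x (S n)"
    and inv: "\<forall>R\<ge>0. uniform_limit {(x0, x1). x0 \<in> X \<and> x1 \<in> X \<and> dist x0 x1 \<le> R}
      (\<lambda>n (x0, x1). m_norm (l1 X) (f n x1 - f n x0)) (\<lambda>_. 0) sequentially"
    using assms unfolding property_A_def by (elim exE conjE)
  define s :: "nat \<Rightarrow> ('a, 'a \<Rightarrow> complex) cochain" where
    "s n = (\<lambda>xs ys. if xs \<in> tuples X 1 \<and> ys \<in> tuples X 1 then f n (hd xs) else 0)" for n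
  have s_app: "s n [x] [y] = f n x" if "x \<in> X" "y \<in> X" for n x y
    using that by (simp add: s_def tuples_1)
  have f1: "f n x \<in> m_space (l1 X)" "m_norm (l1 X) (f n x) = 1" if "x \<in> X" for n x
    using f that unfolding prob_on_def by (simp_all del: l1_selectors)
  have norm_s: "m_norm (l1 X) (s n xs ys) \<le> 1" if "xs \<in> tuples X 1" "ys \<in> tuples X 1" for n xs ys
    using that f1(2) by (auto simp: s_def tuples_1 simp del: l1_selectors)
  have s_in: "s n \<in> sn_space ?E" for n
    unfolding L.sn_space_cochains
  proof (intro conjI allI impI)
    show "s n xs ys \<in> m_space (l1 X)" for xs ys
      using f1(1) L.m_space(1) by (auto simp: s_def tuples_1 simp del: l1_selectors)
    show "s n xs ys = 0" if "(xs, ys) \<notin> tuples X (0 + 1) \<times> tuples X (nat (0 + 1))" for xs ys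
      using that by (auto simp: s_def)
    show "controlled_supports X (l1 X) 0 0 (s n)"
      unfolding controlled_supports_iff
    proof (intro allI impI)
      fix R :: real assume R: "R > 0"
      have "m_supp (l1 X) (s n xs ys) \<subseteq> cball z (R + \<bar>S n\<bar>)"
        if xy: "(xs, ys) \<in> close_pairs X R (0 + 1) (nat (0 + 1))" and z: "z \<in> set xs \<union> set ys" for xs ys z
      proof -
        obtain x y where x: "x \<in> X" "xs = [x]" and y: "y \<in> X" "ys = [y]"
          using xy by (auto simp: close_pairs_iff tuples_1)
        have "dist z x \<le> R" using xy z unfolding close_pairs_iff by (auto simp: x y)
        moreover have "dist x w \<le> \<bar>S n\<bar>" if "w \<in> m_supp (l1 X) (f n x)" for w
          using f x(1) that by (fastforce simp del: l1_selectors)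
        ultimately have "dist z w \<le> R + \<bar>S n\<bar>" if "w \<in> m_supp (l1 X) (f n x)" for w
          using dist_triangle[of z w x] that by fastforce
        then show ?thesis by (auto simp: x y s_app simp del: l1_selectors)
      qed
      then show "\<exists>S>0. supports_within X (l1 X) 0 0 R S (s n)"
        using R by (intro exI[of _ "R + \<bar>S n\<bar>"]) (auto simp: supports_within_def)
    qed
    show "\<exists>C. \<forall>xs\<in>close_tuples X (real (Suc i)) (0 + 1). \<forall>ys\<in>tuples X (nat (0 + 1)). m_norm (l1 X) (s n xs ys) \<le> C" for i
      using norm_s by (intro exI[of _ "1::real"]) (auto simp: close_tuples_def simp del: l1_selectors)
  qed
  have "snorm ?E i (s n) \<le> 1" for i n
    using norm_s by (intro L.snorm_cochains_le) (auto simp: close_tuples_def simp del: l1_selectors)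
  then have bounded: "s \<in> bounded_seqs ?E"
    using s_in by (auto simp: E.bounded_seqs_iff)
  have "(\<lambda>n. snorm ?F i (diff_D X 0 0 (s n))) \<longlonglongrightarrow> 0" for i
  proof (rule LIMSEQ_I)
    fix e :: real assume e: "e > 0"
    have "uniform_limit {(x0, x1). x0 \<in> X \<and> x1 \<in> X \<and> dist x0 x1 \<le> real (Suc i)}
        (\<lambda>n (x0, x1). m_norm (l1 X) (f n x1 - f n x0)) (\<lambda>_. 0) sequentially"
      using inv by (simp del: l1_selectors of_nat_Suc)
    from uniform_limitD[OF this, of "e / 2"] e
    obtain N where N0: "\<forall>n\<ge>N. \<forall>z\<in>{(x0, x1). x0 \<in> X \<and> x1 \<in> X \<and> dist x0 x1 \<le> real (Suc i)}.
        dist (case z of (x0, x1) \<Rightarrow> m_norm (l1 X) (f n x1 - f n x0)) 0 < e / 2"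
      unfolding eventually_sequentially by (auto simp del: l1_selectors of_nat_Suc)
    have N: "m_norm (l1 X) (f n x1 - f n x0) < e / 2"
      if "n \<ge> N" "x0 \<in> X" "x1 \<in> X" "dist x0 x1 \<le> real (Suc i)" for n x0 x1
      using N0[rule_format, OF that(1), of "(x0, x1)"] that by (simp del: l1_selectors of_nat_Suc)
    have "snorm ?F i (diff_D X 0 0 (s n)) \<le> e / 2" if n: "n \<ge> N" for n
    proof (rule L.snorm_cochains_le)
      fix xs ys assume xs: "xs \<in> close_tuples X (real (Suc i)) (Suc 0 + 1)" and ys: "ys \<in> tuples X (nat (0 + 1))"
      obtain x0 x1 y where "x0 \<in> X" "x1 \<in> X" "xs = [x0, x1]" "dist x0 x1 \<le> real (Suc i)" "y \<in> X" "ys = [y]"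
        using xs ys by (auto simp: close_tuples_def tuples_1 tuples_2)
      then show "m_norm (l1 X) (diff_D X 0 0 (s n) xs ys) \<le> e / 2"
        using N[OF n, of x0 x1] by (simp add: diff_D_singleton tuples_1 s_app del: l1_selectors of_nat_Suc)
    qed (use e in simp)
    then have "\<forall>n\<ge>N. norm (snorm ?F i (diff_D X 0 0 (s n)) - 0) < e"
      using e ED.F.snorm_nonneg by (auto simp del: One_nat_def intro: order_le_less_trans[of _ "e / 2"])
    then show "\<exists>N. \<forall>n\<ge>N. norm (snorm ?F i (diff_D X 0 0 (s n)) - 0) < e" ..
  qed
  then have D: "(\<lambda>n. diff_D X 0 0 (s n)) \<in> null_seqs (cochains X (l1 X) 1 0)"
    using ED.maps[OF s_in] by (simp add: ED.F.null_seqs_iff)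
  have "diff_d X 0 0 (s n) = 0" for n
  proof (intro ext)
    fix xs ys z
    show "diff_d X 0 0 (s n) xs ys z = 0 xs ys z"
    proof (cases "xs \<in> tuples X 1 \<and> ys \<in> tuples X 2")
      case True
      then obtain x y0 y1 where "x \<in> X" "y0 \<in> X" "y1 \<in> X" "xs = [x]" "ys = [y0, y1]"
        by (auto simp: tuples_1 tuples_2 numeral_2_eq_2)
      then show ?thesis by (simp add: diff_d_singleton s_app)
    qed (auto simp: diff_d_def)
  qed
  then have d: "(\<lambda>n. diff_d X 0 0 (s n)) \<in> null_seqs (cochains X (l1 X) 0 1)"
    by (simp add: Ed.F.null_seqs_iff Ed.F.space)
  have "l1_sum X (f n x) = 1" if "x \<in> X" for n x
    using f prob_on_sum that by blast
  moreover have "l1_sum X 0 = 0" by (simp add: l1_sum_def)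
  ultimately have "push (l1_sum X) (s n) = one_cochain X" for n
    by (auto simp: push_def fun_eq_iff one_cochain_apply s_def tuples_1)
  then have "(\<lambda>n. push (l1_sum X) (s n)) - (\<lambda>n. one_cochain X) = 0" by (simp add: fun_eq_iff)
  moreover have "0 \<in> null_seqs (cochains X scalars 0 0)"
    by (rule csubspaceD(1)[OF seminormed_space.null_seqs_csubspace[OF S.seminormed_space_cochains]])
  ultimately have "(\<lambda>n. push (l1_sum X) (s n)) - (\<lambda>n. one_cochain X) \<in> null_seqs (cochains X scalars 0 0)"
    by simp
  then show ?thesis using bounded D d unfolding cocycle_lifting_one_Q_def by blast
qed

subsection \<open>From sequences to the bidual\<close>

text \<open>The equations that a sequence satisfies up to null sequences hold exactly in the limit.\<close>

theorem Q_cocycle_imp_W_cocycle: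
  assumes "cocycle_lifting_one_Q X s"
  shows "cocycle_lifting_one_W X (W_limit (cochains X (l1 X) 0 0) s)"
proof -
  interpret L: X_module X "l1 X" by (rule X_module_l1)
  interpret D: cont_linear "cochains X (l1 X) 0 0" "cochains X (l1 X) (Suc 0) 0" "diff_D X 0 0"
    by (rule L.cont_linear_D)
  interpret d: cont_linear "cochains X (l1 X) 0 0" "cochains X (l1 X) 0 1" "diff_d X 0 0"
    using L.cont_linear_d[of 0 0] by simp
  interpret P: cont_linear "cochains X (l1 X) 0 0" "cochains X scalars 0 0" "push (l1_sum X)"
    by (rule cont_linear_l1_sum)
  have s: "s \<in> bounded_seqs (cochains X (l1 X) 0 0)"
    using assms by (simp add: cocycle_lifting_one_Q_def)
  have "W_limit (cochains X scalars 0 0) (\<lambda>n. push (l1_sum X) (s n)) = W_limit (cochains X scalars 0 0) (\<lambda>n. one_cochain X)"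
    using assms by (intro P.F.W_limit_eqI P.F.const_bounded one_cochain_in) (simp add: cocycle_lifting_one_Q_def)
  then show ?thesis
    using assms D.E.W_limit_bidual[OF s] D.W_map_limit[OF s] d.W_map_limit[OF s] P.W_map_limit[OF s]
    by (simp add: cocycle_lifting_one_W_def cocycle_lifting_one_Q_def D.F.W_limit_null d.F.W_limit_null P.F.W_limit_const)
qed

subsection \<open>From a cocycle to a mean\<close>

text \<open>The restriction of \<open>\<phi> (x, y)\<close> to \<open>y = x\<close>. A constant \<open>y\<close> instead would not preserve controlled
  supports, as \<open>y\<close> has to stay close to \<open>x\<close>.\<close>

definition diagonal :: "'x set \<Rightarrow> ('x, 'v::zero) cochain \<Rightarrow> ('x, 'v) cochain" where
  "diagonal X = reindex X 1 0 (\<lambda>xs ys. xs) (\<lambda>xs ys. xs)"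

lemma cont_linear_diagonal:
  assumes "X_module X M"
  shows "cont_linear (cochains X M 0 0) (cochains X M 0 (-1)) (diagonal X)"
  using X_module.cont_linear_reindex[OF assms, of 0 "-1" "\<lambda>xs ys. xs" 0 "\<lambda>xs ys. xs" 0]
  by (simp add: diagonal_def)

text \<open>\<open>\<phi> (y, y) - \<phi> (x, x) = (\<phi> (y, y) - \<phi> (x, y)) + (\<phi> (x, y) - \<phi> (x, x))\<close>, where the first bracket is a
  value of \<open>D \<phi>\<close> and the second one is a value of \<open>d \<phi>\<close>.\<close>

lemma D_diagonal:
  "diff_D X 0 (-1) (diagonal X \<phi>) =
     reindex X 2 0 (\<lambda>xs ys. xs) (\<lambda>xs ys. [xs ! 1]) (diff_D X 0 0 \<phi>)
     + reindex X 2 0 (\<lambda>xs ys. [xs ! 0]) (\<lambda>xs ys. xs) (diff_d X 0 0 \<phi>)"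
proof (intro ext)
  fix xs ys :: "'a list"
  show "diff_D X 0 (-1) (diagonal X \<phi>) xs ys = (reindex X 2 0 (\<lambda>xs ys. xs) (\<lambda>xs ys. [xs ! 1]) (diff_D X 0 0 \<phi>)
     + reindex X 2 0 (\<lambda>xs ys. [xs ! 0]) (\<lambda>xs ys. xs) (diff_d X 0 0 \<phi>)) xs ys"
  proof (cases "xs \<in> tuples X 2 \<and> ys \<in> tuples X 0")
    case True
    then obtain x y where "x \<in> X" "y \<in> X" "xs = [x, y]" "ys = []"
      by (auto simp: tuples_0 tuples_2 numeral_2_eq_2)
    then show ?thesis
      by (simp add: diff_D_singleton diff_d_singleton reindex_def diagonal_def tuples_0 tuples_1 tuples_2 numeral_2_eq_2)
  qed (auto simp: reindex_def diff_D_def numeral_2_eq_2)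
qed

text \<open>The formula for \<open>D\<close> on the diagonal is an identity of continuous linear maps, so it holds in the
  bidual, where it shows that a cocycle restricts to an invariant element.\<close>

theorem W_cocycle_imp_mean:
  assumes "cocycle_lifting_one_W X \<eta>"
  shows "asymptotically_invariant_mean X (W_map (cochains X (l1 X) 0 0) (cochains X (l1 X) 0 (-1)) (diagonal X) \<eta>)"
proof -
  interpret L: X_module X "l1 X" by (rule X_module_l1)
  let ?E = "cochains X (l1 X)" and ?S = "cochains X scalars"
  let ?s1 = "reindex X 2 0 (\<lambda>xs ys. xs) (\<lambda>xs ys. [xs ! 1]) :: ('a, 'a \<Rightarrow> complex) cochain \<Rightarrow> _"
  let ?s2 = "reindex X 2 0 (\<lambda>xs ys. [xs ! 0]) (\<lambda>xs ys. xs) :: ('a, 'a \<Rightarrow> complex) cochain \<Rightarrow> _"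
  note diagonal = cont_linear_diagonal[OF X_module_l1] cont_linear_diagonal[OF X_module_scalars]
  have D0: "cont_linear (?E 0 0) (?E 1 0) (diff_D X 0 0)"
    using L.cont_linear_D[of 0 0] by simp
  have D1: "cont_linear (?E 0 (-1)) (?E 1 (-1)) (diff_D X 0 (-1))"
    using L.cont_linear_D[of 0 "-1"] by simp
  have d0: "cont_linear (?E 0 0) (?E 0 1) (diff_d X 0 0)"
    using L.cont_linear_d[of 0 0] by simp
  have "cont_linear (?E 1 0) (?E 1 (-1)) (reindex X (1 + 1) (nat (-1 + 1)) (\<lambda>xs ys. xs) (\<lambda>xs ys. [xs ! 1]))"
    by (rule L.cont_linear_reindex) (auto simp: tuples_1 tuples_2 numeral_2_eq_2)
  then have s1: "cont_linear (?E 1 0) (?E 1 (-1)) ?s1" by (simp add: numeral_2_eq_2)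
  have "cont_linear (?E 0 1) (?E 1 (-1)) (reindex X (1 + 1) (nat (-1 + 1)) (\<lambda>xs ys. [xs ! 0]) (\<lambda>xs ys. xs))"
    by (rule L.cont_linear_reindex) (auto simp: tuples_1 tuples_2 numeral_2_eq_2)
  then have s2: "cont_linear (?E 0 1) (?E 1 (-1)) ?s2" by (simp add: numeral_2_eq_2)
  interpret diag: cont_linear "?E 0 0" "?E 0 (-1)" "diagonal X" by (rule diagonal(1))
  interpret diagS: cont_linear "?S 0 0" "?S 0 (-1)" "diagonal X" by (rule diagonal(2))
  let ?\<mu> = "W_map (?E 0 0) (?E 0 (-1)) (diagonal X) \<eta>"
  have \<eta>: "\<eta> \<in> bidual (?E 0 0)" using assms by (simp add: cocycle_lifting_one_W_def)
  have zero: "W_map (?E p q) F T 0 = 0" for p q F and T :: "('a, 'a \<Rightarrow> complex) cochain \<Rightarrow> ('a, 'a \<Rightarrow> complex) cochain"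
    by (auto simp: W_map_def)
  have "W_map (?E 0 (-1)) (?E 1 (-1)) (diff_D X 0 (-1)) ?\<mu>
      = W_map (?E 1 0) (?E 1 (-1)) ?s1 (W_map (?E 0 0) (?E 1 0) (diff_D X 0 0) \<eta>)
        + W_map (?E 0 1) (?E 1 (-1)) ?s2 (W_map (?E 0 0) (?E 0 1) (diff_d X 0 0) \<eta>)"
    unfolding W_map_comp[OF diagonal(1) D1] W_map_comp[OF D0 s1] W_map_comp[OF d0 s2] D_diagonal
    by (rule W_map_sum[OF cont_linear_comp[OF D0 s1] cont_linear_comp[OF d0 s2] \<eta>])
  also have "\<dots> = 0" using assms by (simp add: cocycle_lifting_one_W_def zero)
  finally have "W_map (?E 0 (-1)) (?E 1 (-1)) (diff_D X 0 (-1)) ?\<mu> = 0" .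
  moreover have "W_map (?E 0 (-1)) (?S 0 (-1)) (push (l1_sum X)) ?\<mu>
      = W_map (?S 0 0) (?S 0 (-1)) (diagonal X) (W_map (?E 0 0) (?S 0 0) (push (l1_sum X)) \<eta>)"
    by (rule W_map_square[OF diagonal(1) cont_linear_l1_sum cont_linear_l1_sum diagonal(2)])
      (simp add: push_def diagonal_def reindex_def fun_eq_iff l1_sum_def if_distrib cong: if_cong)
  moreover have "W_map (?S 0 0) (?S 0 (-1)) (diagonal X) (W_map (?E 0 0) (?S 0 0) (push (l1_sum X)) \<eta>)
      = W_incl (?S 0 (-1)) (const_one X)"
  proof -
    have "diagonal X (one_cochain X) = const_one X"
      unfolding diagonal_def reindex_def one_cochain_apply by (auto simp: fun_eq_iff const_one_def)
    then show ?thesis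
      using assms diagS.W_map_incl[OF one_cochain_in] by (simp add: cocycle_lifting_one_W_def)
  qed
  ultimately show ?thesis
    using diag.W_map_bidual[OF \<eta>] unfolding asymptotically_invariant_mean_def
    by (simp add: diag.F.W_completion_simps W_completion_def)
qed

subsection \<open>From a mean to property A\<close>

text \<open>The invariant mean is the obstruction to separating \<open>D\<close> of one cochain of sum \<open>1\<close>, here \<open>sect 1\<close>, from
  \<open>D\<close> of the cochains of sum \<open>0\<close>: a separating functional pulls back along \<open>D\<close> to a functional of the
  sums alone, on which invariance and normalization force the mean to take contradictory values.\<close>

theorem mean_imp_almost_invariant:
  assumes \<mu>: "asymptotically_invariant_mean X \<mu>" and \<epsilon>: "\<epsilon> > 0"
  shows "\<exists>\<phi>\<in>sn_space (cochains X (l1 X) 0 (-1)). push (l1_sum X) \<phi> = const_one X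
     \<and> snorm (cochains X (l1 X) 1 (-1)) i (diff_D X 0 (-1) \<phi>) < \<epsilon>"
proof (rule ccontr)
  assume "\<not> ?thesis"
  then have far: "\<epsilon> \<le> snorm (cochains X (l1 X) 1 (-1)) i (diff_D X 0 (-1) \<phi>)"
    if "\<phi> \<in> sn_space (cochains X (l1 X) 0 (-1))" "push (l1_sum X) \<phi> = const_one X" for \<phi>
    using that by force
  let ?E = "cochains X (l1 X) 0 (-1)" and ?F = "cochains X (l1 X) 1 (-1)" and ?S = "cochains X scalars 0 (-1)"
  let ?D = "diff_D X 0 (-1) :: ('a, 'a \<Rightarrow> complex) cochain \<Rightarrow> _"
  interpret D: cont_linear ?E ?F ?D
    using X_module.cont_linear_D[OF X_module_l1, of X 0 "-1"] by simp
  interpret P: cont_linear ?E ?S "push (l1_sum X)" by (rule cont_linear_l1_sum)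
  interpret sect: cont_linear ?S ?E sect by (rule cont_linear_sect)
  let ?K = "{\<phi> \<in> sn_space ?E. push (l1_sum X) \<phi> = 0}"
  let ?u = "?D (sect (const_one X))"
  have P0: "push (l1_sum X) (0 :: ('a, 'a \<Rightarrow> complex) cochain) = 0" using P.scaleC[OF D.E.space(1), of 0] by simp
  have D0: "?D 0 = 0" using D.scaleC[OF D.E.space(1), of 0] by simp
  have K: "csubspace ?K"
    by (auto simp: csubspace_def D.E.space P.add P.scaleC P0)
  have W: "csubspace (?D ` ?K)"
    unfolding csubspace_def
  proof (intro conjI ballI allI)
    show "0 \<in> ?D ` ?K" using csubspaceD(1)[OF K] D0 by force
    fix v w c assume "v \<in> ?D ` ?K"
    then obtain \<phi> where \<phi>: "\<phi> \<in> ?K" "v = ?D \<phi>" by blast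
    then show "c *\<^sub>C v \<in> ?D ` ?K" using csubspaceD(3)[OF K \<phi>(1), of c] D.scaleC[of \<phi> c] by force
    assume "w \<in> ?D ` ?K"
    then obtain \<psi> where \<psi>: "\<psi> \<in> ?K" "w = ?D \<psi>" by blast
    then show "v + w \<in> ?D ` ?K" using \<phi> csubspaceD(2)[OF K \<phi>(1) \<psi>(1)] D.add[of \<phi> \<psi>] by force
  qed
  have s1: "sect (const_one X) \<in> sn_space ?E" by (rule sect.maps[OF const_one_in])
  have pos: "\<epsilon> \<le> snorm ?F i (?u - w)" if w: "w \<in> ?D ` ?K" for w
  proof -
    obtain \<psi> where \<psi>: "\<psi> \<in> sn_space ?E" "push (l1_sum X) \<psi> = 0" "w = ?D \<psi>" using w by blast
    have "push (l1_sum X) (sect (const_one X) - \<psi>) = const_one X"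
      using P.diff[OF s1 \<psi>(1)] \<psi>(2) push_sum_sect[OF const_one_in] by simp
    then show ?thesis using far[OF D.E.space(5)[OF s1 \<psi>(1)]] D.diff[OF s1 \<psi>(1)] \<psi>(3) by simp
  qed
  have "\<exists>\<alpha>. clinear_on (sn_space ?F) \<alpha> \<and> (\<forall>w\<in>?D ` ?K. \<alpha> w = 0) \<and> \<alpha> ?u \<noteq> 0 \<and> (\<forall>\<psi>\<in>sn_space ?F. cmod (\<alpha> \<psi>) \<le> snorm ?F i \<psi>)"
  proof (rule Hahn_Banach_separation[where p = "snorm ?F i" and \<delta> = \<epsilon>])
    show "?D ` ?K \<subseteq> sn_space ?F" using D.maps by blast
  qed (fact D.F.subspace W D.F.triangle D.F.scale D.maps[OF s1] \<epsilon> pos)+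
  then obtain \<alpha>0 where \<alpha>0: "clinear_on (sn_space ?F) \<alpha>0" "\<forall>w\<in>?D ` ?K. \<alpha>0 w = 0" "\<alpha>0 ?u \<noteq> 0"
    "\<forall>\<psi>\<in>sn_space ?F. cmod (\<alpha>0 \<psi>) \<le> snorm ?F i \<psi>" by (elim exE conjE)
  \<comment> \<open>elements of the dual vanish off the space\<close>
  define \<alpha> where "\<alpha> \<psi> = (if \<psi> \<in> sn_space ?F then \<alpha>0 \<psi> else 0)" for \<psi>
  have \<alpha>: "\<alpha> \<in> cdual ?F"
    unfolding D.F.cdual_iff
  proof (intro conjI exI)
    show "clinear_on (sn_space ?F) \<alpha>" using \<alpha>0(1) D.F.space by (simp add: clinear_on_def \<alpha>_def)
    show "vanishes_off (sn_space ?F) \<alpha>" by (simp add: vanishes_off_def \<alpha>_def)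
    show "\<forall>\<phi>\<in>sn_space ?F. cmod (\<alpha> \<phi>) \<le> 1 * snorm ?F i \<phi>" using \<alpha>0(4) by (simp add: \<alpha>_def)
  qed
  define \<gamma> where "\<gamma> = transpose_map ?E ?D \<alpha>"
  define \<beta> where "\<beta> = transpose_map ?S sect \<gamma>"
  have \<gamma>: "\<gamma> \<in> cdual ?E" unfolding \<gamma>_def by (rule D.transpose_map_cdual[OF \<alpha>])
  have \<beta>: "\<beta> \<in> cdual ?S" unfolding \<beta>_def by (rule sect.transpose_map_cdual[OF \<gamma>])
  \<comment> \<open>\<open>\<phi> - sect (\<pi> \<phi>)\<close> has sum zero, so \<open>\<gamma>\<close> does not distinguish \<open>\<phi>\<close> from \<open>sect (\<pi> \<phi>)\<close>.\<close>
  have "\<gamma> = transpose_map ?E (push (l1_sum X)) \<beta>"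
  proof
    fix \<phi>
    show "\<gamma> \<phi> = transpose_map ?E (push (l1_sum X)) \<beta> \<phi>"
    proof (cases "\<phi> \<in> sn_space ?E")
      case True
      let ?\<psi> = "\<phi> - sect (push (l1_sum X) \<phi>)"
      have s: "sect (push (l1_sum X) \<phi>) \<in> sn_space ?E" by (rule sect.maps[OF P.maps[OF True]])
      have "push (l1_sum X) ?\<psi> = 0" using P.diff[OF True s] push_sum_sect[OF P.maps[OF True]] by simp
      then have "?\<psi> \<in> ?K" using D.E.space(5)[OF True s] by simp
      then have "\<gamma> ?\<psi> = 0" using \<alpha>0(2) D.maps by (auto simp: \<gamma>_def transpose_map_def \<alpha>_def)
      moreover have "\<gamma> (?\<psi> + sect (push (l1_sum X) \<phi>)) = \<gamma> ?\<psi> + \<gamma> (sect (push (l1_sum X) \<phi>))"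
        by (rule D.E.cdualD(1)[OF \<gamma> D.E.space(5)[OF True s] s])
      ultimately have "\<gamma> \<phi> = \<gamma> (sect (push (l1_sum X) \<phi>))" by simp
      then show ?thesis using True P.maps[OF True] by (simp add: transpose_map_def \<beta>_def)
    qed (simp add: \<gamma>_def transpose_map_def)
  qed
  then have "W_map ?E ?F ?D \<mu> \<alpha> = W_map ?E ?S (push (l1_sum X)) \<mu> \<beta>"
    using \<alpha> \<beta> by (simp add: W_map_def \<gamma>_def)
  then have "0 = \<beta> (const_one X)"
    using \<mu> \<alpha> \<beta> by (simp add: asymptotically_invariant_mean_def W_incl_def W_completion_def)
  also have "\<dots> = \<alpha>0 ?u"
    using const_one_in[of X] s1 D.maps[OF s1] by (simp add: \<beta>_def \<gamma>_def transpose_map_def \<alpha>_def)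
  finally show False using \<alpha>0(3) by simp
qed

definition normalized_abs :: "'x set \<Rightarrow> ('x \<Rightarrow> complex) \<Rightarrow> 'x \<Rightarrow> complex" where
  "normalized_abs X f = (\<lambda>x. complex_of_real (cmod (f x) / m_norm (l1 X) f))"

lemma normalized_abs_prob:
  fixes X :: "'x::metric_space set"
  assumes a: "a \<in> m_space (l1 X)" and ge: "m_norm (l1 X) a \<ge> 1"
  shows "normalized_abs X a \<in> prob_on X" "m_supp (l1 X) (normalized_abs X a) = m_supp (l1 X) a"
proof -
  have pos: "m_norm (l1 X) a > 0" using ge by simp
  have abs: "cmod (normalized_abs X a x) = (1 / m_norm (l1 X) a) * cmod (a x)" for x
    using pos by (simp add: normalized_abs_def norm_divide del: l1_selectors)
  have "(\<lambda>x. cmod (normalized_abs X a x)) summable_on X"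
    unfolding abs using a by (intro summable_on_cmult_right) simp
  moreover have "vanishes_off X (normalized_abs X a)"
    using a by (simp add: vanishes_off_def normalized_abs_def)
  moreover have "m_norm (l1 X) (normalized_abs X a) = (1 / m_norm (l1 X) a) * m_norm (l1 X) a"
    unfolding l1_selectors(2)[of X "normalized_abs X a"] abs infsum_cmult_right' by simp
  then have "m_norm (l1 X) (normalized_abs X a) = 1" using pos by (simp del: l1_selectors)
  moreover have "normalized_abs X a x \<in> \<real>\<^sub>\<ge>\<^sub>0" for x
    unfolding normalized_abs_def nonneg_Reals_of_real_iff using pos by (intro divide_nonneg_nonneg) auto
  ultimately show "normalized_abs X a \<in> prob_on X" by (simp add: prob_on_def)
  show "m_supp (l1 X) (normalized_abs X a) = m_supp (l1 X) a"
    using pos by (auto simp: normalized_abs_def)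
qed

text \<open>Both steps of the normalization are controlled by the distance of \<open>a\<close> and \<open>b\<close>: taking absolute values
  is a contraction, and dividing by norms that are at least \<open>1\<close> costs at most another copy of the
  distance.\<close>

lemma normalized_abs_Lipschitz:
  fixes X :: "'x::metric_space set"
  assumes a: "a \<in> m_space (l1 X)" and b: "b \<in> m_space (l1 X)"
    and ge: "m_norm (l1 X) a \<ge> 1" "m_norm (l1 X) b \<ge> 1"
  shows "m_norm (l1 X) (normalized_abs X b - normalized_abs X a) \<le> 2 * m_norm (l1 X) (b - a)"
proof -
  interpret L: X_module X "l1 X" by (rule X_module_l1)
  let ?n = "m_norm (l1 X)"
  define A where "A = (\<lambda>x. complex_of_real (cmod (a x)))"
  define B where "B = (\<lambda>x. complex_of_real (cmod (b x)))"
  have in_l1: "A \<in> m_space (l1 X)" "B \<in> m_space (l1 X)"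
    using a b by (auto simp: A_def B_def vanishes_off_def)
  have BA: "B - A \<in> m_space (l1 X)" "b - a \<in> m_space (l1 X)"     by (rule L.m_space(5)[OF in_l1(2,1)], rule L.m_space(5)[OF b a])
  have nB: "?n B = ?n b" by (simp add: B_def)
  have "?n (B - A) \<le> ?n (b - a)"
    unfolding l1_selectors(2)
  proof (rule infsum_mono)
    show "(\<lambda>x. cmod ((B - A) x)) summable_on X" "(\<lambda>x. cmod ((b - a) x)) summable_on X"
      using BA by auto
    show "cmod ((B - A) x) \<le> cmod ((b - a) x)" for x
      using norm_triangle_ineq3[of "b x" "a x"] by (simp add: A_def B_def flip: of_real_diff)
  qed
  moreover have "\<bar>?n a - ?n b\<bar> \<le> ?n (b - a)"
  proof -
    have "?n b \<le> ?n (b - a) + ?n a" using L.norm_triangle[OF BA(2) a] by simp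
    moreover have "?n a \<le> ?n (a - b) + ?n b" using L.norm_triangle[OF L.m_space(5)[OF a b] b] by simp
    moreover have "?n (a - b) = ?n (b - a)" by (simp add: norm_minus_commute)
    ultimately show ?thesis by simp
  qed
  moreover have eq: "normalized_abs X b - normalized_abs X a
      = of_real (1 / ?n a) *\<^sub>C (B - A) + of_real (1 / ?n b - 1 / ?n a) *\<^sub>C B"
    by (simp add: fun_eq_iff normalized_abs_def A_def B_def algebra_simps diff_divide_distrib del: l1_selectors)
  have "?n (normalized_abs X b - normalized_abs X a)
      \<le> ?n (of_real (1 / ?n a) *\<^sub>C (B - A)) + ?n (of_real (1 / ?n b - 1 / ?n a) *\<^sub>C B)"
    unfolding eq by (rule L.norm_triangle[OF L.m_space(3)[OF BA(1)] L.m_space(3)[OF in_l1(2)]])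
  moreover have "?n (of_real (1 / ?n a) *\<^sub>C (B - A)) = 1 / ?n a * ?n (B - A)"
    unfolding L.norm_scale[OF BA(1)] using ge by (simp only: norm_of_real) simp
  moreover have "?n (of_real (1 / ?n b - 1 / ?n a) *\<^sub>C B) = \<bar>?n a - ?n b\<bar> / ?n a"
  proof -
    have "?n (of_real (1 / ?n b - 1 / ?n a) *\<^sub>C B) = \<bar>1 / ?n b - 1 / ?n a\<bar> * ?n b"
      unfolding L.norm_scale[OF in_l1(2)] nB norm_of_real ..
    also have "\<dots> = \<bar>(1 / ?n b - 1 / ?n a) * ?n b\<bar>" using ge unfolding abs_mult by (simp del: l1_selectors)
    also have "(1 / ?n b - 1 / ?n a) * ?n b = (?n a - ?n b) / ?n a" using ge by (simp add: field_simps del: l1_selectors)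
    also have "\<bar>(?n a - ?n b) / ?n a\<bar> = \<bar>?n a - ?n b\<bar> / ?n a" using ge by (simp add: abs_divide del: l1_selectors)
    finally show ?thesis .
  qed
  moreover have "t / ?n a \<le> t" if "t \<ge> 0" for t
    using mult_left_mono[OF ge(1) that] ge(1) by (simp add: field_simps del: l1_selectors)
  then have "1 / ?n a * ?n (B - A) \<le> ?n (B - A)" "\<bar>?n a - ?n b\<bar> / ?n a \<le> \<bar>?n a - ?n b\<bar>"
    using L.norm_nonneg[OF BA(1)] by (simp_all del: l1_selectors)
  ultimately show ?thesis by linarith
qed

text \<open>The functions \<open>\<phi>\<^sub>n x\<close> have sum \<open>1\<close>, hence norm at least \<open>1\<close>, so they can be normalized. The bounds
  for \<open>D \<phi>\<^sub>n\<close> in the \<open>n\<close>-th seminorm concern points within distance \<open>n + 1\<close>; for a given \<open>R\<close> they apply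
  as soon as \<open>n + 1 \<ge> R\<close>.\<close>

theorem mean_imp_property_A:
  assumes \<mu>: "asymptotically_invariant_mean X \<mu>"
  shows "property_A X"
proof -
  interpret L: X_module X "l1 X" by (rule X_module_l1)
  interpret D: cont_linear "cochains X (l1 X) 0 (-1)" "cochains X (l1 X) 1 (-1)" "diff_D X 0 (-1)"
    using L.cont_linear_D[of 0 "-1"] by simp
  have "\<forall>n. \<exists>\<phi>. \<phi> \<in> sn_space (cochains X (l1 X) 0 (-1)) \<and> push (l1_sum X) \<phi> = const_one X
      \<and> snorm (cochains X (l1 X) 1 (-1)) n (diff_D X 0 (-1) \<phi>) < 1 / real (Suc n)"
    using mean_imp_almost_invariant[OF \<mu>] by (simp add: Bex_def del: of_nat_Suc)
  then obtain \<phi> where \<phi>: "\<forall>n. \<phi> n \<in> sn_space (cochains X (l1 X) 0 (-1)) \<and> push (l1_sum X) (\<phi> n) = const_one X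
      \<and> snorm (cochains X (l1 X) 1 (-1)) n (diff_D X 0 (-1) (\<phi> n)) < 1 / real (Suc n)"
    by (rule choice[THEN exE])
  \<comment> \<open>A single point is a tuple that is close at every scale.\<close>
  have "\<forall>n. \<exists>S. supports_within X (l1 X) 0 (-1) 1 S (\<phi> n)"
    using \<phi> zero_less_one unfolding L.sn_space_cochains controlled_supports_iff by blast
  then obtain S where S: "\<forall>n. supports_within X (l1 X) 0 (-1) 1 (S n) (\<phi> n)"
    by (rule choice[THEN exE])
  have in_l1: "\<phi> n [x] [] \<in> m_space (l1 X)" for n x using \<phi> by (intro L.cochain_in_m_space) blast
  have ge: "1 \<le> m_norm (l1 X) (\<phi> n [x] [])" if "x \<in> X" for n x
  proof -
    have "l1_sum X (\<phi> n [x] []) = push (l1_sum X) (\<phi> n) [x] []" by (simp add: push_def)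
    also have "\<dots> = 1" using \<phi> that by (simp add: const_one_def tuples_1 tuples_0)
    finally show ?thesis using l1_sum_bound[OF in_l1, of n x] by (simp del: l1_selectors)
  qed
  have supp: "m_supp (l1 X) (\<phi> n [x] []) \<subseteq> cball x (S n)" if "x \<in> X" for n x
    using S[unfolded supports_within_def, rule_format, of "[x]" "[]" x n] that by (simp add: close_pairs_iff tuples_1 tuples_0 del: l1_selectors)
  have close: "m_norm (l1 X) (\<phi> n [x1] [] - \<phi> n [x0] []) < 1 / real (Suc n)"
    if "x0 \<in> X" "x1 \<in> X" "dist x0 x1 \<le> real (Suc n)" for n x0 x1
  proof -
    have "[x0, x1] \<in> close_tuples X (real (Suc n)) (1 + 1)" "[] \<in> tuples X (nat (-1 + 1))"
      using that by (auto simp: close_tuples_def tuples_2 tuples_0 dist_commute)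
    from L.le_snorm_cochains[OF D.maps this] \<phi>
    have "m_norm (l1 X) (diff_D X 0 (-1) (\<phi> n) [x0, x1] []) < 1 / real (Suc n)"
      by (meson order_le_less_trans)
    then show ?thesis using that(1,2) by (simp add: diff_D_singleton tuples_0 del: l1_selectors of_nat_Suc)
  qed
  define f where "f n x = normalized_abs X (\<phi> n [x] [])" for n x
  show ?thesis
    unfolding property_A_def
  proof (intro exI conjI allI impI ballI)
    fix n x assume x: "x \<in> X"
    show "f n x \<in> prob_on X" unfolding f_def by (rule normalized_abs_prob(1)[OF in_l1 ge[OF x]])
    show "m_supp (l1 X) (f n x) \<subseteq> cball x (S n)"
      unfolding f_def normalized_abs_prob(2)[OF in_l1 ge[OF x]] by (rule supp[OF x])
  next
    fix R :: real assume "R \<ge> 0"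
    show "uniform_limit {(x0, x1). x0 \<in> X \<and> x1 \<in> X \<and> dist x0 x1 \<le> R}
               (\<lambda>n (x0, x1). m_norm (l1 X) (f n x1 - f n x0)) (\<lambda>_. 0) sequentially"
      unfolding uniform_limit_iff eventually_sequentially
    proof (intro allI impI)
      fix e :: real assume e: "e > 0"
      obtain N where N: "max R (2 / e) \<le> real N" using real_arch_simple[of "max R (2 / e)"] ..
      have "m_norm (l1 X) (f n x1 - f n x0) < e"
        if n: "n \<ge> N" and x: "x0 \<in> X" "x1 \<in> X" "dist x0 x1 \<le> R" for n x0 x1
      proof -
        have "max R (2 / e) \<le> real (Suc n)" by (rule order_trans[OF N]) (use n in simp)
        then have R: "R \<le> real (Suc n)" "2 / e \<le> real (Suc n)" by (simp_all only: max.bounded_iff)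
        have "m_norm (l1 X) (f n x1 - f n x0) \<le> 2 * m_norm (l1 X) (\<phi> n [x1] [] - \<phi> n [x0] [])"
          unfolding f_def by (rule normalized_abs_Lipschitz[OF in_l1 in_l1 ge[OF x(1)] ge[OF x(2)]])
        also have "\<dots> < 2 * (1 / real (Suc n))"
          using close[OF x(1,2) order_trans[OF x(3) R(1)]] by (rule mult_strict_left_mono) simp
        also have "\<dots> \<le> e" using R(2) e by (simp add: field_simps del: of_nat_Suc)
        finally show ?thesis .
      qed
      moreover have "m_norm (l1 X) (f n x1 - f n x0) \<ge> 0" for n x0 x1 by (simp add: infsum_nonneg)
      ultimately show "\<exists>N. \<forall>n\<ge>N. \<forall>z\<in>{(x0, x1). x0 \<in> X \<and> x1 \<in> X \<and> dist x0 x1 \<le> R}.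
          dist (case z of (x0, x1) \<Rightarrow> m_norm (l1 X) (f n x1 - f n x0)) 0 < e"
        by (intro exI[of _ N]) (auto simp del: l1_selectors)
    qed
  qed
qed

section \<open>The equivalence\<close>

theorem theorem10:
  fixes X :: "'x::metric_space set"
  assumes "discrete X"
  shows "(property_A X \<longleftrightarrow> one_Q_class X \<in> pi_star_Q X 0 ` carrier (H_Q X (l1 X) 0)) \<and>
         (one_Q_class X \<in> pi_star_Q X 0 ` carrier (H_Q X (l1 X) 0) \<longleftrightarrow>
            connecting_Q X 0 (one_Q_class X) = \<one>\<^bsub>H_Q X (l1_0 X) 1\<^esub>) \<and>
         (connecting_Q X 0 (one_Q_class X) = \<one>\<^bsub>H_Q X (l1_0 X) 1\<^esub> \<longleftrightarrow>
            connecting_W X 0 (one_W_class X) = \<one>\<^bsub>H_W X (l1_0 X) 1\<^esub>) \<and>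
         (connecting_W X 0 (one_W_class X) = \<one>\<^bsub>H_W X (l1_0 X) 1\<^esub> \<longleftrightarrow>
            one_W_class X \<in> pi_star_W X 0 ` carrier (H_W X (l1 X) 0)) \<and>
         (one_W_class X \<in> pi_star_W X 0 ` carrier (H_W X (l1 X) 0) \<longleftrightarrow>
            (\<exists>\<mu>. asymptotically_invariant_mean X \<mu>))"
proof -
  have "property_A X \<longleftrightarrow> (\<exists>s. cocycle_lifting_one_Q X s)"
    "(\<exists>s. cocycle_lifting_one_Q X s) \<longleftrightarrow> (\<exists>\<eta>. cocycle_lifting_one_W X \<eta>)"
    "(\<exists>\<eta>. cocycle_lifting_one_W X \<eta>) \<longleftrightarrow> (\<exists>\<mu>. asymptotically_invariant_mean X \<mu>)"
    using property_A_imp_cocycle[of X] Q_cocycle_imp_W_cocycle[of X] W_cocycle_imp_mean[of X]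
      mean_imp_property_A[of X] by blast+
  then show ?thesis unfolding Q_conditions_iff W_conditions_iff by blast
qed

end
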